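(* Let $n\ge3$, $0<\alpha<1$, let $\Omega\subset\mathbb R^n$ be a bounded domain with $C^{2,\alpha}$ boundary, and let $a_1,a_2\in C^{1,\alpha}(\overline\Omega\times\mathbb R\times\mathbb R^n)$ be positive nonlinearities. Assume that $a_j$ is independent of $p$, i.e. $a_j=a_j(x,z)$, $j=1,2$, and that $\Phi(x)=|x|^2/2$ is a common background solution, i.e. $$a_j\Big(x,\frac{|x|^2}{2}\Big)=1\quad\text{in }\Omega,\qquad j=1,2.$$ Suppose that $$q_j(x):=\partial_za_j\Big(x,\frac{|x|^2}{2}\Big)\ge0.$$ Let $\phi=\Phi|_{\partial\Omega}$. If the nonlinear Cauchy data sets agree near the background, $$\mathscr C_{a_1}^{(\phi,\partial_\nu\Phi|_{\partial\Omega})}=\mathscr C_{a_2}^{(\phi,\partial_\nu\Phi|_{\partial\Omega})},$$ then $$\partial_za_1\Big(x,\frac{|x|^2}{2}\Big)=\partial_za_2\Big(x,\frac{|x|^2}{2}\Big)\quad\text{in }\Omega.$$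
   Context: Nonlinearities are written $a=a(x,z,p)$, $x\in\overline\Omega$, $z\in\mathbb R$, $p\in\mathbb R^n$. $C^{k,\alpha}(\overline\Omega)$ is the usual Hölder space (norms required finite on unbounded sets); $C^{k,\alpha}(\partial\Omega)$ carries the quotient norm over extensions. $\nu$ is the exterior unit normal and $\partial_\nu$ the normal derivative. Nonlinear Cauchy data set: for $a=a_j$, local well-posedness provides $\delta>0$ and a neighbourhood $V$ of $\Phi$ in $C^{2,\alpha}(\overline\Omega)$ such that for every $\eta\in C^{2,\alpha}(\partial\Omega)$ with $\|\eta-\phi\|_{C^{2,\alpha}(\partial\Omega)}<\delta$ the problem $\det D^2u=a(x,u,\nabla u)$ in $\Omega$, $u=\eta$ on $\partial\Omega$ has a unique solution $u_\eta\in V$, and $\eta\mapsto u_\eta$ is of class $C^1$ (Fréchet, into $C^{2,\alpha}(\overline\Omega)$) near $\phi$ with $u_\phi=\Phi$. Then $$\mathscr C_a^{(\phi,\partial_\nu\Phi|_{\partial\Omega})}=\{(\eta,\partial_\nu u_\eta|_{\partial\Omega}):\ \|\eta-\phi\|_{C^{2,\alpha}(\partial\Omega)}<\delta\}\subset C^{2,\alpha}(\partial\Omega)\times C^{1,\alpha}(\partial\Omega).$$ *)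

theory Defs
  imports "HOL-Analysis.Analysis"
begin

section \<open>Hoelder spaces\<close>

text \<open>
  A derivative of order \<open>k\<close> is indexed by the list of the \<open>k\<close> coordinate directions (elements of
  \<^const>\<open>Basis\<close>) in which one differentiates.
\<close>

fun pderivs :: "'a::euclidean_space list \<Rightarrow> ('a \<Rightarrow> real) \<Rightarrow> 'a \<Rightarrow> real" where
  "pderivs [] u = u"
| "pderivs (b # bs) u = (\<lambda>x. frechet_derivative (pderivs bs u) (at x) b)"

definition directions :: "nat \<Rightarrow> 'a::euclidean_space list set" where
  "directions k = {bs. set bs \<subseteq> Basis \<and> length bs = k}"

text \<open>
  \<open>holder_on k \<alpha> U u\<close> is membership of \<open>u\<close> in \<open>C\<^sup>k\<^sup>,\<^sup>\<alpha>(closure U)\<close> for an open set \<open>U\<close>: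
  the derivatives up to order \<open>k\<close> exist in \<open>U\<close>, extend continuously to the closure and are bounded
  (which matters for unbounded \<open>U\<close>), and those of order \<open>k\<close> are \<open>\<alpha>\<close>-Hoelder continuous.
  The values of \<open>u\<close> off the closure of \<open>U\<close> are irrelevant.
\<close>

definition holder_on :: "nat \<Rightarrow> real \<Rightarrow> 'a::euclidean_space set \<Rightarrow> ('a \<Rightarrow> real) \<Rightarrow> bool" where
  "holder_on k \<alpha> U u \<longleftrightarrow>
     continuous_on (closure U) u \<and>
     (\<forall>j<k. \<forall>bs\<in>directions j. \<forall>x\<in>U. pderivs bs u differentiable (at x)) \<and>
     (\<forall>j\<le>k. \<forall>bs\<in>directions j.
        (\<exists>g. continuous_on (closure U) g \<and> (\<forall>x\<in>U. g x = pderivs bs u x)) \<and>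
        bounded (pderivs bs u ` U)) \<and>
     (\<forall>bs\<in>directions k. \<exists>C. \<forall>x\<in>U. \<forall>y\<in>U.
        \<bar>pderivs bs u x - pderivs bs u y\<bar> \<le> C * dist x y powr \<alpha>)"

text \<open>The norm is meaningful for \<open>u\<close> with \<open>holder_on k \<alpha> U u\<close>, \<open>U\<close> open and nonempty.\<close>

definition holder_norm :: "nat \<Rightarrow> real \<Rightarrow> 'a::euclidean_space set \<Rightarrow> ('a \<Rightarrow> real) \<Rightarrow> real" where
  "holder_norm k \<alpha> U u =
     (\<Sum>j\<le>k. Sup {\<bar>pderivs bs u x\<bar> | bs x. bs \<in> directions j \<and> x \<in> U}) +
     Sup {\<bar>pderivs bs u x - pderivs bs u y\<bar> / dist x y powr \<alpha> | bs x y.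
            bs \<in> directions k \<and> x \<in> U \<and> y \<in> U \<and> x \<noteq> y}"

text \<open>
  Functions on \<open>closure U\<close> and on \<open>frontier U\<close> are represented by \<^const>\<open>extensional\<close> functions, so
  that equality of functions is equality on the respective set.
\<close>

definition holder_space :: "nat \<Rightarrow> real \<Rightarrow> 'a::euclidean_space set \<Rightarrow> ('a \<Rightarrow> real) set" where
  "holder_space k \<alpha> U = {u \<in> extensional (closure U). holder_on k \<alpha> U u}"

definition bdry_space :: "nat \<Rightarrow> real \<Rightarrow> 'a::euclidean_space set \<Rightarrow> ('a \<Rightarrow> real) set" where
  "bdry_space k \<alpha> U = (\<lambda>u. restrict u (frontier U)) ` holder_space k \<alpha> U"

definition bdry_norm :: "nat \<Rightarrow> real \<Rightarrow> 'a::euclidean_space set \<Rightarrow> ('a \<Rightarrow> real) \<Rightarrow> real" where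
  "bdry_norm k \<alpha> U \<eta> =
     Inf {holder_norm k \<alpha> U u | u. u \<in> holder_space k \<alpha> U \<and> (\<forall>x\<in>frontier U. u x = \<eta> x)}"

section \<open>Domains and normal derivatives\<close>

text \<open>
  The boundary is locally the graph of a \<open>C\<^sup>k\<^sup>,\<^sup>\<alpha>\<close> function over the hyperplane orthogonal to a unit
  vector \<open>e\<close>, with the domain on the side of \<open>e\<close>. Only the values of \<open>\<gamma>\<close> on that hyperplane matter;
  a graph function given locally can be cut off and extended constantly along \<open>e\<close>, so nothing is
  lost by taking \<open>\<gamma>\<close> on the whole space.
\<close>

definition holder_boundary :: "nat \<Rightarrow> real \<Rightarrow> 'a::euclidean_space set \<Rightarrow> bool" where
  "holder_boundary k \<alpha> \<Omega> \<longleftrightarrow>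
     (\<forall>x0\<in>frontier \<Omega>. \<exists>r>0. \<exists>e \<gamma>. norm e = 1 \<and> holder_on k \<alpha> UNIV \<gamma> \<and>
        \<Omega> \<inter> ball x0 r = {x \<in> ball x0 r. x \<bullet> e > \<gamma> (x - (x \<bullet> e) *\<^sub>R e)})"

text \<open>
  The unit vector orthogonal to the tangent hyperplane of \<open>frontier \<Omega>\<close> at \<open>x\<close> and pointing out
  of \<open>\<Omega>\<close>.
\<close>

definition outer_normal :: "'a::euclidean_space set \<Rightarrow> 'a \<Rightarrow> 'a" where
  "outer_normal \<Omega> x = (THE v. norm v = 1 \<and>
     ((\<lambda>y. ((y - x) \<bullet> v) / norm (y - x)) \<longlongrightarrow> 0) (at x within frontier \<Omega>) \<and>
     (\<forall>\<^sub>F t in at_right 0. x - t *\<^sub>R v \<in> \<Omega> \<and> x + t *\<^sub>R v \<notin> closure \<Omega>))"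

definition grad :: "(real^'n \<Rightarrow> real) \<Rightarrow> real^'n \<Rightarrow> real^'n" where
  "grad u x = (\<chi> i. pderivs [axis i 1] u x)"

definition hessian :: "(real^'n \<Rightarrow> real) \<Rightarrow> real^'n \<Rightarrow> real^'n^'n" where
  "hessian u x = (\<chi> i j. pderivs [axis i 1, axis j 1] u x)"

text \<open>On the boundary the gradient is the continuous extension of the gradient in \<open>\<Omega>\<close>.\<close>

definition normal_deriv :: "(real^'n) set \<Rightarrow> (real^'n \<Rightarrow> real) \<Rightarrow> real^'n \<Rightarrow> real" where
  "normal_deriv \<Omega> u x = Lim (at x within \<Omega>) (grad u) \<bullet> outer_normal \<Omega> x"

section \<open>The Monge-Ampere problem and its Cauchy data\<close>

text \<open>Nonlinearities \<open>a(x,z,p)\<close> are functions on triples.\<close>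

definition partial_z :: "((real^'n) \<times> real \<times> (real^'n) \<Rightarrow> real) \<Rightarrow> real^'n \<Rightarrow> real \<Rightarrow> real^'n \<Rightarrow> real" where
  "partial_z a x z p = deriv (\<lambda>t. a (x, t, p)) z"

definition MA_solution ::
  "(real^'n) set \<Rightarrow> ((real^'n) \<times> real \<times> (real^'n) \<Rightarrow> real) \<Rightarrow> (real^'n \<Rightarrow> real) \<Rightarrow> (real^'n \<Rightarrow> real) \<Rightarrow> bool" where
  "MA_solution \<Omega> a \<eta> u \<longleftrightarrow>
     (\<forall>x\<in>\<Omega>. det (hessian u x) = a (x, u x, grad u x)) \<and> (\<forall>x\<in>frontier \<Omega>. u x = \<eta> x)"

definition solution_in ::
  "(real^'n) set \<Rightarrow> ((real^'n) \<times> real \<times> (real^'n) \<Rightarrow> real) \<Rightarrow> (real^'n \<Rightarrow> real) set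
    \<Rightarrow> (real^'n \<Rightarrow> real) \<Rightarrow> (real^'n \<Rightarrow> real)" where
  "solution_in \<Omega> a V \<eta> = (THE u. u \<in> V \<and> MA_solution \<Omega> a \<eta> u)"

definition bdry_ball ::
  "(real^'n) set \<Rightarrow> real \<Rightarrow> (real^'n \<Rightarrow> real) \<Rightarrow> real \<Rightarrow> (real^'n \<Rightarrow> real) set" where
  "bdry_ball \<Omega> \<alpha> \<phi> \<delta> = {\<eta> \<in> bdry_space 2 \<alpha> \<Omega>. bdry_norm 2 \<alpha> \<Omega> (\<lambda>x. \<eta> x - \<phi> x) < \<delta>}"

text \<open>Bounded linear operators from \<open>C\<^sup>2\<^sup>,\<^sup>\<alpha>(\<partial>\<Omega>)\<close> to \<open>C\<^sup>2\<^sup>,\<^sup>\<alpha>(closure \<Omega>)\<close>.\<close>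

definition bounded_linear_op ::
  "(real^'n) set \<Rightarrow> real \<Rightarrow> ((real^'n \<Rightarrow> real) \<Rightarrow> (real^'n \<Rightarrow> real)) \<Rightarrow> bool" where
  "bounded_linear_op \<Omega> \<alpha> L \<longleftrightarrow>
     (\<forall>h\<in>bdry_space 2 \<alpha> \<Omega>. L h \<in> holder_space 2 \<alpha> \<Omega>) \<and>
     (\<forall>h\<in>bdry_space 2 \<alpha> \<Omega>. \<forall>k\<in>bdry_space 2 \<alpha> \<Omega>. \<forall>c.
        L (restrict (\<lambda>x. h x + c * k x) (frontier \<Omega>)) =
        restrict (\<lambda>x. L h x + c * L k x) (closure \<Omega>)) \<and>
     (\<exists>K. \<forall>h\<in>bdry_space 2 \<alpha> \<Omega>. holder_norm 2 \<alpha> \<Omega> (L h) \<le> K * bdry_norm 2 \<alpha> \<Omega> h)"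

definition frechet_deriv_at ::
  "(real^'n) set \<Rightarrow> real \<Rightarrow> ((real^'n \<Rightarrow> real) \<Rightarrow> (real^'n \<Rightarrow> real)) \<Rightarrow> (real^'n \<Rightarrow> real)
    \<Rightarrow> ((real^'n \<Rightarrow> real) \<Rightarrow> (real^'n \<Rightarrow> real)) \<Rightarrow> bool" where
  "frechet_deriv_at \<Omega> \<alpha> S \<eta> L \<longleftrightarrow>
     bounded_linear_op \<Omega> \<alpha> L \<and>
     (\<forall>\<epsilon>>0. \<exists>r>0. \<forall>h\<in>bdry_space 2 \<alpha> \<Omega>. bdry_norm 2 \<alpha> \<Omega> h < r \<longrightarrow>
        holder_norm 2 \<alpha> \<Omega>
          (\<lambda>x. S (restrict (\<lambda>y. \<eta> y + h y) (frontier \<Omega>)) x - S \<eta> x - L h x)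
        \<le> \<epsilon> * bdry_norm 2 \<alpha> \<Omega> h)"

text \<open>
  \<open>S\<close> is continuously Frechet differentiable on the ball of radius \<open>\<delta>\<close> around \<open>\<phi>\<close>;
  the derivative is continuous with respect to the operator norm.
\<close>

definition C1_on_bdry_ball ::
  "(real^'n) set \<Rightarrow> real \<Rightarrow> ((real^'n \<Rightarrow> real) \<Rightarrow> (real^'n \<Rightarrow> real)) \<Rightarrow> (real^'n \<Rightarrow> real) \<Rightarrow> real \<Rightarrow> bool" where
  "C1_on_bdry_ball \<Omega> \<alpha> S \<phi> \<delta> \<longleftrightarrow>
     (\<exists>D. (\<forall>\<eta>\<in>bdry_ball \<Omega> \<alpha> \<phi> \<delta>. frechet_deriv_at \<Omega> \<alpha> S \<eta> (D \<eta>)) \<and>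
          (\<forall>\<eta>\<in>bdry_ball \<Omega> \<alpha> \<phi> \<delta>. \<forall>\<epsilon>>0. \<exists>r>0. \<forall>\<eta>'\<in>bdry_ball \<Omega> \<alpha> \<phi> \<delta>.
             bdry_norm 2 \<alpha> \<Omega> (\<lambda>x. \<eta>' x - \<eta> x) < r \<longrightarrow>
             (\<forall>h\<in>bdry_space 2 \<alpha> \<Omega>.
                holder_norm 2 \<alpha> \<Omega> (\<lambda>x. D \<eta>' h x - D \<eta> h x) \<le> \<epsilon> * bdry_norm 2 \<alpha> \<Omega> h)))"

text \<open>
  \<open>well_posed \<Omega> \<alpha> a \<Phi> \<delta> V\<close>: the radius \<open>\<delta>\<close> and the neighbourhood \<open>V\<close> of the background solution
  \<open>\<Phi>\<close> are as provided by local well-posedness of the Dirichlet problem near \<open>\<Phi>\<close>.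
\<close>

definition well_posed ::
  "(real^'n) set \<Rightarrow> real \<Rightarrow> ((real^'n) \<times> real \<times> (real^'n) \<Rightarrow> real) \<Rightarrow> (real^'n \<Rightarrow> real)
    \<Rightarrow> real \<Rightarrow> (real^'n \<Rightarrow> real) set \<Rightarrow> bool" where
  "well_posed \<Omega> \<alpha> a \<Phi> \<delta> V \<longleftrightarrow>
     (let \<phi> = restrict \<Phi> (frontier \<Omega>) in
       \<delta> > 0 \<and>
       V \<subseteq> holder_space 2 \<alpha> \<Omega> \<and>
       (\<exists>r>0. \<forall>u\<in>holder_space 2 \<alpha> \<Omega>. holder_norm 2 \<alpha> \<Omega> (\<lambda>x. u x - \<Phi> x) < r \<longrightarrow> u \<in> V) \<and>
       (\<forall>\<eta>\<in>bdry_ball \<Omega> \<alpha> \<phi> \<delta>. \<exists>!u. u \<in> V \<and> MA_solution \<Omega> a \<eta> u) \<and>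
       (\<exists>\<delta>'>0. \<delta>' \<le> \<delta> \<and> C1_on_bdry_ball \<Omega> \<alpha> (solution_in \<Omega> a V) \<phi> \<delta>') \<and>
       solution_in \<Omega> a V \<phi> = restrict \<Phi> (closure \<Omega>))"

definition cauchy_data ::
  "(real^'n) set \<Rightarrow> real \<Rightarrow> ((real^'n) \<times> real \<times> (real^'n) \<Rightarrow> real) \<Rightarrow> (real^'n \<Rightarrow> real)
    \<Rightarrow> real \<Rightarrow> (real^'n \<Rightarrow> real) set \<Rightarrow> ((real^'n \<Rightarrow> real) \<times> (real^'n \<Rightarrow> real)) set" where
  "cauchy_data \<Omega> \<alpha> a \<Phi> \<delta> V =
     (\<lambda>\<eta>. (\<eta>, restrict (normal_deriv \<Omega> (solution_in \<Omega> a V \<eta>)) (frontier \<Omega>))) `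
       bdry_ball \<Omega> \<alpha> (restrict \<Phi> (frontier \<Omega>)) \<delta>"

end

theory Submission
  imports Defs
begin

text \<open>
  Linearising \<open>det D\<^sup>2u = a(x, u)\<close> at \<open>\<Phi> = |x|\<^sup>2/2\<close>, where \<open>D\<^sup>2\<Phi>\<close> is the identity, turns equality of the
  nonlinear Cauchy data into equality of the Cauchy data of \<open>\<Delta>v = q\<^sub>jv\<close>, and Green's formula gives
  \<open>\<integral>\<^sub>\<Omega> (q\<^sub>1 - q\<^sub>2) v\<^sub>1 v\<^sub>2 = 0\<close> for solutions \<open>v\<^sub>j\<close>. These are compared with complex geometrical optics
  \<open>exp (\<zeta>\<^sub>j \<cdot> x) (1 + r\<^sub>j)\<close>, \<open>\<zeta>\<^sub>1 + \<zeta>\<^sub>2 = i\<xi>\<close>. Instead of exact solutions, which would need elliptic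
  regularity, \<open>r\<^sub>j\<close> is a trigonometric polynomial on a cube for which the equation holds up to an
  arbitrarily small \<open>L\<^sup>2\<close> error; since \<open>q\<^sub>j \<ge> 0\<close>, the energy estimate shows that the exact solution with
  the same boundary values is close to it. So all Fourier coefficients of \<open>q\<^sub>1 - q\<^sub>2\<close> with respect to
  the lattice of the cube vanish.
\<close>

section \<open>The divergence theorem for functions vanishing on the boundary\<close>

text \<open>The exact solutions of \<Delta>v = q_j v with prescribed boundary values are themselves
  taken from the nonlinear problem, as Frechet derivatives of its solution operators. Green's
  formula is applied to the difference of two of them with equal Cauchy data; value and full
  gradient of this difference vanish on the boundary, so only fields vanishing there have to be
  integrated by parts. The order of limits matters, because an equation error is amplified by the
  size of exp (\<zeta> . x): \<zeta> is fixed first, with r_j of size O(1 / \<kappa>), then the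
  equation error is sent to 0, and \<kappa> grows only afterwards. On the torus belonging to the
  cube, inverting the conjugated Laplacian means dividing Fourier coefficients by 2 i \<zeta> . f -
  |f|^2. A half-step shift of the lattice along Re \<zeta> keeps this symbol away from 0.
  Prescribing \<zeta>_1 + \<zeta>_2 takes a direction orthogonal to both \<xi> and Re \<zeta>, hence
  n \<ge> 3. The potentials, and in the end their difference, are extended to the cube with value 0
  on its faces, so that they are continuous on the torus. Trigonometric polynomials are then
  uniformly dense enough for lattice frequencies to suffice.\<close>

lemma graph_negligible:
  fixes g :: "'a::euclidean_space \<Rightarrow> real" and e :: 'a
  assumes "norm e = 1" and g: "continuous_on UNIV g" and inv: "\<And>x t. g (x + t *\<^sub>R e) = g x"
  shows "negligible {x \<in> cball x0 r. x \<bullet> e = g x}" (is "negligible ?S")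
proof -
  have ee: "e \<bullet> e = 1" using assms(1) by (simp add: norm_eq_1)
  have "closed {x. x \<bullet> e - g x = 0}"
    by (intro closed_Collect_eq continuous_intros g)
  moreover have "?S = cball x0 r \<inter> {x. x \<bullet> e - g x = 0}" by auto
  ultimately have cS: "compact ?S" by (simp add: compact_Int_closed)
  \<comment> \<open>As \<open>g\<close> is constant along \<open>e\<close>, translates of the
    compact graph piece by different multiples of \<open>e\<close> are disjoint. They have equal
    measure and stay in \<open>cball x0 (r + 1)\<close>; infinitely many fit only if this measure is
    0.\<close>
  define T where "T n = (+) ((1 / (real n + 1)) *\<^sub>R e) ` ?S" for n :: nat
  have T: "T n \<in> lmeasurable" "measure lebesgue (T n) = measure lebesgue ?S" for n
    unfolding T_def using cS
    by (auto simp: measure_translation intro!: lmeasurable_compact compact_translation)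
  have disj: "T m \<inter> T n = {}" if "m \<noteq> n" for m n
  proof (rule ccontr)
    assume "T m \<inter> T n \<noteq> {}"
    then obtain x y where xy: "x \<bullet> e = g x" "y \<bullet> e = g y"
      "(1 / (real m + 1)) *\<^sub>R e + x = (1 / (real n + 1)) *\<^sub>R e + y"
      unfolding T_def by auto
    then have y: "y = x + (1 / (real m + 1) - 1 / (real n + 1)) *\<^sub>R e"
      by (simp add: algebra_simps)
    then have "g y = g x" using inv by simp
    then have "1 / (real m + 1) - 1 / (real n + 1) = 0"
      using xy y ee by (simp add: inner_add_left)
    then have "real m + 1 = real n + 1" by (metis eq_iff_diff_eq_0 inverse_eq_divide inverse_eq_iff_eq)
    then show False using that by simp
  qed
  have "bounded (\<Union>(range T))"
  proof -
    have "T n \<subseteq> cball x0 (r + 1)" for n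
    proof
      fix y assume "y \<in> T n"
      then obtain x where x: "x \<in> ?S" "y = (1 / (real n + 1)) *\<^sub>R e + x" unfolding T_def by auto
      have "dist x0 y \<le> dist x0 x + dist x y" by (rule dist_triangle)
      also have "dist x y = 1 / (real n + 1)" using x assms(1) by (simp add: dist_norm)
      also have "\<dots> \<le> 1" by simp
      finally show "y \<in> cball x0 (r+1)" using x by simp
    qed
    then show ?thesis by (meson UN_least bounded_cball bounded_subset)
  qed
  then have "(\<lambda>n. measure lebesgue (T n)) sums measure lebesgue (\<Union>(range T))"
    by (intro measure_countable_negligible_Union_bounded T) (auto simp: pairwise_def disj)
  then have "summable (\<lambda>n::nat. measure lebesgue ?S)" using T(2) by (simp add: sums_iff)
  then have "measure lebesgue ?S = 0" by (simp add: summable_const_iff)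
  then show ?thesis using cS by (simp add: negligible_iff_measure0 lmeasurable_compact)
qed

text \<open>Frontier points are outside the open set, which gives one inequality. If it were strict,
  it would hold on a neighbourhood, and this neighbourhood would miss
  \<open>\<Omega>\<close>.\<close>

lemma frontier_in_graph:
  fixes \<Omega> :: "'a::euclidean_space set"
  assumes op: "open \<Omega>" and g: "continuous_on UNIV g"
    and eq: "\<Omega> \<inter> ball x0 r = {x \<in> ball x0 r. x \<bullet> e > g x}"
  shows "frontier \<Omega> \<inter> ball x0 r \<subseteq> {x. x \<bullet> e = g x}"
proof
  have eq': "y \<in> \<Omega> \<longleftrightarrow> y \<bullet> e > g y" if "y \<in> ball x0 r" for y
    using arg_cong[OF eq, of "\<lambda>A. y \<in> A"] that by simp
  fix x assume x: "x \<in> frontier \<Omega> \<inter> ball x0 r"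
  then have "x \<notin> \<Omega>" using op by (simp add: frontier_def interior_open)
  then have le: "x \<bullet> e \<le> g x" using eq'[of x] x by simp
  have "x \<bullet> e \<ge> g x"
  proof (rule ccontr)
    assume "\<not> ?thesis"
    moreover have "open {x. x \<bullet> e < g x}" by (intro open_Collect_less continuous_intros g)
    ultimately have "open ({x. x \<bullet> e < g x} \<inter> ball x0 r)" "x \<in> {x. x \<bullet> e < g x} \<inter> ball x0 r"
      using x by auto
    moreover have "x \<in> closure \<Omega>" using x by (simp add: frontier_def)
    ultimately obtain y where y: "y \<in> \<Omega>" "y \<bullet> e < g y" "y \<in> ball x0 r"
      unfolding closure_iff_nhds_not_empty by blast
    then show False using eq'[of y] by simp
  qed
  with le show "x \<in> {x. x \<bullet> e = g x}" by simp
qed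

text \<open>Take the point of the complement on the segment that is nearest to \<open>x\<close>:
  everything strictly closer still lies in \<open>\<Omega>\<close>, so it is a frontier point
  reached from inside along a straight line. This stands in for convexity of \<open>\<Omega>\<close>
  in the Lipschitz estimate that follows.\<close>

lemma closest_obstacle:
  fixes x y :: "'a::euclidean_space"
  assumes op: "open \<Omega>" and x: "x \<in> \<Omega>" and z0: "z0 \<in> closed_segment x y" "z0 \<notin> \<Omega>"
  obtains z where "z \<in> frontier \<Omega>" "z \<in> closed_segment x y" "norm (x - z) \<le> norm (x - z0)"
    "\<And>t. 0 < t \<Longrightarrow> t \<le> 1 \<Longrightarrow> z + t *\<^sub>R (x - z) \<in> \<Omega>"
proof -
  let ?S = "closed_segment x y \<inter> - \<Omega>"
  have "closed ?S" using op by (intro closed_Int) auto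
  moreover have "?S \<noteq> {}" using z0 by auto
  ultimately obtain z where z: "z \<in> ?S" "\<And>w. w \<in> ?S \<Longrightarrow> dist x z \<le> dist x w"
    by (metis distance_attains_inf)
  have xz: "x \<noteq> z" using z x by auto
  have in\<Omega>: "z + t *\<^sub>R (x - z) \<in> \<Omega>" if "0 < t" "t \<le> 1" for t
  proof (rule ccontr)
    assume "\<not> ?thesis"
    moreover have "z + t *\<^sub>R (x - z) \<in> closed_segment z x"
      unfolding closed_segment_def using that by (auto simp: algebra_simps intro!: exI[of _ t])
    then have "z + t *\<^sub>R (x - z) \<in> closed_segment x y"
      using z(1) by (meson IntD1 closed_segment_subset convex_closed_segment ends_in_segment(1) subsetD)
    ultimately have "dist x z \<le> dist x (z + t *\<^sub>R (x - z))" using z(2) by auto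
    also have "x - (z + t *\<^sub>R (x - z)) = (1 - t) *\<^sub>R (x - z)" by (simp add: algebra_simps)
    then have "dist x (z + t *\<^sub>R (x - z)) = (1 - t) * dist x z"
      using that by (simp add: dist_norm)
    finally have "t * dist x z \<le> 0" by (simp add: algebra_simps)
    then show False using that xz by (simp add: mult_le_0_iff)
  qed
  have "z \<in> closure \<Omega>"
  proof -
    have "((\<lambda>t. z + t *\<^sub>R (x - z)) \<longlongrightarrow> z + 0 *\<^sub>R (x - z)) (at_right 0)" by (intro tendsto_intros)
    moreover have "\<forall>\<^sub>F t in at_right 0. z + t *\<^sub>R (x - z) \<in> closure \<Omega>"
      unfolding eventually_at_right_field using in\<Omega> closure_subset[of \<Omega>]
      by (intro exI[of _ 1]) auto
    ultimately show ?thesis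
      using Lim_in_closed_set[of "closure \<Omega>" _ "at_right (0::real)"] by auto
  qed
  then have "z \<in> frontier \<Omega>" using z op by (simp add: frontier_def interior_open)
  moreover have "norm (x - z) \<le> norm (x - z0)" using z(2)[of z0] z0 by (simp add: dist_norm)
  ultimately show ?thesis using that[of z] z(1) in\<Omega> by blast
qed

lemma mvt_le:
  fixes f :: "'a::euclidean_space \<Rightarrow> real"
  assumes "closed_segment a b \<subseteq> \<Omega>" and "\<And>x. x \<in> \<Omega> \<Longrightarrow> (f has_derivative f' x) (at x)"
    and "\<And>x h. x \<in> \<Omega> \<Longrightarrow> \<bar>f' x h\<bar> \<le> K * norm h"
  shows "\<bar>f a - f b\<bar> \<le> K * norm (a - b)"
proof -
  have "norm (f a - f b) \<le> K * norm (a - b)"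
  proof (rule differentiable_bound[where S="closed_segment a b" and f'=f'])
    show "(f has_derivative f' x) (at x within closed_segment a b)" if "x \<in> closed_segment a b" for x
      using assms that by (meson has_derivative_at_withinI subsetD)
    show "onorm (f' x) \<le> K" if "x \<in> closed_segment a b" for x
    proof -
      have "norm (f' x h) \<le> K * norm h" for h using assms(1,3) that by auto
      then show ?thesis by (rule onorm_le)
    qed
  qed (auto)
  then show ?thesis by simp
qed

text \<open>A segment may leave \<open>\<Omega>\<close>, so the mean value inequality does not apply
  between \<open>x\<close> and \<open>y\<close> directly. It is applied between \<open>x\<close> and
  the first exit point, where \<open>f\<close> tends to 0. Two inner points whose segment meets the
  complement each pay their distance to a common obstacle on it, and these distances add up to
  \<open>norm (x - y)\<close>.\<close>

lemma zero_extension_lipschitz: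
  fixes f :: "'a::euclidean_space \<Rightarrow> real"
  assumes op: "open \<Omega>" and d: "\<And>x. x \<in> \<Omega> \<Longrightarrow> (f has_derivative f' x) (at x)"
    and b: "\<And>x h. x \<in> \<Omega> \<Longrightarrow> \<bar>f' x h\<bar> \<le> K * norm h" and K: "K \<ge> 0"
    and lim: "\<And>z. z \<in> frontier \<Omega> \<Longrightarrow> (f \<longlongrightarrow> 0) (at z within \<Omega>)"
  defines "F \<equiv> \<lambda>x. if x \<in> \<Omega> then f x else 0"
  shows "\<bar>F x - F y\<bar> \<le> K * norm (x - y)"
proof -
  have one: "\<bar>F x\<bar> \<le> K * norm (x - z0)" if x: "x \<in> \<Omega>" and z0: "z0 \<in> closed_segment x y" "z0 \<notin> \<Omega>" for x y z0
  proof -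
    obtain z where z: "z \<in> frontier \<Omega>" "z \<in> closed_segment x y" "norm (x - z) \<le> norm (x - z0)"
      "\<And>t. 0 < t \<Longrightarrow> t \<le> 1 \<Longrightarrow> z + t *\<^sub>R (x - z) \<in> \<Omega>"
      using closest_obstacle[OF op x z0] by blast
    have xz: "x \<noteq> z" using z(1) op x by (auto simp: frontier_def interior_open)
    \<comment> \<open>Nothing is known about \<open>f\<close> at \<open>z\<close> itself, so the
      inequality is proved up to \<open>p t\<close>, which tends to \<open>z\<close> from inside as
      \<open>t\<close> decreases to 0, and then passed to the limit.\<close>
    define p where "p t = z + t *\<^sub>R (x - z)" for t :: real
    have ev: "\<forall>\<^sub>F t in at_right 0. 0 < t \<and> t \<le> (1::real)"
      unfolding eventually_at_right_field by (intro exI[of _ 1]) auto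
    have "(p \<longlongrightarrow> z + 0 *\<^sub>R (x - z)) (at_right 0)" unfolding p_def by (intro tendsto_intros)
    then have "filterlim p (at z within \<Omega>) (at_right 0)"
      unfolding filterlim_at
      by (auto intro!: eventually_mono[OF ev] simp: p_def z(4) xz)
    then have l0: "((\<lambda>t. f (p t)) \<longlongrightarrow> 0) (at_right 0)"
      using lim[OF z(1)] filterlim_compose by blast
    have "\<forall>\<^sub>F t in at_right 0. \<bar>f x - f (p t)\<bar> \<le> K * norm (x - z)"
    proof (rule eventually_mono[OF ev])
      fix t :: real assume t: "0 < t \<and> t \<le> 1"
      have "closed_segment x (p t) \<subseteq> \<Omega>"
      proof
        fix w assume "w \<in> closed_segment x (p t)"
        then obtain u where u: "0 \<le> u" "u \<le> 1" "w = (1 - u) *\<^sub>R x + u *\<^sub>R p t"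
          by (auto simp: closed_segment_def)
        then have "w = z + (1 - u + u * t) *\<^sub>R (x - z)" by (simp add: p_def algebra_simps)
        moreover have "0 < 1 - u + u * t"
        proof (cases "u = 1")
          case False
          then show ?thesis using u t by (intro add_pos_nonneg) auto
        qed (use t in auto)
        moreover have "1 - u + u * t \<le> 1" using u t mult_left_le[of t u] by simp
        ultimately show "w \<in> \<Omega>" using z(4) by simp
      qed
      then have "\<bar>f x - f (p t)\<bar> \<le> K * norm (x - p t)" using mvt_le d b by blast
      also have "x - p t = (1 - t) *\<^sub>R (x - z)" by (simp add: p_def algebra_simps)
      then have "norm (x - p t) \<le> norm (x - z)" using t by (simp add: mult_left_le_one_le)
      finally show "\<bar>f x - f (p t)\<bar> \<le> K * norm (x - z)" using K by (meson mult_left_mono order_trans)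
    qed
    then have "\<bar>f x - 0\<bar> \<le> K * norm (x - z)"
      using tendsto_diff[OF tendsto_const l0, of "f x"]
      by (intro tendsto_upperbound[rotated]) (auto intro!: tendsto_rabs)
    then have "\<bar>f x\<bar> \<le> K * norm (x - z)" by simp
    also have "\<dots> \<le> K * norm (x - z0)" using z(3) K by (rule mult_left_mono)
    finally show ?thesis using x by (simp add: F_def)
  qed
  consider "x \<in> \<Omega>" "y \<in> \<Omega>" "closed_segment x y \<subseteq> \<Omega>" | z where "x \<in> \<Omega>" "y \<in> \<Omega>" "z \<in> closed_segment x y" "z \<notin> \<Omega>"
    | "x \<in> \<Omega>" "y \<notin> \<Omega>" | "x \<notin> \<Omega>" "y \<in> \<Omega>" | "x \<notin> \<Omega>" "y \<notin> \<Omega>" by blast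
  then show ?thesis
  proof cases
    case 1
    then show ?thesis using mvt_le[OF 1(3) d b] by (auto simp: F_def)
  next
    case 2
    have "\<bar>F x - F y\<bar> \<le> \<bar>F x\<bar> + \<bar>F y\<bar>" by simp
    also have "\<dots> \<le> K * norm (x - z) + K * norm (y - z)"
      using one[OF 2(1,3,4)] one[OF 2(2) _ 2(4), of x] 2(3) by (simp add: closed_segment_commute)
    also have "\<dots> = K * (dist x z + dist z y)" by (simp add: dist_norm norm_minus_commute algebra_simps)
    also have "dist x z + dist z y = dist x y" using 2(3) by (simp add: between_mem_segment[symmetric] between)
    finally show ?thesis by (simp add: dist_norm)
  next
    case 3
    then show ?thesis using one[OF 3(1), of y y] by (simp add: F_def)
  next
    case 4
    then show ?thesis using one[OF 4(2), of x x] by (simp add: F_def norm_minus_commute)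
  next
    case 5
    then show ?thesis using K by (simp add: F_def)
  qed
qed

lemma set_integrable_bounded_continuous:
  fixes f :: "'a::euclidean_space \<Rightarrow> 'b::{banach,second_countable_topology}"
  assumes "open \<Omega>" "bounded \<Omega>" "continuous_on \<Omega> f" "bounded (f ` \<Omega>)"
  shows "set_integrable lborel \<Omega> f"
proof -
  obtain B where B: "\<And>x. x \<in> \<Omega> \<Longrightarrow> norm (f x) \<le> B" using assms(4) by (auto simp: bounded_iff)
  have m: "set_borel_measurable borel \<Omega> f"
    using assms by (simp add: set_borel_measurable_def borel_measurable_continuous_on_indicator)
  have em: "emeasure lborel \<Omega> < \<infinity>" using assms(2) by (rule emeasure_bounded_finite)
  have i: "integrable lborel (\<lambda>x. indicator \<Omega> x *\<^sub>R B)"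
    using em assms(1) by (intro integrable_scaleR_left integrable_real_indicator) auto
  show ?thesis unfolding set_integrable_def
  proof (rule Bochner_Integration.integrable_bound[OF i])
    show "(\<lambda>x. indicat_real \<Omega> x *\<^sub>R f x) \<in> borel_measurable lborel"
      using m by (simp add: set_borel_measurable_def)
    show "AE x in lborel. norm (indicat_real \<Omega> x *\<^sub>R f x) \<le> norm (indicat_real \<Omega> x *\<^sub>R B)"
      by (rule AE_I2) (use B in \<open>force simp: indicator_def\<close>)
  qed
qed

text \<open>The difference quotients of the zero extension of \<open>f\<close> have integral zero by translation
  invariance, and dominated convergence passes to the derivative.\<close>

lemma integral_directional_derivative_zero:
  fixes f :: "'a::euclidean_space \<Rightarrow> real"
  assumes op: "open \<Omega>" and bd: "bounded \<Omega>" and neg: "negligible (frontier \<Omega>)"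
    and d: "\<And>x. x \<in> \<Omega> \<Longrightarrow> (f has_derivative f' x) (at x)"
    and b: "\<And>x h. x \<in> \<Omega> \<Longrightarrow> \<bar>f' x h\<bar> \<le> K * norm h"
    and lim: "\<And>z. z \<in> frontier \<Omega> \<Longrightarrow> (f \<longlongrightarrow> 0) (at z within \<Omega>)"
    and c: "continuous_on \<Omega> (\<lambda>x. f' x e)"
  shows "(LINT x:\<Omega>|lborel. f' x e) = 0"
proof (cases "\<Omega> = {}")
  case True then show ?thesis by (simp add: set_lebesgue_integral_def)
next
  case False
  then obtain x1 where "x1 \<in> \<Omega>" by auto
  obtain b1 :: 'a where "b1 \<in> Basis" using nonempty_Basis by blast
  have K: "K \<ge> 0" using b[OF \<open>x1 \<in> \<Omega>\<close>, of b1] \<open>b1 \<in> Basis\<close> by simp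
  define F where "F = (\<lambda>x. if x \<in> \<Omega> then f x else 0)"
  have lip: "\<bar>F x - F y\<bar> \<le> K * norm (x - y)" for x y
    unfolding F_def by (rule zero_extension_lipschitz[OF op d b K lim])
  have F0: "F x = 0" if "x \<notin> \<Omega>" for x using that by (simp add: F_def)
  have "K-lipschitz_on UNIV F"
    by (rule lipschitz_onI) (use lip K in \<open>auto simp: dist_norm\<close>)
  then have cF: "continuous_on A F" for A
    using lipschitz_on_continuous_on continuous_on_subset by blast
  obtain B where B: "\<And>x. x \<in> \<Omega> \<Longrightarrow> norm x \<le> B" using bd by (auto simp: bounded_iff)
  have mF: "F \<in> borel_measurable borel" using cF by (intro borel_measurable_continuous_onI)
  have iF: "integrable lborel F"
  proof -
    have "integrable lborel (\<lambda>x. indicator (cball 0 B) x *\<^sub>R F x)"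
      by (intro borel_integrable_compact cF compact_cball)
    moreover have "(\<lambda>x. indicator (cball 0 B) x *\<^sub>R F x) = F"
      by (rule ext) (use B F0 in \<open>auto simp: indicator_def\<close>)
    ultimately show ?thesis by simp
  qed
  have tr: "integrable lborel (\<lambda>x. F (a + x))" "(LINT x|lborel. F (a + x)) = (LINT x|lborel. F x)" for a
  proof -
    show "(LINT x|lborel. F (a + x)) = (LINT x|lborel. F x)"
      using integral_distr[of "(+) a" lborel borel F] mF by (simp add: lborel_distr_plus)
    show "integrable lborel (\<lambda>x. F (a + x))"
      using integrable_distr_eq[of "(+) a" lborel borel F] mF iF by (simp add: lborel_distr_plus)
  qed
  define t where "t n = 1 / (real n + 1)" for n :: nat
  have t: "t n > 0" "t n \<le> 1" for n by (auto simp: t_def)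
  have tlim: "t \<longlonglongrightarrow> 0"
    using LIMSEQ_inverse_real_of_nat by (simp add: t_def[abs_def] inverse_eq_divide add.commute)
  define s where "s n x = (F (t n *\<^sub>R e + x) - F x) / t n" for n x
  have "(\<lambda>n. LINT x|lborel. s n x) \<longlonglongrightarrow> (LINT x|lborel. indicator \<Omega> x *\<^sub>R f' x e)"
  \<comment> \<open>Since \<open>t n \<le> 1\<close>, the quotients vanish outside the ball of
    radius \<open>B + norm e\<close>. Inside, the Lipschitz bound of the zero extension also covers
    points whose translate lies on the other side of the boundary.\<close>
  proof (rule integral_dominated_convergence[where w="\<lambda>x. indicator (cball 0 (B + norm e)) x *\<^sub>R (K * norm e)"])
    show "(\<lambda>x. indicat_real \<Omega> x *\<^sub>R f' x e) \<in> borel_measurable lborel"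
      using borel_measurable_continuous_on_indicator[of \<Omega>, OF _ c] op by simp
    show "s n \<in> borel_measurable lborel" for n unfolding s_def using mF by measurable
    show "integrable lborel (\<lambda>x. indicator (cball 0 (B + norm e)) x *\<^sub>R (K * norm e))"
      by (intro borel_integrable_compact) auto
    \<comment> \<open>Off the frontier a point is interior either to \<open>\<Omega>\<close> or to
      its complement, so eventually the quotient is that of \<open>f\<close>, or it is 0.\<close>
    have "frontier \<Omega> \<in> null_sets lborel"
      using neg by (simp add: negligible_iff_null_sets null_sets_completion_iff)
    then have "AE x in lborel. x \<notin> frontier \<Omega>" by (rule AE_not_in)
    then show "AE x in lborel. (\<lambda>n. s n x) \<longlonglongrightarrow> indicator \<Omega> x *\<^sub>R f' x e"
    proof (rule eventually_mono)
      fix x assume xf: "x \<notin> frontier \<Omega>"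
      have xt: "(\<lambda>n. t n *\<^sub>R e + x) \<longlonglongrightarrow> 0 *\<^sub>R e + x" by (intro tendsto_intros tlim)
      show "(\<lambda>n. s n x) \<longlonglongrightarrow> indicator \<Omega> x *\<^sub>R f' x e"
      proof (cases "x \<in> \<Omega>")
        case True
        have "((\<lambda>u. f (u *\<^sub>R e + x)) has_derivative (\<lambda>u. f' x (u *\<^sub>R e))) (at 0)"
          by (rule has_derivative_compose[of "\<lambda>u. u *\<^sub>R e + x" "\<lambda>u. u *\<^sub>R e" 0 UNIV f "f' x"])
             (auto intro!: derivative_eq_intros d True)
        moreover have "f' x (u *\<^sub>R e) = u * f' x e" for u
          using d[OF True] has_derivative_bounded_linear bounded_linear.linear linear_scale by fastforce
        ultimately have "((\<lambda>u. f (u *\<^sub>R e + x)) has_real_derivative f' x e) (at 0)"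
          by (simp add: has_field_derivative_def mult.commute[of _ "f' x e"] mult_commute_abs)
        then have "((\<lambda>u. (f (u *\<^sub>R e + x) - f x) / u) \<longlongrightarrow> f' x e) (at 0)"
          by (simp add: DERIV_def)
        moreover have "filterlim t (at 0) sequentially"
          using tlim t by (auto simp: filterlim_at intro!: always_eventually less_imp_neq[symmetric])
        ultimately have "(\<lambda>n. (f (t n *\<^sub>R e + x) - f x) / t n) \<longlonglongrightarrow> f' x e"
          by (rule filterlim_compose)
        moreover have "\<forall>\<^sub>F n in sequentially. t n *\<^sub>R e + x \<in> \<Omega>"
          using topological_tendstoD[OF xt op] True by simp
        then have "\<forall>\<^sub>F n in sequentially. (f (t n *\<^sub>R e + x) - f x) / t n = s n x"
          by (rule eventually_mono) (use True in \<open>auto simp: s_def F_def\<close>)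
        ultimately show ?thesis using True by (simp add: Lim_transform_eventually)
      next
        case False
        then have "x \<in> - closure \<Omega>" using xf op by (simp add: frontier_def interior_open)
        then have "\<forall>\<^sub>F n in sequentially. t n *\<^sub>R e + x \<in> - closure \<Omega>"
          using topological_tendstoD[OF xt, of "- closure \<Omega>"] by (simp add: open_Compl)
        then have "\<forall>\<^sub>F n in sequentially. 0 = s n x"
        proof (rule eventually_mono)
          fix n assume "t n *\<^sub>R e + x \<in> - closure \<Omega>"
          then have "t n *\<^sub>R e + x \<notin> \<Omega>" using closure_subset by auto
          then show "0 = s n x" using False by (simp add: s_def F_def)
        qed
        then show ?thesis using False by (simp add: Lim_transform_eventually[OF tendsto_const])
      qed
    qed
    show "AE x in lborel. norm (s n x) \<le> indicat_real (cball 0 (B + norm e)) x *\<^sub>R (K * norm e)" for n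
    proof (rule AE_I2)
      fix x
      show "norm (s n x) \<le> indicat_real (cball 0 (B + norm e)) x *\<^sub>R (K * norm e)"
      proof (cases "x \<in> cball 0 (B + norm e)")
        case True
        have "\<bar>F (t n *\<^sub>R e + x) - F x\<bar> \<le> K * norm (t n *\<^sub>R e)"
          using lip[of "t n *\<^sub>R e + x" x] by simp
        then show ?thesis using True t[of n] by (simp add: s_def divide_le_eq mult_ac)
      next
        case False
        then have x: "norm x > B + norm e" by simp
        have "norm (t n *\<^sub>R e) \<le> norm e" using t[of n] by (simp add: mult_left_le_one_le)
        moreover have "norm x \<le> norm (t n *\<^sub>R e + x) + norm (t n *\<^sub>R e)"
          by (metis add_diff_cancel_left' norm_triangle_sub norm_minus_commute norm_triangle_ineq4)
        ultimately have "norm (t n *\<^sub>R e + x) > B" using x by linarith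
        moreover have "norm x > B" using x norm_ge_zero[of e] by linarith
        ultimately have "t n *\<^sub>R e + x \<notin> \<Omega>" "x \<notin> \<Omega>" using B by force+
        then show ?thesis using False by (simp add: s_def F_def)
      qed
    qed
  qed
  moreover have "(LINT x|lborel. s n x) = 0" for n
    unfolding s_def using tr iF by (simp add: Bochner_Integration.integral_diff)
  ultimately show ?thesis by (simp add: set_lebesgue_integral_def LIMSEQ_const_iff)
qed

section \<open>Calculus in Hoelder spaces\<close>

text \<open>Derivatives depend on germs only. This allows passing between extensional
  representatives and functions given by a formula on the whole space.\<close>

lemma pderivs_cong:
  assumes "open U" "\<And>x. x \<in> U \<Longrightarrow> u x = v x" "x \<in> U"
  shows "pderivs bs u x = pderivs bs v x"
  using assms(3)
proof (induction bs arbitrary: x)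
  case Nil
  then show ?case using assms(2) by simp
next
  case (Cons b bs)
  have "(pderivs bs u has_derivative D) (at x) \<longleftrightarrow> (pderivs bs v has_derivative D) (at x)" for D
    using has_derivative_transform_within_open[OF _ assms(1) Cons.prems] Cons.IH by metis
  then have "frechet_derivative (pderivs bs u) (at x) = frechet_derivative (pderivs bs v) (at x)"
    by (simp add: frechet_derivative_def)
  then show ?case by simp
qed

lemma directions_0 [simp]: "directions 0 = {[]}"
  by (auto simp: directions_def)

lemma Cons_in_directions [simp]: "b # bs \<in> directions (Suc k) \<longleftrightarrow> b \<in> Basis \<and> bs \<in> directions k"
  by (auto simp: directions_def)

lemma finite_directions [simp]: "finite (directions k)"
  unfolding directions_def by (rule finite_lists_length_eq) simp

lemma directions_nonempty: "directions k \<noteq> ({} :: 'a::euclidean_space list set)"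
proof -
  obtain b :: 'a where "b \<in> Basis" using nonempty_Basis by blast
  then have "replicate k b \<in> directions k" by (auto simp: directions_def)
  then show ?thesis by blast
qed

lemma pderivs_has_derivative:
  fixes u :: "'a::euclidean_space \<Rightarrow> real"
  assumes "pderivs bs u differentiable (at x)"
  shows "(pderivs bs u has_derivative (\<lambda>h. \<Sum>b\<in>Basis. (h \<bullet> b) * pderivs (b # bs) u x)) (at x)"
proof -
  let ?D = "frechet_derivative (pderivs bs u) (at x)"
  have D: "(pderivs bs u has_derivative ?D) (at x)" using assms frechet_derivative_works by blast
  then interpret bounded_linear ?D by (rule has_derivative_bounded_linear)
  have "?D h = (\<Sum>b\<in>Basis. (h \<bullet> b) * pderivs (b # bs) u x)" for h
  proof -
    have "?D h = ?D (\<Sum>b\<in>Basis. (h \<bullet> b) *\<^sub>R b)" by (simp add: euclidean_representation)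
    also have "\<dots> = (\<Sum>b\<in>Basis. (h \<bullet> b) * ?D b)" by (simp add: sum scale)
    finally show ?thesis by simp
  qed
  then have "?D = (\<lambda>h. \<Sum>b\<in>Basis. (h \<bullet> b) * pderivs (b # bs) u x)" by (rule ext)
  then show ?thesis using D by simp
qed

lemma holder_onD:
  assumes "holder_on k \<alpha> U u"
  shows "continuous_on (closure U) u"
    and "j < k \<Longrightarrow> bs \<in> directions j \<Longrightarrow> x \<in> U \<Longrightarrow> pderivs bs u differentiable (at x)"
    and "j \<le> k \<Longrightarrow> bs \<in> directions j \<Longrightarrow> \<exists>g. continuous_on (closure U) g \<and> (\<forall>x\<in>U. g x = pderivs bs u x)"
    and "j \<le> k \<Longrightarrow> bs \<in> directions j \<Longrightarrow> bounded (pderivs bs u ` U)"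
    and "bs \<in> directions k \<Longrightarrow> \<exists>C. \<forall>x\<in>U. \<forall>y\<in>U. \<bar>pderivs bs u x - pderivs bs u y\<bar> \<le> C * dist x y powr \<alpha>"
  using assms unfolding holder_on_def by blast+

lemma holder_on_continuous_pderivs:
  assumes "holder_on k \<alpha> U u" "j \<le> k" "bs \<in> directions j"
  shows "continuous_on U (pderivs bs u)"
  using holder_onD(3)[OF assms]
  by (metis (mono_tags, lifting) closure_subset continuous_on_cong continuous_on_subset)

text \<open>\<open>frechet_derivative\<close> is an arbitrary choice where no derivative exists, so
  linearity at order \<open>j\<close> rests on differentiability of all lower orders throughout
  \<open>U\<close>, not merely at \<open>x\<close>.\<close>

lemma pderivs_lincomb:
  fixes u v :: "'a::euclidean_space \<Rightarrow> real"
  assumes U: "open U"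
    and du: "\<And>j bs x. j < k \<Longrightarrow> bs \<in> directions j \<Longrightarrow> x \<in> U \<Longrightarrow> pderivs bs u differentiable (at x)"
    and dv: "\<And>j bs x. j < k \<Longrightarrow> bs \<in> directions j \<Longrightarrow> x \<in> U \<Longrightarrow> pderivs bs v differentiable (at x)"
    and "j \<le> k" "bs \<in> directions j" "x \<in> U"
  shows "pderivs bs (\<lambda>x. u x + c * v x) x = pderivs bs u x + c * pderivs bs v x"
    and "j < k \<Longrightarrow> pderivs bs (\<lambda>x. u x + c * v x) differentiable (at x)"
proof -
  have *: "(\<forall>x\<in>U. pderivs bs (\<lambda>x. u x + c * v x) x = pderivs bs u x + c * pderivs bs v x)"
    if "j \<le> k" "bs \<in> directions j" for j bs
    using that
  proof (induction bs arbitrary: j)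
    case Nil
    then show ?case by simp
  next
    case (Cons b bs)
    obtain i where j: "j = Suc i" and bs: "b \<in> Basis" "bs \<in> directions i"
      using Cons.prems(2) by (cases j) (auto simp: directions_def)
    have IH: "\<forall>x\<in>U. pderivs bs (\<lambda>x. u x + c * v x) x = pderivs bs u x + c * pderivs bs v x"
      using Cons.IH[of i] Cons.prems j bs by simp
    show ?case
    proof
      fix x assume x: "x \<in> U"
      let ?Du = "frechet_derivative (pderivs bs u) (at x)" and ?Dv = "frechet_derivative (pderivs bs v) (at x)"
      have "(pderivs bs u has_derivative ?Du) (at x)" "(pderivs bs v has_derivative ?Dv) (at x)"
        using du[of i bs x] dv[of i bs x] Cons.prems j bs x frechet_derivative_works by auto
      then have "((\<lambda>x. pderivs bs u x + c * pderivs bs v x) has_derivative (\<lambda>h. ?Du h + c * ?Dv h)) (at x)"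
        by (intro derivative_intros)
      then have "(pderivs bs (\<lambda>x. u x + c * v x) has_derivative (\<lambda>h. ?Du h + c * ?Dv h)) (at x)"
        by (rule has_derivative_transform_within_open[OF _ U x]) (use IH in auto)
      then have "frechet_derivative (pderivs bs (\<lambda>x. u x + c * v x)) (at x) = (\<lambda>h. ?Du h + c * ?Dv h)"
        by (rule frechet_derivative_at[symmetric])
      then show "pderivs (b # bs) (\<lambda>x. u x + c * v x) x = pderivs (b # bs) u x + c * pderivs (b # bs) v x"
        by simp
    qed
  qed
  show "pderivs bs (\<lambda>x. u x + c * v x) x = pderivs bs u x + c * pderivs bs v x"
    using * assms by blast
  assume jk: "j < k"
  have "(\<lambda>x. pderivs bs u x + c * pderivs bs v x) differentiable (at x)"
    using du[OF jk] dv[OF jk] assms by (intro differentiable_add differentiable_mult) auto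
  then obtain D where "((\<lambda>x. pderivs bs u x + c * pderivs bs v x) has_derivative D) (at x)"
    by (auto simp: differentiable_def)
  then have "(pderivs bs (\<lambda>x. u x + c * v x) has_derivative D) (at x)"
    by (rule has_derivative_transform_within_open[OF _ U \<open>x \<in> U\<close>]) (use * assms in auto)
  then show "pderivs bs (\<lambda>x. u x + c * v x) differentiable (at x)" by (auto simp: differentiable_def)
qed

lemma holder_on_cong:
  fixes u v :: "'a::euclidean_space \<Rightarrow> real"
  assumes U: "open U" and eq: "\<And>x. x \<in> closure U \<Longrightarrow> u x = v x" and u: "holder_on k \<alpha> U u"
  shows "holder_on k \<alpha> U v"
proof -
  have e: "pderivs bs u x = pderivs bs v x" if "x \<in> U" for bs x
    using pderivs_cong[OF U] eq that closure_subset by (metis subsetD)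
  have d: "pderivs bs v differentiable (at x)" if "pderivs bs u differentiable (at x)" "x \<in> U" for bs x
    using that e has_derivative_transform_within_open[OF _ U that(2)] unfolding differentiable_def by metis
  have c: "continuous_on (closure U) v"
    using holder_onD(1)[OF u] eq by (metis continuous_on_cong)
  have i: "pderivs bs v ` U = pderivs bs u ` U" for bs using e by auto
  show ?thesis
    unfolding holder_on_def i
  proof (intro conjI allI impI ballI)
    show "continuous_on (closure U) v" by fact
  next
    fix j x and bs :: "'a list" assume "j < k" "bs \<in> directions j" "x \<in> U"
    then show "pderivs bs v differentiable (at x)" using d holder_onD(2)[OF u] by blast
  next
    fix j and bs :: "'a list" assume "j \<le> k" "bs \<in> directions j"
    then show "\<exists>g. continuous_on (closure U) g \<and> (\<forall>x\<in>U. g x = pderivs bs v x)"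
      "bounded (pderivs bs u ` U)"
      using holder_onD(3,4)[OF u] e by metis+
  next
    fix bs :: "'a list" assume "bs \<in> directions k"
    then show "\<exists>C. \<forall>x\<in>U. \<forall>y\<in>U. \<bar>pderivs bs v x - pderivs bs v y\<bar> \<le> C * dist x y powr \<alpha>"
      using holder_onD(5)[OF u] e by metis
  qed
qed

lemma pderivs_holder_lincomb:
  fixes u v :: "'a::euclidean_space \<Rightarrow> real"
  assumes "open U" and u: "holder_on k \<alpha> U u" and v: "holder_on k \<alpha> U v"
    and "j \<le> k" "bs \<in> directions j" "x \<in> U"
  shows "pderivs bs (\<lambda>x. u x + c * v x) x = pderivs bs u x + c * pderivs bs v x"
    and "j < k \<Longrightarrow> pderivs bs (\<lambda>x. u x + c * v x) differentiable (at x)"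
proof -
  show "pderivs bs (\<lambda>x. u x + c * v x) x = pderivs bs u x + c * pderivs bs v x"
    by (rule pderivs_lincomb(1)[where U=U and k=k])
       (use assms holder_onD(2)[OF u] holder_onD(2)[OF v] in blast)+
  show "pderivs bs (\<lambda>x. u x + c * v x) differentiable (at x)" if "j < k"
    by (rule pderivs_lincomb(2)[where U=U and k=k and j=j])
       (use assms that holder_onD(2)[OF u] holder_onD(2)[OF v] in blast)+
qed

lemma holder_on_lincomb:
  fixes u v :: "'a::euclidean_space \<Rightarrow> real"
  assumes U: "open U" and u: "holder_on k \<alpha> U u" and v: "holder_on k \<alpha> U v"
  shows "holder_on k \<alpha> U (\<lambda>x. u x + c * v x)"
proof -
  note L = pderivs_holder_lincomb[OF U u v]
  show ?thesis
    unfolding holder_on_def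
  proof (intro conjI allI impI ballI)
    show "continuous_on (closure U) (\<lambda>x. u x + c * v x)"
      by (intro continuous_intros holder_onD(1)[OF u] holder_onD(1)[OF v])
  next
    fix j x and bs :: "'a list" assume "j < k" "bs \<in> directions j" "x \<in> U"
    then show "pderivs bs (\<lambda>x. u x + c * v x) differentiable (at x)" using L(2) by simp
  next
    fix j and bs :: "'a list" assume j: "j \<le> k" "bs \<in> directions j"
    obtain g h where "continuous_on (closure U) g" "\<forall>x\<in>U. g x = pderivs bs u x"
      "continuous_on (closure U) h" "\<forall>x\<in>U. h x = pderivs bs v x"
      using holder_onD(3)[OF u j] holder_onD(3)[OF v j] by blast
    then show "\<exists>g. continuous_on (closure U) g \<and> (\<forall>x\<in>U. g x = pderivs bs (\<lambda>x. u x + c * v x) x)"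
      using L(1)[OF j] by (intro exI[of _ "\<lambda>x. g x + c * h x"]) (auto intro!: continuous_intros)
    obtain A B where A: "\<And>x. x \<in> U \<Longrightarrow> \<bar>pderivs bs u x\<bar> \<le> A" and B: "\<And>x. x \<in> U \<Longrightarrow> \<bar>pderivs bs v x\<bar> \<le> B"
      using holder_onD(4)[OF u j] holder_onD(4)[OF v j] by (auto simp: bounded_iff)
    have "\<bar>pderivs bs u x + c * pderivs bs v x\<bar> \<le> A + \<bar>c\<bar> * B" if "x \<in> U" for x
      using A[OF that] mult_left_mono[OF B[OF that], of "\<bar>c\<bar>"] by (simp add: abs_mult[symmetric])
    then show "bounded (pderivs bs (\<lambda>x. u x + c * v x) ` U)"
      unfolding bounded_iff using L(1)[OF j] by (intro exI[of _ "A + \<bar>c\<bar> * B"]) auto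
  next
    fix bs :: "'a list" assume bs: "bs \<in> directions k"
    obtain A B where A: "\<And>x y. x \<in> U \<Longrightarrow> y \<in> U \<Longrightarrow> \<bar>pderivs bs u x - pderivs bs u y\<bar> \<le> A * dist x y powr \<alpha>"
      and B: "\<And>x y. x \<in> U \<Longrightarrow> y \<in> U \<Longrightarrow> \<bar>pderivs bs v x - pderivs bs v y\<bar> \<le> B * dist x y powr \<alpha>"
      using holder_onD(5)[OF u bs] holder_onD(5)[OF v bs] by blast
    have "\<bar>pderivs bs (\<lambda>x. u x + c * v x) x - pderivs bs (\<lambda>x. u x + c * v x) y\<bar> \<le> (A + \<bar>c\<bar> * B) * dist x y powr \<alpha>"
      if xy: "x \<in> U" "y \<in> U" for x y
    proof -
      have "pderivs bs (\<lambda>x. u x + c * v x) x - pderivs bs (\<lambda>x. u x + c * v x) y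
          = (pderivs bs u x - pderivs bs u y) + c * (pderivs bs v x - pderivs bs v y)"
        using L(1)[OF order_refl bs] xy by (simp add: algebra_simps)
      also have "\<bar>\<dots>\<bar> \<le> \<bar>pderivs bs u x - pderivs bs u y\<bar> + \<bar>c\<bar> * \<bar>pderivs bs v x - pderivs bs v y\<bar>"
        by (metis abs_mult abs_triangle_ineq)
      also have "\<dots> \<le> A * dist x y powr \<alpha> + \<bar>c\<bar> * (B * dist x y powr \<alpha>)"
        by (intro add_mono mult_left_mono A B xy) auto
      finally show ?thesis by (simp add: algebra_simps)
    qed
    then show "\<exists>C. \<forall>x\<in>U. \<forall>y\<in>U. \<bar>pderivs bs (\<lambda>x. u x + c * v x) x - pderivs bs (\<lambda>x. u x + c * v x) y\<bar> \<le> C * dist x y powr \<alpha>"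
      by blast
  qed
qed

lemma frechet_derivative_const_zero: "frechet_derivative (\<lambda>x. 0 :: real) (at x) b = 0"
  by (metis frechet_derivative_const)

lemma pderivs_zero [simp]: "pderivs bs (\<lambda>x. 0) = (\<lambda>x. 0)"
  by (induction bs) (auto simp: frechet_derivative_const_zero)

lemma holder_on_zero: "holder_on k \<alpha> U (\<lambda>x. 0)"
  by (auto simp: holder_on_def bounded_iff intro!: exI[of _ "\<lambda>x. 0"] exI[of _ "0::real"])

lemma holder_on_scale:
  assumes "open U" "holder_on k \<alpha> U u"
  shows "holder_on k \<alpha> U (\<lambda>x. c * u x)"
  using holder_on_lincomb[OF assms(1) holder_on_zero assms(2), of c] by simp

lemma pderivs_scale:
  assumes "open U" "holder_on k \<alpha> U u" "j \<le> k" "bs \<in> directions j" "x \<in> U"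
  shows "pderivs bs (\<lambda>x. c * u x) x = c * pderivs bs u x"
  using pderivs_holder_lincomb(1)[OF assms(1) holder_on_zero assms(2-), of c] by simp

section \<open>Finiteness, positivity and homogeneity of the Hoelder norm\<close>

context
  fixes U :: "'a::euclidean_space set" and u :: "'a \<Rightarrow> real" and k \<alpha>
  assumes U: "open U" "U \<noteq> {}" and u: "holder_on k \<alpha> U u"
begin

text \<open>\<open>Sup\<close> of an empty or unbounded set of reals says nothing, so each estimate
  of the norm needs a bound of this kind and a member of the set.\<close>

lemma bdd_above_pderivs:
  assumes "j \<le> k"
  shows "bdd_above {\<bar>pderivs bs u x\<bar> | bs x. bs \<in> directions j \<and> x \<in> U}"
proof -
  have "{\<bar>pderivs bs u x\<bar> | bs x. bs \<in> directions j \<and> x \<in> U} = (\<Union>bs\<in>directions j. (\<lambda>x. \<bar>pderivs bs u x\<bar>) ` U)"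
    by auto
  moreover have "bdd_above ((\<lambda>x. \<bar>pderivs bs u x\<bar>) ` U)" if "bs \<in> directions j" for bs
    using holder_onD(4)[OF u assms that] by (auto simp: bounded_iff bdd_above_def)
  ultimately show ?thesis by (simp add: bdd_above_UN)
qed

lemma bdd_above_holder_quotients:
  "bdd_above {\<bar>pderivs bs u x - pderivs bs u y\<bar> / dist x y powr \<alpha> | bs x y.
            bs \<in> directions k \<and> x \<in> U \<and> y \<in> U \<and> x \<noteq> y}" (is "bdd_above ?A")
proof -
  have "?A = (\<Union>bs\<in>directions k. {\<bar>pderivs bs u x - pderivs bs u y\<bar> / dist x y powr \<alpha> | x y. x \<in> U \<and> y \<in> U \<and> x \<noteq> y})"
    by auto
  moreover have "bdd_above {\<bar>pderivs bs u x - pderivs bs u y\<bar> / dist x y powr \<alpha> | x y. x \<in> U \<and> y \<in> U \<and> x \<noteq> y}"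
    if bs: "bs \<in> directions k" for bs
  proof -
    obtain C where "\<And>x y. x \<in> U \<Longrightarrow> y \<in> U \<Longrightarrow> \<bar>pderivs bs u x - pderivs bs u y\<bar> \<le> C * dist x y powr \<alpha>"
      using holder_onD(5)[OF u bs] by blast
    then show ?thesis by (intro bdd_aboveI[of _ C]) (auto simp: divide_le_eq)
  qed
  ultimately show ?thesis by (simp add: bdd_above_UN)
qed

text \<open>A nonempty open set has no isolated points; hence the set of Hoelder quotients is
  nonempty.\<close>

lemma two_points: obtains x y where "x \<in> U" "y \<in> U" "x \<noteq> y"
proof -
  obtain x where x: "x \<in> U" using U by blast
  then have "x islimpt U" using U interior_limit_point[of x U] by (simp add: interior_open)
  then obtain y where "y \<in> U" "y \<noteq> x" using islimptE[of x U UNIV] by auto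
  then show ?thesis using that x by blast
qed

lemma abs_pderivs_le_Sup:
  assumes "j \<le> k" "bs \<in> directions j" "x \<in> U"
  shows "\<bar>pderivs bs u x\<bar> \<le> Sup {\<bar>pderivs bs u x\<bar> | bs x. bs \<in> directions j \<and> x \<in> U}"
  using assms by (intro cSup_upper bdd_above_pderivs) auto

lemma Sup_pderivs_nonneg:
  assumes "j \<le> k"
  shows "0 \<le> Sup {\<bar>pderivs bs u x\<bar> | bs x. bs \<in> directions j \<and> x \<in> U}"
proof -
  obtain bs :: "'a list" and x where "bs \<in> directions j" "x \<in> U" using directions_nonempty U by blast
  then show ?thesis using abs_pderivs_le_Sup[OF assms] abs_ge_zero order_trans by blast
qed

lemma Sup_quotients_nonneg:
  "0 \<le> Sup {\<bar>pderivs bs u x - pderivs bs u y\<bar> / dist x y powr \<alpha> | bs x y.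
            bs \<in> directions k \<and> x \<in> U \<and> y \<in> U \<and> x \<noteq> y}"
proof -
  obtain bs :: "'a list" where bs: "bs \<in> directions k" using directions_nonempty by blast
  obtain x y where xy: "x \<in> U" "y \<in> U" "x \<noteq> y" by (rule two_points)
  have "0 \<le> \<bar>pderivs bs u x - pderivs bs u y\<bar> / dist x y powr \<alpha>" by simp
  also have "\<dots> \<le> Sup {\<bar>pderivs bs u x - pderivs bs u y\<bar> / dist x y powr \<alpha> | bs x y.
            bs \<in> directions k \<and> x \<in> U \<and> y \<in> U \<and> x \<noteq> y}"
    using bs xy by (intro cSup_upper bdd_above_holder_quotients) auto
  finally show ?thesis .
qed

text \<open>The way in which Frechet differentiability in \<open>holder_norm\<close> is exploited
  later: as a uniform pointwise estimate of all derivatives up to order 2.\<close>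

lemma abs_pderivs_le_holder_norm:
  assumes "j \<le> k" "bs \<in> directions j" "x \<in> U"
  shows "\<bar>pderivs bs u x\<bar> \<le> holder_norm k \<alpha> U u"
proof -
  have "Sup {\<bar>pderivs bs u x\<bar> | bs x. bs \<in> directions j \<and> x \<in> U}
     \<le> (\<Sum>j\<le>k. Sup {\<bar>pderivs bs u x\<bar> | bs x. bs \<in> directions j \<and> x \<in> U})"
    using assms(1) by (intro member_le_sum) (auto intro: Sup_pderivs_nonneg)
  then show ?thesis
    using abs_pderivs_le_Sup[OF assms] Sup_quotients_nonneg unfolding holder_norm_def by linarith
qed

lemma holder_norm_nonneg: "0 \<le> holder_norm k \<alpha> U u"
  unfolding holder_norm_def
  by (intro add_nonneg_nonneg sum_nonneg Sup_quotients_nonneg Sup_pderivs_nonneg) auto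

lemma holder_norm_scale_le: "holder_norm k \<alpha> U (\<lambda>x. c * u x) \<le> \<bar>c\<bar> * holder_norm k \<alpha> U u"
proof -
  have 1: "Sup {\<bar>pderivs bs (\<lambda>x. c * u x) x\<bar> | bs x. bs \<in> directions j \<and> x \<in> U}
     \<le> \<bar>c\<bar> * Sup {\<bar>pderivs bs u x\<bar> | bs x. bs \<in> directions j \<and> x \<in> U}" if "j \<le> k" for j
  proof (rule cSup_least)
    show "{\<bar>pderivs bs (\<lambda>x. c * u x) x\<bar> | bs x. bs \<in> directions j \<and> x \<in> U} \<noteq> {}"
      using directions_nonempty[of j] U by auto
    fix z assume "z \<in> {\<bar>pderivs bs (\<lambda>x. c * u x) x\<bar> | bs x. bs \<in> directions j \<and> x \<in> U}"
    then obtain bs x where z: "z = \<bar>pderivs bs (\<lambda>x. c * u x) x\<bar>" "bs \<in> directions j" "x \<in> U" by auto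
    then show "z \<le> \<bar>c\<bar> * Sup {\<bar>pderivs bs u x\<bar> | bs x. bs \<in> directions j \<and> x \<in> U}"
      using pderivs_scale[OF U(1) u that z(2,3), of c] abs_pderivs_le_Sup[OF that z(2,3)]
      by (simp add: abs_mult mult_left_mono)
  qed
  have 2: "Sup {\<bar>pderivs bs (\<lambda>x. c * u x) x - pderivs bs (\<lambda>x. c * u x) y\<bar> / dist x y powr \<alpha> | bs x y.
            bs \<in> directions k \<and> x \<in> U \<and> y \<in> U \<and> x \<noteq> y}
     \<le> \<bar>c\<bar> * Sup {\<bar>pderivs bs u x - pderivs bs u y\<bar> / dist x y powr \<alpha> | bs x y.
            bs \<in> directions k \<and> x \<in> U \<and> y \<in> U \<and> x \<noteq> y}" (is "Sup ?A \<le> _ * Sup ?B")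
  proof (rule cSup_least)
    obtain x y where xy: "x \<in> U" "y \<in> U" "x \<noteq> y" by (rule two_points)
    then show "?A \<noteq> {}" using directions_nonempty[of k] by blast
    fix z assume "z \<in> ?A"
    then obtain bs x y where z: "z = \<bar>pderivs bs (\<lambda>x. c * u x) x - pderivs bs (\<lambda>x. c * u x) y\<bar> / dist x y powr \<alpha>"
      and bs: "bs \<in> directions k" "x \<in> U" "y \<in> U" "x \<noteq> y" by auto
    have "z = \<bar>c\<bar> * (\<bar>pderivs bs u x - pderivs bs u y\<bar> / dist x y powr \<alpha>)"
      unfolding z using pderivs_scale[OF U(1) u order_refl bs(1), of _ c] bs
      by (simp add: abs_mult right_diff_distrib[symmetric])
    also have "\<dots> \<le> \<bar>c\<bar> * Sup ?B"
      by (intro mult_left_mono cSup_upper bdd_above_holder_quotients) (use bs in auto)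
    finally show "z \<le> \<bar>c\<bar> * Sup ?B" .
  qed
  have "(\<Sum>j\<le>k. Sup {\<bar>pderivs bs (\<lambda>x. c * u x) x\<bar> | bs x. bs \<in> directions j \<and> x \<in> U})
    \<le> (\<Sum>j\<le>k. \<bar>c\<bar> * Sup {\<bar>pderivs bs u x\<bar> | bs x. bs \<in> directions j \<and> x \<in> U})"
    by (intro sum_mono 1) auto
  with 2 show ?thesis unfolding holder_norm_def by (simp add: distrib_left sum_distrib_left)
qed

end

lemma holder_norm_cong:
  assumes U: "open U" and eq: "\<And>x. x \<in> U \<Longrightarrow> u x = v x"
  shows "holder_norm k \<alpha> U u = holder_norm k \<alpha> U v"
proof -
  have e: "pderivs bs u x = pderivs bs v x" if "x \<in> U" for bs x
    using pderivs_cong[OF U eq that] .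
  have "{\<bar>pderivs bs u x\<bar> | bs x. bs \<in> directions j \<and> x \<in> U} = {\<bar>pderivs bs v x\<bar> | bs x. bs \<in> directions j \<and> x \<in> U}" for j
    by (intro Collect_cong iff_exI) (auto simp: e)
  moreover have "{\<bar>pderivs bs u x - pderivs bs u y\<bar> / dist x y powr \<alpha> | bs x y. bs \<in> directions k \<and> x \<in> U \<and> y \<in> U \<and> x \<noteq> y}
    = {\<bar>pderivs bs v x - pderivs bs v y\<bar> / dist x y powr \<alpha> | bs x y. bs \<in> directions k \<and> x \<in> U \<and> y \<in> U \<and> x \<noteq> y}"
    by (intro Collect_cong iff_exI) (auto simp: e)
  ultimately show ?thesis unfolding holder_norm_def by simp
qed

lemma restrict_in_holder_space:
  assumes "open U" "holder_on k \<alpha> U u"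
  shows "restrict u (closure U) \<in> holder_space k \<alpha> U"
  using assms holder_on_cong[of U u "restrict u (closure U)" k \<alpha>] by (auto simp: holder_space_def)

lemma frontier_subset_closure: "frontier U \<subseteq> closure U"
  by (auto simp: frontier_def)

lemma restrict_in_bdry_space:
  assumes "open U" "holder_on k \<alpha> U u"
  shows "restrict u (frontier U) \<in> bdry_space k \<alpha> U"
proof -
  have "restrict u (frontier U) = restrict (restrict u (closure U)) (frontier U)"
    using frontier_subset_closure[of U] by (auto simp: restrict_def fun_eq_iff)
  then show ?thesis using restrict_in_holder_space[OF assms] unfolding bdry_space_def by blast
qed

lemma bdry_norm_le:
  assumes "open U" "U \<noteq> {}" "holder_on k \<alpha> U u" "\<And>x. x \<in> frontier U \<Longrightarrow> u x = \<eta> x"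
  shows "bdry_norm k \<alpha> U \<eta> \<le> holder_norm k \<alpha> U u"
proof -
  have "holder_norm k \<alpha> U u = holder_norm k \<alpha> U (restrict u (closure U))"
    using closure_subset[of U] by (intro holder_norm_cong assms) auto
  then have "holder_norm k \<alpha> U u \<in> {holder_norm k \<alpha> U u | u. u \<in> holder_space k \<alpha> U \<and> (\<forall>x\<in>frontier U. u x = \<eta> x)}"
    using restrict_in_holder_space[OF assms(1,3)] assms(4) frontier_subset_closure[of U]
    by (intro CollectI exI[of _ "restrict u (closure U)"]) auto
  moreover have "bdd_below {holder_norm k \<alpha> U u | u. u \<in> holder_space k \<alpha> U \<and> (\<forall>x\<in>frontier U. u x = \<eta> x)}"
    using holder_norm_nonneg[OF assms(1,2)] by (intro bdd_belowI[of _ 0]) (auto simp: holder_space_def)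
  ultimately show ?thesis unfolding bdry_norm_def by (intro cInf_lower)
qed

text \<open>A family indexed by direction lists and closed under differentiation lists its own
  partial derivatives, so one closed formula settles all orders at once. The Hoelder bound comes
  from the derivatives of the next order and the boundedness of \<open>U\<close>.\<close>

lemma smooth_family_holder_on:
  fixes D :: "'a::euclidean_space list \<Rightarrow> 'a \<Rightarrow> real"
  assumes \<alpha>: "0 < \<alpha>" "\<alpha> < 1" and U: "open U" "bounded U"
    and D: "\<And>bs x. (D bs has_derivative (\<lambda>h. \<Sum>b\<in>Basis. (h \<bullet> b) * D (b # bs) x)) (at x)"
  shows "holder_on k \<alpha> U (D [])" and "set bs \<subseteq> Basis \<Longrightarrow> pderivs bs (D []) = D bs"
proof -
  have p: "pderivs bs (D []) = D bs" if "set bs \<subseteq> Basis" for bs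
    using that
  proof (induction bs)
    case (Cons b bs)
    have "frechet_derivative (D bs) (at x) b = D (b # bs) x" for x
    proof -
      have "frechet_derivative (D bs) (at x) b = (\<Sum>c\<in>Basis. (b \<bullet> c) * D (c # bs) x)"
        by (subst frechet_derivative_at[OF D, symmetric]) simp
      also have "\<dots> = (\<Sum>c\<in>Basis. if c = b then D (c # bs) x else 0)"
        using Cons.prems by (intro sum.cong) (auto simp: inner_Basis)
      also have "\<dots> = D (b # bs) x" using Cons.prems by simp
      finally show ?thesis .
    qed
    then show ?case using Cons by auto
  qed simp
  show "set bs \<subseteq> Basis \<Longrightarrow> pderivs bs (D []) = D bs" by (rule p)
  have cont: "continuous_on S (D bs)" for S bs
    using D by (meson continuous_at_imp_continuous_on has_derivative_continuous)
  have bdd: "bounded (D bs ` U)" for bs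
  proof -
    have "compact (D bs ` closure U)" using U cont by (intro compact_continuous_image) (auto simp: compact_closure)
    then show ?thesis using closure_subset by (metis bounded_subset compact_imp_bounded image_mono)
  qed
  \<comment> \<open>\<open>U\<close> may fail to be convex; the mean value inequality is used in a
    ball around it, on which the next derivatives are bounded by compactness.\<close>
  obtain r where r: "U \<subseteq> cball 0 r" using U(2) using bounded_subset_ballD[of U 0] ball_subset_cball by blast
  have lip: "\<exists>C. \<forall>x\<in>U. \<forall>y\<in>U. \<bar>D bs x - D bs y\<bar> \<le> C * dist x y powr \<alpha>" for bs
  proof -
    have "\<exists>B. \<forall>x\<in>cball 0 r. norm (D (b # bs) x) \<le> B" for b
    proof -
      have "compact (D (b # bs) ` cball 0 r)" by (intro compact_continuous_image cont compact_cball)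
      then have "bounded (D (b # bs) ` cball 0 r)" by (rule compact_imp_bounded)
      then show ?thesis by (auto simp: bounded_iff)
    qed
    then have "\<exists>B. \<forall>b. \<forall>x\<in>cball 0 r. \<bar>D (b # bs) x\<bar> \<le> B b"
      by (intro choice) (simp add: real_norm_def)
    then obtain B where B: "\<And>b x. x \<in> cball 0 r \<Longrightarrow> \<bar>D (b # bs) x\<bar> \<le> B b" by blast
    define K where "K = (\<Sum>b\<in>Basis. \<bar>B b\<bar>)"
    have K0: "0 \<le> K" by (auto simp: K_def intro: sum_nonneg)
    have Db: "\<bar>\<Sum>b\<in>Basis. (h \<bullet> b) * D (b # bs) x\<bar> \<le> K * norm h" if "x \<in> cball 0 r" for x h
    proof -
      have "\<bar>\<Sum>b\<in>Basis. (h \<bullet> b) * D (b # bs) x\<bar> \<le> (\<Sum>b\<in>Basis. \<bar>(h \<bullet> b) * D (b # bs) x\<bar>)" by (rule sum_abs)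
      also have "\<dots> \<le> (\<Sum>b\<in>Basis. norm h * \<bar>B b\<bar>)"
        unfolding abs_mult using B[OF that, THEN order_trans, OF abs_ge_self]
        by (intro sum_mono mult_mono Basis_le_norm) auto
      finally show ?thesis by (simp add: K_def sum_distrib_left mult.commute)
    qed
    have L: "\<bar>D bs x - D bs y\<bar> \<le> K * norm (x - y)" if "x \<in> U" "y \<in> U" for x y
    proof (rule mvt_le[OF _ D Db])
      show "closed_segment x y \<subseteq> cball 0 r" using that r by (intro closed_segment_subset) auto
    qed
    \<comment> \<open>From Lipschitz to Hoelder: of the factors
      \<open>norm (x - y) powr (1 - \<alpha>)\<close> and \<open>norm (x - y) powr \<alpha>\<close>,
      the first is bounded by the diameter of the ball.\<close>
    have "\<bar>D bs x - D bs y\<bar> \<le> (K * (2 * \<bar>r\<bar>) powr (1 - \<alpha>)) * dist x y powr \<alpha>" if xy: "x \<in> U" "y \<in> U" for x y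
    proof -
      have "norm (x - y) \<le> 2 * \<bar>r\<bar>"
        using subsetD[OF r xy(1)] subsetD[OF r xy(2)] norm_triangle_ineq4[of x y] by simp
      then have "norm (x - y) powr (1 - \<alpha>) \<le> (2 * \<bar>r\<bar>) powr (1 - \<alpha>)"
        using \<alpha> by (intro powr_mono2) auto
      moreover have "norm (x - y) = norm (x - y) powr (1 - \<alpha>) * norm (x - y) powr \<alpha>"
        by (simp add: powr_add[symmetric])
      ultimately have "norm (x - y) \<le> (2 * \<bar>r\<bar>) powr (1 - \<alpha>) * norm (x - y) powr \<alpha>"
        by (metis mult_right_mono powr_ge_zero)
      then have "K * norm (x - y) \<le> K * ((2 * \<bar>r\<bar>) powr (1 - \<alpha>) * norm (x - y) powr \<alpha>)"
        using K0 by (rule mult_left_mono)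
      then show ?thesis using L[OF xy] by (simp add: dist_norm mult.assoc)
    qed
    then show ?thesis by blast
  qed
  show "holder_on k \<alpha> U (D [])"
    unfolding holder_on_def
  proof (intro conjI allI impI ballI)
    show "continuous_on (closure U) (D [])" by (rule cont)
  next
    fix j x and bs :: "'a list" assume "j < k" "bs \<in> directions j"
    then show "pderivs bs (D []) differentiable (at x)"
      using p D unfolding directions_def differentiable_def by (metis (no_types, lifting) mem_Collect_eq)
  next
    fix j and bs :: "'a list" assume "j \<le> k" "bs \<in> directions j"
    then have "pderivs bs (D []) = D bs" by (simp add: p directions_def)
    then show "\<exists>g. continuous_on (closure U) g \<and> (\<forall>x\<in>U. g x = pderivs bs (D []) x)"
      "bounded (pderivs bs (D []) ` U)"
      using cont bdd by (auto intro!: exI[of _ "D bs"])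
  qed (use p lip in \<open>auto simp: directions_def\<close>)
qed

section \<open>Energy estimate and Green's formula\<close>

declare pderivs.simps(2) [simp del]

text \<open>The regularity that \<open>integral_directional_derivative_zero\<close> asks for, apart
  from the limit at the boundary. It is stable under products and differences, and the explicit
  \<open>D\<close> lets the product rule appear directly as a formula for the integrand.\<close>

definition bounded_C1 :: "'a::euclidean_space set \<Rightarrow> ('a \<Rightarrow> real) \<Rightarrow> ('a \<Rightarrow> 'a \<Rightarrow> real) \<Rightarrow> bool" where
  "bounded_C1 \<Omega> f D \<longleftrightarrow>
     (\<forall>x\<in>\<Omega>. (f has_derivative D x) (at x)) \<and>
     (\<exists>K. \<forall>x\<in>\<Omega>. \<bar>f x\<bar> \<le> K \<and> (\<forall>h. \<bar>D x h\<bar> \<le> K * norm h)) \<and>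
     (\<forall>e. continuous_on \<Omega> (\<lambda>x. D x e))"

lemma bounded_C1_continuous: "bounded_C1 \<Omega> f D \<Longrightarrow> continuous_on \<Omega> f"
  unfolding bounded_C1_def by (meson continuous_at_imp_continuous_on has_derivative_continuous)

lemma bounded_C1_mult:
  assumes f: "bounded_C1 \<Omega> f D" and g: "bounded_C1 \<Omega> g E"
  shows "bounded_C1 \<Omega> (\<lambda>x. f x * g x) (\<lambda>x h. f x * E x h + D x h * g x)"
proof -
  obtain K where K: "\<And>x. x \<in> \<Omega> \<Longrightarrow> \<bar>f x\<bar> \<le> K" "\<And>x h. x \<in> \<Omega> \<Longrightarrow> \<bar>D x h\<bar> \<le> K * norm h"
    using f unfolding bounded_C1_def by blast
  obtain L where L: "\<And>x. x \<in> \<Omega> \<Longrightarrow> \<bar>g x\<bar> \<le> L" "\<And>x h. x \<in> \<Omega> \<Longrightarrow> \<bar>E x h\<bar> \<le> L * norm h"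
    using g unfolding bounded_C1_def by blast
  show ?thesis
    unfolding bounded_C1_def
  proof (intro conjI ballI allI)
    show "((\<lambda>x. f x * g x) has_derivative (\<lambda>h. f x * E x h + D x h * g x)) (at x)" if "x \<in> \<Omega>" for x
      using f g that unfolding bounded_C1_def by (intro has_derivative_mult) auto
    show "continuous_on \<Omega> (\<lambda>x. f x * E x e + D x e * g x)" for e
      using f g bounded_C1_continuous[OF f] bounded_C1_continuous[OF g]
      unfolding bounded_C1_def by (intro continuous_intros) auto
    show "\<exists>K. \<forall>x\<in>\<Omega>. \<bar>f x * g x\<bar> \<le> K \<and> (\<forall>h. \<bar>f x * E x h + D x h * g x\<bar> \<le> K * norm h)"
    proof (intro exI[of _ "2 * \<bar>K\<bar> * \<bar>L\<bar>"] ballI conjI allI)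
      fix x h assume x: "x \<in> \<Omega>"
      have fK: "\<bar>f x\<bar> \<le> \<bar>K\<bar>" and gL: "\<bar>g x\<bar> \<le> \<bar>L\<bar>" using K(1)[OF x] L(1)[OF x] by auto
      have "\<bar>f x * g x\<bar> \<le> \<bar>K\<bar> * \<bar>L\<bar>" unfolding abs_mult using fK gL by (intro mult_mono) auto
      moreover have "0 \<le> \<bar>K\<bar> * \<bar>L\<bar>" by simp
      ultimately show "\<bar>f x * g x\<bar> \<le> 2 * \<bar>K\<bar> * \<bar>L\<bar>" by linarith
      have DK: "\<bar>D x h\<bar> \<le> \<bar>K\<bar> * norm h" and EL: "\<bar>E x h\<bar> \<le> \<bar>L\<bar> * norm h"
        using K(2)[OF x, of h] L(2)[OF x, of h]
        by (meson abs_ge_self mult_right_mono norm_ge_zero order_trans)+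
      have "\<bar>f x * E x h\<bar> \<le> \<bar>K\<bar> * (\<bar>L\<bar> * norm h)" "\<bar>D x h * g x\<bar> \<le> (\<bar>K\<bar> * norm h) * \<bar>L\<bar>"
        unfolding abs_mult using fK gL DK EL by (auto intro!: mult_mono)
      then show "\<bar>f x * E x h + D x h * g x\<bar> \<le> 2 * \<bar>K\<bar> * \<bar>L\<bar> * norm h"
        by (simp add: algebra_simps)
    qed
  qed
qed

lemma bounded_C1_diff:
  assumes f: "bounded_C1 \<Omega> f D" and g: "bounded_C1 \<Omega> g E"
  shows "bounded_C1 \<Omega> (\<lambda>x. f x - g x) (\<lambda>x h. D x h - E x h)"
proof -
  obtain K where K: "\<And>x. x \<in> \<Omega> \<Longrightarrow> \<bar>f x\<bar> \<le> K" "\<And>x h. x \<in> \<Omega> \<Longrightarrow> \<bar>D x h\<bar> \<le> K * norm h"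
    using f unfolding bounded_C1_def by blast
  obtain L where L: "\<And>x. x \<in> \<Omega> \<Longrightarrow> \<bar>g x\<bar> \<le> L" "\<And>x h. x \<in> \<Omega> \<Longrightarrow> \<bar>E x h\<bar> \<le> L * norm h"
    using g unfolding bounded_C1_def by blast
  have "\<bar>f x - g x\<bar> \<le> K + L \<and> (\<forall>h. \<bar>D x h - E x h\<bar> \<le> (K + L) * norm h)" if "x \<in> \<Omega>" for x
  proof (intro conjI allI)
    show "\<bar>f x - g x\<bar> \<le> K + L" using K(1)[OF that] L(1)[OF that] by linarith
    show "\<bar>D x h - E x h\<bar> \<le> (K + L) * norm h" for h
      using K(2)[OF that, of h] L(2)[OF that, of h] by (simp add: distrib_right)
  qed
  moreover have "((\<lambda>x. f x - g x) has_derivative (\<lambda>h. D x h - E x h)) (at x)" if "x \<in> \<Omega>" for x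
    using f g that unfolding bounded_C1_def by (intro has_derivative_diff) auto
  moreover have "continuous_on \<Omega> (\<lambda>x. D x e - E x e)" for e
    using f g unfolding bounded_C1_def by (intro continuous_intros) auto
  ultimately show ?thesis unfolding bounded_C1_def by blast
qed

lemma bounded_C1_coordinate:
  assumes "bounded \<Omega>"
  shows "bounded_C1 \<Omega> (\<lambda>x. x \<bullet> b) (\<lambda>x h. h \<bullet> b)"
proof -
  obtain R where R: "\<And>x. x \<in> \<Omega> \<Longrightarrow> norm x \<le> R" using assms by (auto simp: bounded_iff)
  have "\<bar>x \<bullet> b\<bar> \<le> (\<bar>R\<bar> + 1) * norm b \<and> (\<forall>h. \<bar>h \<bullet> b\<bar> \<le> ((\<bar>R\<bar> + 1) * norm b) * norm h)" if "x \<in> \<Omega>" for x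
  proof (intro conjI allI)
    have "\<bar>x \<bullet> b\<bar> \<le> norm x * norm b" by (rule Cauchy_Schwarz_ineq2)
    also have "\<dots> \<le> (\<bar>R\<bar> + 1) * norm b" using R[OF that] by (intro mult_right_mono) auto
    finally show "\<bar>x \<bullet> b\<bar> \<le> (\<bar>R\<bar> + 1) * norm b" .
    fix h
    have "\<bar>h \<bullet> b\<bar> \<le> norm h * norm b" by (rule Cauchy_Schwarz_ineq2)
    also have "\<dots> \<le> ((\<bar>R\<bar> + 1) * norm b) * norm h" by (simp add: algebra_simps)
    finally show "\<bar>h \<bullet> b\<bar> \<le> ((\<bar>R\<bar> + 1) * norm b) * norm h" .
  qed
  moreover have "((\<lambda>x. x \<bullet> b) has_derivative (\<lambda>h. h \<bullet> b)) (at x)" for x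
    by (auto intro!: derivative_eq_intros)
  ultimately show ?thesis unfolding bounded_C1_def by (intro conjI ballI allI) (auto intro: continuous_intros)
qed

lemma abs_sum_inner_Basis_le:
  fixes h :: "'a::euclidean_space" and K :: real
  assumes "\<And>b. b \<in> Basis \<Longrightarrow> \<bar>a b\<bar> \<le> K"
  shows "\<bar>\<Sum>b\<in>Basis. (h \<bullet> b) * a b\<bar> \<le> (DIM('a) * K) * norm h"
proof -
  have "\<bar>\<Sum>b\<in>Basis. (h \<bullet> b) * a b\<bar> \<le> (\<Sum>b\<in>Basis. \<bar>(h \<bullet> b) * a b\<bar>)" by (rule sum_abs)
  also have "\<dots> \<le> (\<Sum>b\<in>(Basis::'a set). norm h * K)"
    unfolding abs_mult using assms by (intro sum_mono mult_mono Basis_le_norm) auto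
  finally show ?thesis by (simp add: mult_ac)
qed

lemma sum_inner_Basis: "c \<in> Basis \<Longrightarrow> (\<Sum>b\<in>Basis. (c \<bullet> b) * a b) = (a c :: real)"
proof -
  assume c: "c \<in> (Basis :: 'a::euclidean_space set)"
  have "(\<Sum>b\<in>Basis. (c \<bullet> b) * a b) = (\<Sum>b\<in>Basis. if b = c then a b else 0)"
    using c by (intro sum.cong) (auto simp: inner_Basis)
  then show ?thesis using c by simp
qed

lemma tendsto_zero_mult_bounded:
  assumes "(f \<longlongrightarrow> (0::real)) (at z within \<Omega>)" "\<And>x. x \<in> \<Omega> \<Longrightarrow> \<bar>g x\<bar> \<le> K"
  shows "((\<lambda>x. f x * g x) \<longlongrightarrow> 0) (at z within \<Omega>)"
proof (rule Lim_null_comparison)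
  show "\<forall>\<^sub>F x in at z within \<Omega>. norm (f x * g x) \<le> \<bar>f x\<bar> * K"
    unfolding eventually_at_filter using assms(2)
    by (auto simp: abs_mult mult_left_mono)
  show "((\<lambda>x. \<bar>f x\<bar> * K) \<longlongrightarrow> 0) (at z within \<Omega>)"
    using tendsto_mult_right[OF tendsto_rabs[OF assms(1)], of K] by simp
qed

definition laplacian :: "('a::euclidean_space \<Rightarrow> real) \<Rightarrow> 'a \<Rightarrow> real" where
  "laplacian u x = (\<Sum>b\<in>Basis. pderivs [b, b] u x)"

definition gradient :: "('a::euclidean_space \<Rightarrow> real) \<Rightarrow> 'a \<Rightarrow> 'a" where
  "gradient u x = (\<Sum>b\<in>Basis. pderivs [b] u x *\<^sub>R b)"

lemma inner_gradient: "b \<in> Basis \<Longrightarrow> gradient u x \<bullet> b = pderivs [b] u x"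
  by (simp add: gradient_def inner_sum_left inner_Basis if_distrib cong: if_cong)

context
  fixes \<Omega> :: "'a::euclidean_space set" and \<alpha> :: real
  assumes op: "open \<Omega>"
begin

lemma bounded_C1_pderivs:
  assumes u: "holder_on k \<alpha> \<Omega> u" and bs: "bs \<in> directions j" and jk: "j < k"
  shows "bounded_C1 \<Omega> (pderivs bs u) (\<lambda>x h. \<Sum>b\<in>Basis. (h \<bullet> b) * pderivs (b # bs) u x)"
proof -
  have "\<exists>K. \<forall>x\<in>\<Omega>. \<bar>pderivs (b # bs) u x\<bar> \<le> K" if "b \<in> Basis" for b
    using holder_onD(4)[OF u, of "Suc j" "b # bs"] that bs jk by (simp add: bounded_iff)
  then obtain K where K: "\<And>b x. b \<in> Basis \<Longrightarrow> x \<in> \<Omega> \<Longrightarrow> \<bar>pderivs (b # bs) u x\<bar> \<le> K b" by metis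
  obtain L where L: "\<And>x. x \<in> \<Omega> \<Longrightarrow> \<bar>pderivs bs u x\<bar> \<le> L"
    using holder_onD(4)[OF u, of j bs] bs jk by (auto simp: bounded_iff)
  define M where "M = (\<Sum>b\<in>(Basis::'a set). \<bar>K b\<bar>)"
  have M: "\<bar>pderivs (b # bs) u x\<bar> \<le> M" if "b \<in> Basis" "x \<in> \<Omega>" for b x
  proof -
    have "\<bar>pderivs (b # bs) u x\<bar> \<le> \<bar>K b\<bar>" using K[OF that] by linarith
    also have "\<dots> \<le> M" unfolding M_def using that by (intro member_le_sum) auto
    finally show ?thesis .
  qed
  have M0: "M \<ge> 0" by (auto simp: M_def sum_nonneg)
  show ?thesis
    unfolding bounded_C1_def
  proof (intro conjI ballI allI)
    show "(pderivs bs u has_derivative (\<lambda>h. \<Sum>b\<in>Basis. h \<bullet> b * pderivs (b # bs) u x)) (at x)" if "x \<in> \<Omega>" for x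
      using holder_onD(2)[OF u jk bs that] by (rule pderivs_has_derivative)
    show "continuous_on \<Omega> (\<lambda>x. \<Sum>b\<in>Basis. e \<bullet> b * pderivs (b # bs) u x)" for e
      using jk bs by (intro continuous_intros holder_on_continuous_pderivs[OF u, of "Suc j"]) auto
    show "\<exists>K. \<forall>x\<in>\<Omega>. \<bar>pderivs bs u x\<bar> \<le> K \<and> (\<forall>h. \<bar>\<Sum>b\<in>Basis. h \<bullet> b * pderivs (b # bs) u x\<bar> \<le> K * norm h)"
    proof (intro exI[of _ "DIM('a) * M + \<bar>L\<bar>"] ballI conjI allI)
      fix x h assume x: "x \<in> \<Omega>"
      show "\<bar>pderivs bs u x\<bar> \<le> DIM('a) * M + \<bar>L\<bar>"
        using L[OF x] mult_nonneg_nonneg[OF of_nat_0_le_iff M0, of "DIM('a)"] by linarith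
      have "\<bar>\<Sum>b\<in>Basis. h \<bullet> b * pderivs (b # bs) u x\<bar> \<le> (DIM('a) * M) * norm h"
        using abs_sum_inner_Basis_le[of "\<lambda>b. pderivs (b # bs) u x" M h] M[OF _ x] by simp
      also have "\<dots> \<le> (DIM('a) * M + \<bar>L\<bar>) * norm h" by (intro mult_right_mono) auto
      finally show "\<bar>\<Sum>b\<in>Basis. h \<bullet> b * pderivs (b # bs) u x\<bar> \<le> (DIM('a) * M + \<bar>L\<bar>) * norm h" .
    qed
  qed
qed

context
  assumes bd: "bounded \<Omega>" and neg: "negligible (frontier \<Omega>)"
begin

lemma integral_bounded_C1_zero:
  assumes f: "bounded_C1 \<Omega> f D" and "\<And>z. z \<in> frontier \<Omega> \<Longrightarrow> (f \<longlongrightarrow> 0) (at z within \<Omega>)"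
  shows "(LINT x:\<Omega>|lborel. D x e) = 0" and "set_integrable lborel \<Omega> (\<lambda>x. D x e)"
proof -
  obtain K where K: "\<And>x h. x \<in> \<Omega> \<Longrightarrow> \<bar>D x h\<bar> \<le> K * norm h"
    using f unfolding bounded_C1_def by blast
  have c: "continuous_on \<Omega> (\<lambda>x. D x e)" and d: "\<And>x. x \<in> \<Omega> \<Longrightarrow> (f has_derivative D x) (at x)"
    using f unfolding bounded_C1_def by blast+
  show "(LINT x:\<Omega>|lborel. D x e) = 0"
    by (rule integral_directional_derivative_zero[OF op bd neg d K assms(2) c])
  show "set_integrable lborel \<Omega> (\<lambda>x. D x e)"
    using K by (intro set_integrable_bounded_continuous[OF op bd c]) (auto simp: bounded_iff)
qed

text \<open>The field w grad u - u grad w tends to 0 at the boundary, because \<open>u\<close> and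
  its gradient do while \<open>w\<close> and its gradient are bounded. So each component has a
  derivative with integral 0.\<close>

lemma green_zero:
  assumes u: "holder_on 2 \<alpha> \<Omega> u" and w: "holder_on 2 \<alpha> \<Omega> w"
    and u0: "\<And>z. z \<in> frontier \<Omega> \<Longrightarrow> (u \<longlongrightarrow> 0) (at z within \<Omega>)"
    and du0: "\<And>z. z \<in> frontier \<Omega> \<Longrightarrow> (gradient u \<longlongrightarrow> 0) (at z within \<Omega>)"
  shows "(LINT x:\<Omega>|lborel. w x * laplacian u x - u x * laplacian w x) = 0"
proof -
  have C: "bounded_C1 \<Omega> v (\<lambda>x h. \<Sum>b\<in>Basis. (h \<bullet> b) * pderivs [b] v x)"
    "c \<in> Basis \<Longrightarrow> bounded_C1 \<Omega> (pderivs [c] v) (\<lambda>x h. \<Sum>b\<in>Basis. (h \<bullet> b) * pderivs [b, c] v x)"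
    if "holder_on 2 \<alpha> \<Omega> v" for v c
    using bounded_C1_pderivs[OF that, of "[]" 0] bounded_C1_pderivs[OF that, of "[c]" 1]
    by (auto simp: directions_def simp del: pderivs.simps(2))
  \<comment> \<open>Derivative of the \<open>b\<close>-th component of the field in direction
    \<open>h\<close>, in the shape produced by \<open>bounded_C1_mult\<close>. At
    \<open>h = b\<close> the products of first derivatives cancel.\<close>
  define D where "D b x h = (w x * (\<Sum>c\<in>Basis. (h \<bullet> c) * pderivs [c, b] u x) + (\<Sum>c\<in>Basis. (h \<bullet> c) * pderivs [c] w x) * pderivs [b] u x)
      - (u x * (\<Sum>c\<in>Basis. (h \<bullet> c) * pderivs [c, b] w x) + (\<Sum>c\<in>Basis. (h \<bullet> c) * pderivs [c] u x) * pderivs [b] w x)" for b x h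
  have DC: "bounded_C1 \<Omega> (\<lambda>x. w x * pderivs [b] u x - u x * pderivs [b] w x) (D b)" if "b \<in> Basis" for b
    unfolding D_def by (intro bounded_C1_diff bounded_C1_mult C u w that)
  have lim: "((\<lambda>x. w x * pderivs [b] u x - u x * pderivs [b] w x) \<longlongrightarrow> 0) (at z within \<Omega>)"
    if b: "b \<in> Basis" and z: "z \<in> frontier \<Omega>" for b z
  proof -
    obtain K where K: "\<And>x. x \<in> \<Omega> \<Longrightarrow> \<bar>w x\<bar> \<le> K"
      using C(1)[OF w] unfolding bounded_C1_def by blast
    obtain L where L: "\<And>x. x \<in> \<Omega> \<Longrightarrow> \<bar>pderivs [b] w x\<bar> \<le> L"
      using C(2)[OF w b] unfolding bounded_C1_def by blast
    have "((\<lambda>x. gradient u x \<bullet> b) \<longlongrightarrow> 0 \<bullet> b) (at z within \<Omega>)" by (intro tendsto_intros du0 z)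
    then have "((\<lambda>x. pderivs [b] u x) \<longlongrightarrow> 0) (at z within \<Omega>)" unfolding inner_gradient[OF b] by simp
    then have "((\<lambda>x. pderivs [b] u x * w x) \<longlongrightarrow> 0) (at z within \<Omega>)"
      using K by (rule tendsto_zero_mult_bounded)
    moreover have "((\<lambda>x. u x * pderivs [b] w x) \<longlongrightarrow> 0) (at z within \<Omega>)"
      using u0[OF z] L by (rule tendsto_zero_mult_bounded)
    ultimately show ?thesis using tendsto_diff by (fastforce simp: mult.commute)
  qed
  note I = integral_bounded_C1_zero[OF DC lim]
  have eq: "w x * laplacian u x - u x * laplacian w x = (\<Sum>b\<in>Basis. D b x b)" for x
  proof -
    have "D b x b = w x * pderivs [b, b] u x - u x * pderivs [b, b] w x" if "b \<in> Basis" for b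
      unfolding D_def using that by (simp only: sum_inner_Basis) simp
    then show ?thesis by (simp add: laplacian_def sum_subtractf sum_distrib_left)
  qed
  have "(LINT x:\<Omega>|lborel. w x * laplacian u x - u x * laplacian w x) = (\<Sum>b\<in>Basis. LINT x:\<Omega>|lborel. D b x b)"
    unfolding eq set_lebesgue_integral_def scaleR_sum_right
    by (rule Bochner_Integration.integral_sum) (use I(2) in \<open>simp add: set_integrable_def\<close>)
  then show ?thesis using I(1) by simp
qed

text \<open>Poincare's inequality and the equation tested with \<open>u\<close>, in one stroke. The
  divergences of (x . b0) u^2 b0 and of u grad u integrate to 0. The first yields u^2 and a cross
  term that |grad u|^2 absorbs; the second supplies |grad u|^2 together with q u^2, which is where
  the sign of \<open>q\<close> enters. The resulting constant does not depend on
  \<open>q\<close>.\<close>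

lemma energy_estimate:
  assumes u: "holder_on 2 \<alpha> \<Omega> u"
    and u0: "\<And>z. z \<in> frontier \<Omega> \<Longrightarrow> (u \<longlongrightarrow> 0) (at z within \<Omega>)"
    and q: "\<And>x. x \<in> \<Omega> \<Longrightarrow> q x \<ge> 0" "continuous_on \<Omega> q" "bounded (q ` \<Omega>)"
    and R: "\<And>x. x \<in> \<Omega> \<Longrightarrow> norm x \<le> R"
  shows "(LINT x:\<Omega>|lborel. (u x)\<^sup>2) \<le> 16 * R^4 * (LINT x:\<Omega>|lborel. (laplacian u x - q x * u x)\<^sup>2)"
proof -
  obtain b0 :: 'a where b0: "b0 \<in> Basis" using nonempty_Basis by blast
  have Cu: "bounded_C1 \<Omega> u (\<lambda>x h. \<Sum>b\<in>Basis. (h \<bullet> b) * pderivs [b] u x)"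
    and Cd: "\<And>c. c \<in> Basis \<Longrightarrow> bounded_C1 \<Omega> (pderivs [c] u) (\<lambda>x h. \<Sum>b\<in>Basis. (h \<bullet> b) * pderivs [b, c] u x)"
    using bounded_C1_pderivs[OF u, of "[]" 0] bounded_C1_pderivs[OF u, of _ 1]
    by (auto simp: directions_def simp del: pderivs.simps(2))
  define f where "f x = laplacian u x - q x * u x" for x
  define D where "D b x h = u x * (\<Sum>c\<in>Basis. (h \<bullet> c) * pderivs [c, b] u x) + (\<Sum>c\<in>Basis. (h \<bullet> c) * pderivs [c] u x) * pderivs [b] u x" for b x h
  define E where "E x h = (x \<bullet> b0) * (u x * (\<Sum>c\<in>Basis. (h \<bullet> c) * pderivs [c] u x) + (\<Sum>c\<in>Basis. (h \<bullet> c) * pderivs [c] u x) * u x)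
     + (h \<bullet> b0) * (u x * u x)" for x h
  have DC: "bounded_C1 \<Omega> (\<lambda>x. u x * pderivs [b] u x) (D b)" if "b \<in> Basis" for b
    unfolding D_def by (intro bounded_C1_mult Cu Cd that)
  have EC: "bounded_C1 \<Omega> (\<lambda>x. (x \<bullet> b0) * (u x * u x)) E"
    unfolding E_def by (intro bounded_C1_mult bounded_C1_coordinate Cu bd)
  obtain K where K: "\<And>x. x \<in> \<Omega> \<Longrightarrow> \<bar>u x\<bar> \<le> K" using Cu unfolding bounded_C1_def by blast
  have lD: "((\<lambda>x. u x * pderivs [b] u x) \<longlongrightarrow> 0) (at z within \<Omega>)" if b: "b \<in> Basis" and z: "z \<in> frontier \<Omega>" for b z
  proof -
    obtain L where L: "\<And>x. x \<in> \<Omega> \<Longrightarrow> \<bar>pderivs [b] u x\<bar> \<le> L"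
      using Cd[OF b] unfolding bounded_C1_def by blast
    show ?thesis using u0[OF z] L by (rule tendsto_zero_mult_bounded)
  qed
  have lE: "((\<lambda>x. (x \<bullet> b0) * (u x * u x)) \<longlongrightarrow> 0) (at z within \<Omega>)" if "z \<in> frontier \<Omega>" for z
    by (rule tendsto_eq_intros u0 that refl | simp)+
  note ID = integral_bounded_C1_zero[OF DC lD] and IE = integral_bounded_C1_zero[OF EC lE]
  \<comment> \<open>The weight \<open>2 * R\<^sup>2\<close> lets the gradient term dominate 2 y^2
    A^2, which completing the square leaves over, where |y| is at most \<open>R\<close>.\<close>
  define P where "P x = E x b0 + 2 * R\<^sup>2 * (\<Sum>b\<in>Basis. D b x b)" for x
  have iS: "set_integrable lborel \<Omega> (\<lambda>x. \<Sum>b\<in>Basis. D b x b)"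
    unfolding set_integrable_def scaleR_sum_right
    by (intro Bochner_Integration.integrable_sum) (use ID(2) in \<open>simp add: set_integrable_def\<close>)
  have iP: "set_integrable lborel \<Omega> P"
    unfolding P_def by (intro set_integral_add set_integrable_mult_right iS IE(2))
  have P0: "(LINT x:\<Omega>|lborel. P x) = 0"
  proof -
    have "(LINT x:\<Omega>|lborel. (\<Sum>b\<in>Basis. D b x b)) = (\<Sum>b\<in>Basis. LINT x:\<Omega>|lborel. D b x b)"
      unfolding set_lebesgue_integral_def scaleR_sum_right
      by (rule Bochner_Integration.integral_sum) (use ID(2) in \<open>simp add: set_integrable_def\<close>)
    then show ?thesis
      unfolding P_def using ID(1) IE iS by (simp add: set_integral_add)
  qed
  \<comment> \<open>Of the term u^2, one half is spent on the cross term with the gradient and one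
    quarter on the cross term with \<open>f\<close>. The quarter that remains, against 4 R^4 f^2,
    gives the factor 16 R^4.\<close>
  have le: "(u x)\<^sup>2 / 4 - 4 * R^4 * (f x)\<^sup>2 \<le> P x" if x: "x \<in> \<Omega>" for x
  proof -
    define y A G where "y = x \<bullet> b0" and "A = pderivs [b0] u x" and "G = (\<Sum>b\<in>Basis. (pderivs [b] u x)\<^sup>2)"
    have yR: "y\<^sup>2 \<le> R\<^sup>2"
      using R[OF x] Basis_le_norm[OF b0, of x] unfolding y_def by (intro abs_le_square_iff[THEN iffD1]) simp
    have AG: "A\<^sup>2 \<le> G" unfolding A_def G_def using b0 by (intro member_le_sum) auto
    have "D b x b = u x * pderivs [b, b] u x + (pderivs [b] u x)\<^sup>2" if "b \<in> Basis" for b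
      unfolding D_def using that by (simp only: sum_inner_Basis power2_eq_square)
    then have SD: "(\<Sum>b\<in>Basis. D b x b) = u x * (q x * u x + f x) + G"
      by (simp add: sum.distrib G_def f_def laplacian_def sum_distrib_left)
    have SE: "E x b0 = (u x)\<^sup>2 + 2 * y * u x * A"
      unfolding E_def using b0 by (simp only: sum_inner_Basis) (simp add: y_def A_def power2_eq_square algebra_simps)
    have 1: "2 * y * u x * A \<ge> - ((u x)\<^sup>2 / 2) - 2 * (y\<^sup>2 * A\<^sup>2)"
      using zero_le_power2[of "u x + 2 * y * A"] by (simp add: power2_eq_square algebra_simps)
    have 2: "y\<^sup>2 * A\<^sup>2 \<le> R\<^sup>2 * G" using yR AG by (intro mult_mono) auto
    have 3: "2 * R\<^sup>2 * (u x * f x) \<ge> - ((u x)\<^sup>2 / 4) - 4 * R^4 * (f x)\<^sup>2"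
      using zero_le_power2[of "u x / 2 + 2 * R\<^sup>2 * f x"] by (simp add: power2_eq_square power4_eq_xxxx algebra_simps)
    have 4: "0 \<le> R\<^sup>2 * (q x * (u x)\<^sup>2)" using q(1)[OF x] by simp
    have "P x = (u x)\<^sup>2 + 2 * y * u x * A + 2 * (R\<^sup>2 * (q x * (u x)\<^sup>2)) + 2 * R\<^sup>2 * (u x * f x) + 2 * (R\<^sup>2 * G)"
      unfolding P_def SD SE by (simp add: algebra_simps power2_eq_square)
    then show ?thesis using 1 2 3 4 by linarith
  qed
  have cu: "continuous_on \<Omega> u" and cf: "continuous_on \<Omega> f"
  proof -
    show "continuous_on \<Omega> u" by (rule bounded_C1_continuous[OF Cu])
    then show "continuous_on \<Omega> f" unfolding f_def laplacian_def
      by (intro continuous_intros q holder_on_continuous_pderivs[OF u order_refl]) (auto simp: directions_def)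
  qed
  obtain Q where Q: "\<And>x. x \<in> \<Omega> \<Longrightarrow> \<bar>q x\<bar> \<le> Q" using q(3) by (auto simp: bounded_iff)
  have bf: "\<exists>B. \<forall>x\<in>\<Omega>. \<bar>f x\<bar> \<le> B"
  proof -
    have "\<forall>b\<in>Basis. \<exists>M. \<forall>x\<in>\<Omega>. \<bar>pderivs [b, b] u x\<bar> \<le> M"
      using holder_onD(4)[OF u order_refl] by (force simp: bounded_iff directions_def)
    then obtain M where M: "\<And>b x. b \<in> Basis \<Longrightarrow> x \<in> \<Omega> \<Longrightarrow> \<bar>pderivs [b, b] u x\<bar> \<le> M b" by metis
    have "\<bar>f x\<bar> \<le> (\<Sum>b\<in>Basis. M b) + Q * K" if x: "x \<in> \<Omega>" for x
    proof -
      have "\<bar>laplacian u x\<bar> \<le> (\<Sum>b\<in>Basis. M b)"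
        unfolding laplacian_def by (rule order_trans[OF sum_abs]) (intro sum_mono M x)
      moreover have "\<bar>q x * u x\<bar> \<le> Q * K"
        unfolding abs_mult using Q[OF x] K[OF x] by (intro mult_mono) auto
      ultimately show ?thesis unfolding f_def by linarith
    qed
    then show ?thesis by blast
  qed
  have sq: "set_integrable lborel \<Omega> (\<lambda>x. (g x)\<^sup>2)" if "continuous_on \<Omega> g" "\<And>x. x \<in> \<Omega> \<Longrightarrow> \<bar>g x\<bar> \<le> B" for g :: "'a \<Rightarrow> real" and B
  proof (rule set_integrable_bounded_continuous[OF op bd])
    show "continuous_on \<Omega> (\<lambda>x. (g x)\<^sup>2)" by (intro continuous_intros that)
    show "bounded ((\<lambda>x. (g x)\<^sup>2) ` \<Omega>)"
      unfolding bounded_iff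
    proof (intro exI[of _ "B\<^sup>2"] ballI, clarify)
      fix x assume "x \<in> \<Omega>"
      then have "\<bar>g x\<bar>\<^sup>2 \<le> B\<^sup>2" using that(2) by (intro power_mono) auto
      then show "norm ((g x)\<^sup>2) \<le> B\<^sup>2" by simp
    qed
  qed
  have iu: "set_integrable lborel \<Omega> (\<lambda>x. (u x)\<^sup>2)" using cu K by (rule sq)
  have "set_integrable lborel \<Omega> (\<lambda>x. (f x)\<^sup>2)" using bf sq[OF cf] by blast
  then have i4: "set_integrable lborel \<Omega> (\<lambda>x. 4 * R^4 * (f x)\<^sup>2)" by (intro set_integrable_mult_right)
  have iu4: "set_integrable lborel \<Omega> (\<lambda>x. (u x)\<^sup>2 / 4)" using iu by (rule set_integrable_divide)
  have "(LINT x:\<Omega>|lborel. (u x)\<^sup>2 / 4 - 4 * R^4 * (f x)\<^sup>2) \<le> (LINT x:\<Omega>|lborel. P x)"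
    using le by (intro set_integral_mono iP set_integral_diff i4 iu4)
  then show ?thesis
    unfolding P0 using i4 iu4 by (simp add: set_integral_diff f_def)
qed

end

end

section \<open>The boundary and its normal\<close>

text \<open>Locally the frontier lies in a graph, hence is negligible by
  \<open>graph_negligible\<close>; compactness reduces it to finitely many such pieces.\<close>

lemma negligible_frontier:
  fixes \<Omega> :: "'a::euclidean_space set"
  assumes op: "open \<Omega>" and bd: "bounded \<Omega>" and hb: "holder_boundary k \<alpha> \<Omega>"
  shows "negligible (frontier \<Omega>)"
proof -
  have "\<exists>r>0. negligible (frontier \<Omega> \<inter> ball x0 r)" if x0: "x0 \<in> frontier \<Omega>" for x0
  proof -
    obtain r e \<gamma> where r: "r > 0" and e: "norm e = 1" and \<gamma>: "holder_on k \<alpha> UNIV \<gamma>"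
      and eq: "\<Omega> \<inter> ball x0 r = {x \<in> ball x0 r. x \<bullet> e > \<gamma> (x - (x \<bullet> e) *\<^sub>R e)}"
      using hb[unfolded holder_boundary_def, rule_format, OF x0] by (elim exE conjE) (rule that)
    define g where "g x = \<gamma> (x - (x \<bullet> e) *\<^sub>R e)" for x
    have c\<gamma>: "continuous_on UNIV \<gamma>" using holder_onD(1)[OF \<gamma>] by simp
    have "continuous_on UNIV (\<lambda>x. x - (x \<bullet> e) *\<^sub>R e)" by (intro continuous_intros)
    from continuous_on_compose2[OF c\<gamma> this] have g: "continuous_on UNIV g"
      unfolding g_def by simp
    have inv: "g (x + t *\<^sub>R e) = g x" for x t
      using e by (simp add: g_def inner_add_left norm_eq_1 algebra_simps)
    have "negligible {x \<in> cball x0 r. x \<bullet> e = g x}" by (rule graph_negligible[OF e g inv])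
    moreover have "frontier \<Omega> \<inter> ball x0 r \<subseteq> {x \<in> cball x0 r. x \<bullet> e = g x}"
      using frontier_in_graph[OF op g eq[folded g_def]] by auto
    ultimately show ?thesis using r negligible_subset by blast
  qed
  then obtain r where r: "\<And>x. x \<in> frontier \<Omega> \<Longrightarrow> r x > 0 \<and> negligible (frontier \<Omega> \<inter> ball x (r x))"
    by metis
  have "compact (frontier \<Omega>)" using bd by (rule compact_frontier_bounded)
  then obtain C where C: "C \<subseteq> frontier \<Omega>" "finite C" "frontier \<Omega> \<subseteq> (\<Union>x\<in>C. ball x (r x))"
  proof (rule compactE_image[where C="frontier \<Omega>" and f="\<lambda>x. ball x (r x)"])
    show "frontier \<Omega> \<subseteq> (\<Union>x\<in>frontier \<Omega>. ball x (r x))" using r by force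
  qed auto
  have "negligible (\<Union>x\<in>C. frontier \<Omega> \<inter> ball x (r x))"
    using C r by (intro negligible_Union) auto
  moreover have "frontier \<Omega> = (\<Union>x\<in>C. frontier \<Omega> \<inter> ball x (r x))" using C(3) by blast
  ultimately show ?thesis by simp
qed

text \<open>\<open>F\<close> is the height of the graph above a point, measured along
  \<open>e\<close>, and \<open>N\<close> is its gradient. As \<open>F\<close> drops at unit speed
  along \<open>e\<close>, the point \<open>x + F x *\<^sub>R e\<close> lies on the zero set, which
  gives an explicit projection to the boundary; a further small step along \<open>e\<close> leads
  into \<open>\<Omega>\<close>.\<close>

lemma graph_defining_function:
  fixes \<Omega> :: "'a::euclidean_space set"
  assumes op: "open \<Omega>" and hb: "holder_boundary 2 \<alpha> \<Omega>" and x0: "x0 \<in> frontier \<Omega>"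
  obtains r e F N where "r > 0" and "norm e = 1"
    and "\<And>x. (F has_derivative (\<lambda>h. h \<bullet> N x)) (at x)" and "continuous_on UNIV N"
    and "\<And>x. N x \<bullet> e = -1" and "\<And>x t. F (x + t *\<^sub>R e) = F x - t" and "\<And>x t. N (x + t *\<^sub>R e) = N x"
    and "\<And>x. x \<in> ball x0 r \<Longrightarrow> x \<in> \<Omega> \<longleftrightarrow> F x < 0"
    and "\<And>x. x \<in> ball x0 r \<Longrightarrow> x \<in> frontier \<Omega> \<Longrightarrow> F x = 0"
proof -
  obtain r e \<gamma> where r: "r > 0" and e: "norm e = 1" and \<gamma>: "holder_on 2 \<alpha> UNIV \<gamma>"
    and eq: "\<Omega> \<inter> ball x0 r = {x \<in> ball x0 r. x \<bullet> e > \<gamma> (x - (x \<bullet> e) *\<^sub>R e)}"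
    using hb[unfolded holder_boundary_def, rule_format, OF x0] by (elim exE conjE) (rule that)
  have ee: "e \<bullet> e = 1" using e by (simp add: norm_eq_1)
  define p where "p x = x - (x \<bullet> e) *\<^sub>R e" for x
  have p_inv: "p (x + t *\<^sub>R e) = p x" for x t by (simp add: p_def inner_add_left ee algebra_simps)
  have cp: "continuous_on UNIV p" unfolding p_def by (intro continuous_intros)
  define F where "F x = \<gamma> (p x) - x \<bullet> e" for x
  define N where "N x = (\<Sum>b\<in>Basis. pderivs [b] \<gamma> (p x) *\<^sub>R p b) - e" for x
  have pe: "p b \<bullet> e = 0" for b by (simp add: p_def inner_diff_left ee)
  have dF: "(F has_derivative (\<lambda>h. h \<bullet> N x)) (at x)" for x
  proof -
    have "(\<gamma> has_derivative (\<lambda>h. \<Sum>b\<in>Basis. (h \<bullet> b) * pderivs [b] \<gamma> (p x))) (at (p x))"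
      using holder_onD(2)[OF \<gamma>, of 0 "[]" "p x"] pderivs_has_derivative[of "[]" \<gamma> "p x"] by simp
    moreover have "(p has_derivative p) (at x)" unfolding p_def by (auto intro!: derivative_eq_intros)
    ultimately have "((\<lambda>x. \<gamma> (p x)) has_derivative (\<lambda>h. \<Sum>b\<in>Basis. (p h \<bullet> b) * pderivs [b] \<gamma> (p x))) (at x)"
      using has_derivative_compose by blast
    then have "(F has_derivative (\<lambda>h. (\<Sum>b\<in>Basis. (p h \<bullet> b) * pderivs [b] \<gamma> (p x)) - h \<bullet> e)) (at x)"
      unfolding F_def by (intro derivative_intros)
    moreover have "(\<Sum>b\<in>Basis. (p h \<bullet> b) * pderivs [b] \<gamma> (p x)) - h \<bullet> e = h \<bullet> N x" for h
    proof -
      have "p h \<bullet> b = h \<bullet> p b" for b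
        by (simp add: p_def inner_diff_left inner_diff_right inner_commute)
      then show ?thesis by (simp add: N_def inner_diff_right inner_sum_right mult.commute)
    qed
    ultimately show ?thesis by simp
  qed
  have "continuous_on UNIV (pderivs [b] \<gamma>)" if "b \<in> Basis" for b
    using holder_on_continuous_pderivs[OF \<gamma>, of 1 "[b]"] that by (simp add: directions_def)
  from continuous_on_compose2[OF this cp] have cN: "continuous_on UNIV N"
    unfolding N_def by (intro continuous_intros) auto
  have Ne: "N x \<bullet> e = -1" for x
    by (simp add: N_def inner_diff_left inner_sum_left pe ee)
  have F1: "F (x + t *\<^sub>R e) = F x - t" for x t by (simp add: F_def p_inv inner_add_left ee)
  have N1: "N (x + t *\<^sub>R e) = N x" for x t by (simp add: N_def p_inv)
  have in\<Omega>: "x \<in> \<Omega> \<longleftrightarrow> F x < 0" if "x \<in> ball x0 r" for x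
    using arg_cong[OF eq, of "\<lambda>A. x \<in> A"] that by (simp add: F_def p_def)
  have "continuous_on UNIV (\<lambda>x. \<gamma> (p x))"
    using continuous_on_compose2[OF _ cp, of UNIV \<gamma>] holder_onD(1)[OF \<gamma>] by simp
  from frontier_in_graph[OF op this eq[folded p_def]]
  have fr: "F x = 0" if "x \<in> ball x0 r" "x \<in> frontier \<Omega>" for x
    using that by (auto simp: F_def)
  show ?thesis by (rule that[OF r e dF cN Ne F1 N1 in\<Omega> fr])
qed

section \<open>Boundary curves, tangential derivatives and the outer normal at one boundary
  point\<close>

context
  fixes \<Omega> :: "'a::euclidean_space set" and x0 e r F N
  assumes op: "open \<Omega>" and x0: "x0 \<in> frontier \<Omega>" and r: "r > 0" and e: "norm e = 1"
    and dF: "\<And>x. (F has_derivative (\<lambda>h. h \<bullet> N x)) (at x)" and cN: "continuous_on UNIV N"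
    and Ne: "\<And>x. N x \<bullet> e = -1" and F1: "\<And>x t. F (x + t *\<^sub>R e) = F x - t" and N1: "\<And>x t. N (x + t *\<^sub>R e) = N x"
    and in\<Omega>: "\<And>x. x \<in> ball x0 r \<Longrightarrow> x \<in> \<Omega> \<longleftrightarrow> F x < 0"
    and fr: "\<And>x. x \<in> ball x0 r \<Longrightarrow> x \<in> frontier \<Omega> \<Longrightarrow> F x = 0"
begin

lemma defining_F0: "F x0 = 0"
  using fr[of x0] x0 r by simp

lemma N_nonzero: "N x \<noteq> 0" using Ne[of x] by auto

lemma zero_in_frontier:
  assumes "x \<in> ball x0 r" "F x = 0"
  shows "x \<in> frontier \<Omega>"
proof -
  have "x \<notin> \<Omega>" using in\<Omega> assms by auto
  have "x \<in> closure \<Omega>"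
  proof (rule Lim_in_closed_set[of "closure \<Omega>" "\<lambda>t. x + t *\<^sub>R e" "at_right (0::real)"])
    have l: "((\<lambda>t. x + t *\<^sub>R e) \<longlongrightarrow> x + 0 *\<^sub>R e) (at_right 0)" by (intro tendsto_intros)
    then show "((\<lambda>t. x + t *\<^sub>R e) \<longlongrightarrow> x) (at_right 0)" by simp
    have "\<forall>\<^sub>F t in at_right 0. x + t *\<^sub>R e \<in> ball x0 r"
      using topological_tendstoD[OF l, of "ball x0 r"] assms by simp
    moreover have "\<forall>\<^sub>F t::real in at_right 0. t > 0" by (rule eventually_at_right_less)
    ultimately show "\<forall>\<^sub>F t in at_right 0. x + t *\<^sub>R e \<in> closure \<Omega>"
    proof eventually_elim
      case (elim t)
      then have "x + t *\<^sub>R e \<in> \<Omega>" using in\<Omega>[OF elim(1)] F1[of x t] assms by simp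
      then show ?case using closure_subset by blast
    qed
  qed auto
  then show ?thesis using \<open>x \<notin> \<Omega>\<close> op by (simp add: frontier_def interior_open)
qed

text \<open>This curve lies in the boundary, and its initial velocity is \<open>T\<close> if \<open>T\<close> is orthogonal to \<open>N x0\<close>.\<close>

definition bdry_curve :: "'a \<Rightarrow> real \<Rightarrow> 'a" where
  "bdry_curve T s = x0 + s *\<^sub>R T + F (x0 + s *\<^sub>R T) *\<^sub>R e"

lemma bdry_curve_0: "bdry_curve T 0 = x0"
  by (simp add: bdry_curve_def defining_F0)

lemma F_bdry_curve: "F (bdry_curve T s) = 0"
  by (simp add: bdry_curve_def F1)

lemma N_bdry_curve: "N (bdry_curve T s) = N (x0 + s *\<^sub>R T)"
  by (simp add: bdry_curve_def N1)

lemma bdry_curve_deriv: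
  "(bdry_curve T has_vector_derivative (T + (T \<bullet> N (bdry_curve T s)) *\<^sub>R e)) (at s)"
proof -
  have "((\<lambda>s. x0 + s *\<^sub>R T) has_derivative (\<lambda>h. h *\<^sub>R T)) (at s)"
    by (auto intro!: derivative_eq_intros)
  from has_derivative_compose[OF this dF]
  have "((\<lambda>s. F (x0 + s *\<^sub>R T)) has_derivative (\<lambda>h. h *\<^sub>R T \<bullet> N (x0 + s *\<^sub>R T))) (at s)" .
  then have "(bdry_curve T has_derivative (\<lambda>h. h *\<^sub>R T + (h *\<^sub>R T \<bullet> N (x0 + s *\<^sub>R T)) *\<^sub>R e)) (at s)"
    unfolding bdry_curve_def by (auto intro!: derivative_eq_intros)
  then show ?thesis by (simp add: has_vector_derivative_def N_bdry_curve algebra_simps)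
qed

lemma bdry_curve_tendsto: "(bdry_curve T \<longlongrightarrow> x0) (at 0)"
proof -
  have "isCont (bdry_curve T) 0"
    using bdry_curve_deriv has_vector_derivative_continuous by blast
  then show ?thesis by (simp add: isCont_def bdry_curve_0)
qed

text \<open>\<open>u\<close> vanishes on the boundary only as a limit, and its gradient is available
  only inside. So the boundary curve with initial velocity \<open>T\<close> is pushed inside by
  \<open>\<tau> *\<^sub>R e\<close>. If \<open>T \<bullet> g\<close> were nonzero, \<open>u\<close>
  would change along it by at least s0 |T . g| / 2 for every small \<open>\<tau>\<close>, whereas
  its end values tend to 0 with \<open>\<tau>\<close>.\<close>

lemma tangential_gradient_zero:
  assumes u: "\<And>x. x \<in> \<Omega> \<Longrightarrow> (u has_derivative (\<lambda>h. h \<bullet> G x)) (at x)"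
    and u0: "\<And>z. z \<in> frontier \<Omega> \<Longrightarrow> (u \<longlongrightarrow> (0::real)) (at z within \<Omega>)"
    and G: "(G \<longlongrightarrow> g) (at x0 within \<Omega>)" and T: "T \<bullet> N x0 = 0"
  shows "T \<bullet> g = 0"
proof (rule ccontr)
  assume nz: "T \<bullet> g \<noteq> 0"
  \<comment> \<open>Derivative of \<open>u\<close> along the pushed curve: the velocity of
    \<open>bdry_curve T\<close> paired with \<open>G\<close>. Since \<open>N\<close> is constant
    along \<open>e\<close>, the velocity formula may be evaluated at the pushed point.\<close>
  define H where "H x = (T + (T \<bullet> N x) *\<^sub>R e) \<bullet> G x" for x
  have "(N \<longlongrightarrow> N x0) (at x0 within \<Omega>)"
    using cN by (meson UNIV_I continuous_on_def subset_UNIV tendsto_within_subset)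
  then have "(H \<longlongrightarrow> (T + (T \<bullet> N x0) *\<^sub>R e) \<bullet> g) (at x0 within \<Omega>)"
    unfolding H_def by (intro tendsto_intros G)
  then have "(H \<longlongrightarrow> T \<bullet> g) (at x0 within \<Omega>)" using T by simp
  then have "\<forall>\<^sub>F x in at x0 within \<Omega>. dist (H x) (T \<bullet> g) < \<bar>T \<bullet> g\<bar> / 2"
    using nz by (intro tendstoD) auto
  then obtain d where d: "d > 0" "\<And>x. x \<in> \<Omega> \<Longrightarrow> x \<noteq> x0 \<Longrightarrow> dist x x0 < d \<Longrightarrow> \<bar>H x - T \<bullet> g\<bar> < \<bar>T \<bullet> g\<bar> / 2"
    unfolding eventually_at by (auto simp: dist_real_def)
  have x0n: "x0 \<notin> \<Omega>" using x0 op by (simp add: frontier_def interior_open)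
  have "\<forall>\<^sub>F s in at 0. dist (bdry_curve T s) x0 < min d r / 2"
    using bdry_curve_tendsto d r by (intro tendstoD) auto
  then obtain s1 where s1: "s1 > 0" "\<And>s. s \<noteq> 0 \<Longrightarrow> \<bar>s\<bar> < s1 \<Longrightarrow> dist (bdry_curve T s) x0 < min d r / 2"
    unfolding eventually_at by (auto simp: dist_real_def)
  define s0 where "s0 = s1 / 2"
  have s0: "s0 > 0" "s0 < s1" using s1(1) by (auto simp: s0_def)
  have near: "dist (bdry_curve T s) x0 < min d r / 2" if "0 \<le> s" "s \<le> s0" for s
    using s1(2)[of s] that s0 d r by (cases "s = 0") (auto simp: bdry_curve_0)
  have pt: "bdry_curve T s + \<tau> *\<^sub>R e \<in> \<Omega>" "dist (bdry_curve T s + \<tau> *\<^sub>R e) x0 < d"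
    if "0 \<le> s" "s \<le> s0" "0 < \<tau>" "\<tau> < min d r / 2" for s \<tau>
  proof -
    have "dist (bdry_curve T s + \<tau> *\<^sub>R e) x0 \<le> dist (bdry_curve T s + \<tau> *\<^sub>R e) (bdry_curve T s) + dist (bdry_curve T s) x0"
      by (rule dist_triangle)
    also have "\<dots> < min d r / 2 + min d r / 2"
      using near[OF that(1,2)] that e by (intro add_strict_mono) (auto simp: dist_norm)
    finally have *: "dist (bdry_curve T s + \<tau> *\<^sub>R e) x0 < min d r" by simp
    then show "dist (bdry_curve T s + \<tau> *\<^sub>R e) x0 < d" by simp
    show "bdry_curve T s + \<tau> *\<^sub>R e \<in> \<Omega>"
      using in\<Omega>[of "bdry_curve T s + \<tau> *\<^sub>R e"] * that F1 F_bdry_curve by (simp add: dist_commute)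
  qed
  define p where "p \<tau> s = u (bdry_curve T s + \<tau> *\<^sub>R e)" for \<tau> s
  have big: "\<bar>p \<tau> s0 - p \<tau> 0\<bar> \<ge> s0 * (\<bar>T \<bullet> g\<bar> / 2)" if \<tau>: "0 < \<tau>" "\<tau> < min d r / 2" for \<tau>
  proof -
    have dp: "(p \<tau> has_real_derivative H (bdry_curve T s + \<tau> *\<^sub>R e)) (at s)" if s: "0 \<le> s" "s \<le> s0" for s
    proof -
      let ?v = "T + (T \<bullet> N (bdry_curve T s)) *\<^sub>R e"
      have "((\<lambda>s. bdry_curve T s + \<tau> *\<^sub>R e) has_derivative (\<lambda>h. h *\<^sub>R ?v)) (at s)"
        using bdry_curve_deriv[unfolded has_vector_derivative_def] by (auto intro!: derivative_eq_intros)
      from has_derivative_compose[OF this u[OF pt(1)[OF s \<tau>]]]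
      have "(p \<tau> has_derivative (\<lambda>h. h *\<^sub>R ?v \<bullet> G (bdry_curve T s + \<tau> *\<^sub>R e))) (at s)"
        by (simp add: p_def[abs_def])
      then show ?thesis
        by (simp add: has_field_derivative_def H_def N1 mult_commute_abs)
    qed
    have "\<exists>\<xi>. \<xi> > 0 \<and> \<xi> < s0 \<and> p \<tau> s0 - p \<tau> 0 = (s0 - 0) * H (bdry_curve T \<xi> + \<tau> *\<^sub>R e)"
      by (rule MVT2[OF s0(1)]) (use dp in auto)
    then obtain \<xi> where \<xi>: "0 < \<xi>" "\<xi> < s0" "p \<tau> s0 - p \<tau> 0 = s0 * H (bdry_curve T \<xi> + \<tau> *\<^sub>R e)" by auto
    have "\<bar>H (bdry_curve T \<xi> + \<tau> *\<^sub>R e) - T \<bullet> g\<bar> < \<bar>T \<bullet> g\<bar> / 2"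
      using pt[of \<xi> \<tau>] \<xi> \<tau> x0n by (intro d(2)) auto
    then have "\<bar>T \<bullet> g\<bar> / 2 \<le> \<bar>H (bdry_curve T \<xi> + \<tau> *\<^sub>R e)\<bar>" by linarith
    then show ?thesis using s0 \<xi>(3) by (simp add: abs_mult)
  qed
  have lim: "((\<lambda>\<tau>. p \<tau> s) \<longlongrightarrow> 0) (at_right 0)" if s: "0 \<le> s" "s \<le> s0" for s
  proof -
    have "bdry_curve T s \<in> frontier \<Omega>"
      using near[OF s] r d F_bdry_curve by (intro zero_in_frontier) (auto simp: dist_commute)
    moreover have "filterlim (\<lambda>\<tau>. bdry_curve T s + \<tau> *\<^sub>R e) (at (bdry_curve T s) within \<Omega>) (at_right 0)"
      unfolding filterlim_at
    proof
      have "((\<lambda>\<tau>. bdry_curve T s + \<tau> *\<^sub>R e) \<longlongrightarrow> bdry_curve T s + 0 *\<^sub>R e) (at_right 0)" by (intro tendsto_intros)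
      then show "((\<lambda>\<tau>. bdry_curve T s + \<tau> *\<^sub>R e) \<longlongrightarrow> bdry_curve T s) (at_right 0)" by simp
      show "\<forall>\<^sub>F \<tau> in at_right 0. bdry_curve T s + \<tau> *\<^sub>R e \<in> \<Omega> \<and> bdry_curve T s + \<tau> *\<^sub>R e \<noteq> bdry_curve T s"
        unfolding eventually_at_right_field using pt(1)[OF s] e d r
        by (intro exI[of _ "min d r / 2"]) auto
    qed
    ultimately show ?thesis unfolding p_def using u0 filterlim_compose by blast
  qed
  have "((\<lambda>\<tau>. \<bar>p \<tau> s0 - p \<tau> 0\<bar>) \<longlongrightarrow> \<bar>0 - 0\<bar>) (at_right 0)"
    using s0 by (intro tendsto_intros lim) auto
  moreover have "\<forall>\<^sub>F \<tau> in at_right 0. \<bar>p \<tau> s0 - p \<tau> 0\<bar> \<ge> s0 * (\<bar>T \<bullet> g\<bar> / 2)"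
    unfolding eventually_at_right_field using big d r by (intro exI[of _ "min d r / 2"]) auto
  ultimately have "s0 * (\<bar>T \<bullet> g\<bar> / 2) \<le> \<bar>0 - 0\<bar>"
    using tendsto_lowerbound trivial_limit_at_right_real by blast
  then show False using s0 nz by (simp add: mult_le_0_iff)
qed

text \<open>\<open>outer_normal\<close> is a definite description, so uniqueness is part of the
  claim. The unit vector along \<open>N x0\<close> is tangent-orthogonal because \<open>F\<close>
  vanishes on the frontier, and its side is read off from the growth of \<open>F\<close>.
  Conversely, testing a candidate along boundary curves makes it orthogonal to every
  \<open>T\<close> orthogonal to \<open>N x0\<close>, and the side condition selects the
  sign.\<close>

lemma outer_normal_eq: "outer_normal \<Omega> x0 = N x0 /\<^sub>R norm (N x0)"
proof -
  let ?v = "N x0 /\<^sub>R norm (N x0)"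
  have Npos: "norm (N x0) > 0" using N_nonzero by simp
  have line: "((\<lambda>t. F (x0 + t *\<^sub>R ?v)) has_real_derivative norm (N x0)) (at 0)"
  proof -
    have "((\<lambda>t. x0 + t *\<^sub>R ?v) has_derivative (\<lambda>h. h *\<^sub>R ?v)) (at 0)"
      by (auto intro!: derivative_eq_intros)
    from has_derivative_compose[OF this dF]
    have "((\<lambda>t. F (x0 + t *\<^sub>R ?v)) has_derivative (\<lambda>h. h *\<^sub>R ?v \<bullet> N (x0 + 0 *\<^sub>R ?v))) (at 0)" .
    moreover have "(\<lambda>h. h *\<^sub>R ?v \<bullet> N (x0 + 0 *\<^sub>R ?v)) = (*) (norm (N x0))"
      using Npos by (intro ext) (simp add: power2_norm_eq_inner[symmetric] power2_eq_square field_simps)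
    ultimately show ?thesis unfolding has_field_derivative_def by (simp only:)
  qed
  have ballv: "\<forall>\<^sub>F t in at_right 0. x0 - t *\<^sub>R ?v \<in> ball x0 r \<and> x0 + t *\<^sub>R ?v \<in> ball x0 r"
    unfolding eventually_at_right_field using r N_nonzero[of x0]
    by (intro exI[of _ r]) (auto simp: dist_norm mult.assoc)
  have side: "\<forall>\<^sub>F t in at_right 0. x0 - t *\<^sub>R ?v \<in> \<Omega> \<and> x0 + t *\<^sub>R ?v \<notin> closure \<Omega>"
  proof -
    obtain d1 where d1: "d1 > 0" "\<And>h. 0 < h \<Longrightarrow> h < d1 \<Longrightarrow> F (x0 + 0 *\<^sub>R ?v) < F (x0 + (0 + h) *\<^sub>R ?v)"
      using DERIV_pos_inc_right[OF line Npos] by blast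
    obtain d2 where d2: "d2 > 0" "\<And>h. 0 < h \<Longrightarrow> h < d2 \<Longrightarrow> F (x0 + (0 - h) *\<^sub>R ?v) < F (x0 + 0 *\<^sub>R ?v)"
      using DERIV_pos_inc_left[OF line Npos] by blast
    have "\<forall>\<^sub>F t in at_right 0. 0 < t \<and> t < min d1 d2"
      unfolding eventually_at_right_field using d1 d2 by (intro exI[of _ "min d1 d2"]) auto
    with ballv show ?thesis
    proof eventually_elim
      case (elim t)
      have "F (x0 - t *\<^sub>R ?v) < 0" using d2(2)[of t] elim defining_F0 by simp
      moreover have "F (x0 + t *\<^sub>R ?v) > 0" using d1(2)[of t] elim defining_F0 by simp
      ultimately show ?case using in\<Omega>[of "x0 - t *\<^sub>R ?v"] in\<Omega>[of "x0 + t *\<^sub>R ?v"] fr[of "x0 + t *\<^sub>R ?v"] elim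
        by (auto simp: closure_Un_frontier)
    qed
  qed
  \<comment> \<open>On the frontier \<open>F y\<close> and \<open>F x0\<close> are both 0, so the
    remainder of the first-order expansion of \<open>F\<close> is, up to the factor
    \<open>- norm (N x0)\<close>, the quotient in question.\<close>
  have tang: "((\<lambda>y. ((y - x0) \<bullet> ?v) / norm (y - x0)) \<longlongrightarrow> 0) (at x0 within frontier \<Omega>)"
  proof -
    have "((\<lambda>y. (F y - F x0 - (y - x0) \<bullet> N x0) /\<^sub>R norm (y - x0)) \<longlongrightarrow> 0) (at x0 within frontier \<Omega>)"
      using has_derivative_at_withinI[OF dF[of x0], of "frontier \<Omega>"] unfolding has_derivative_within
      by (simp add: diff_diff_eq divide_inverse mult.commute)
    then have "((\<lambda>y. (F y - F x0 - (y - x0) \<bullet> N x0) /\<^sub>R norm (y - x0) * (- 1 / norm (N x0))) \<longlongrightarrow> 0 * (- 1 / norm (N x0))) (at x0 within frontier \<Omega>)"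
      by (intro tendsto_intros)
    then have L: "((\<lambda>y. (F y - F x0 - (y - x0) \<bullet> N x0) /\<^sub>R norm (y - x0) * (- 1 / norm (N x0))) \<longlongrightarrow> 0) (at x0 within frontier \<Omega>)"
      by simp
    have "\<forall>\<^sub>F y in at x0 within frontier \<Omega>. y \<in> ball x0 r \<and> y \<in> frontier \<Omega>"
      unfolding eventually_at using r by (intro exI[of _ r]) (auto simp: dist_commute)
    then have "\<forall>\<^sub>F y in at x0 within frontier \<Omega>. (F y - F x0 - (y - x0) \<bullet> N x0) /\<^sub>R norm (y - x0) * (- 1 / norm (N x0))
       = ((y - x0) \<bullet> ?v) / norm (y - x0)"
    proof eventually_elim
      case (elim y)
      then have "F y = 0" using fr by blast
      then show ?case using Npos by (simp add: defining_F0 field_simps)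
    qed
    with L show ?thesis by (rule Lim_transform_eventually)
  qed
  have uniq: "v' = ?v" if v': "norm v' = 1" "((\<lambda>y. ((y - x0) \<bullet> v') / norm (y - x0)) \<longlongrightarrow> 0) (at x0 within frontier \<Omega>)"
     "\<forall>\<^sub>F t in at_right 0. x0 - t *\<^sub>R v' \<in> \<Omega> \<and> x0 + t *\<^sub>R v' \<notin> closure \<Omega>" for v'
  proof -
    \<comment> \<open>The tangency limit is evaluated along \<open>bdry_curve T\<close>, which stays
      in the frontier and avoids \<open>x0\<close> for nonzero parameters.\<close>
    have orth: "T \<bullet> v' = 0" if T: "T \<bullet> N x0 = 0" for T
    proof (cases "T = 0")
      case False
      have ne: "bdry_curve T s \<noteq> x0" if "s \<noteq> 0" for s
      proof
        assume "bdry_curve T s = x0"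
        then have *: "s *\<^sub>R T + F (x0 + s *\<^sub>R T) *\<^sub>R e = 0" by (simp add: bdry_curve_def add.assoc)
        then have "(s *\<^sub>R T + F (x0 + s *\<^sub>R T) *\<^sub>R e) \<bullet> N x0 = 0" by simp
        moreover have "e \<bullet> N x0 = -1" using Ne[of x0] by (simp add: inner_commute)
        ultimately have "F (x0 + s *\<^sub>R T) = 0" using T by (simp add: inner_add_left)
        then show False using * that False by simp
      qed
      have "\<forall>\<^sub>F s in at 0. bdry_curve T s \<in> ball x0 r"
        using topological_tendstoD[OF bdry_curve_tendsto, of "ball x0 r"] r by simp
      then have "\<forall>\<^sub>F s in at 0. bdry_curve T s \<in> frontier \<Omega> \<and> bdry_curve T s \<noteq> x0"
        using eventually_neq_at_within[of "0::real" 0 UNIV]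
        by eventually_elim (use zero_in_frontier F_bdry_curve ne in auto)
      then have "filterlim (bdry_curve T) (at x0 within frontier \<Omega>) (at 0)"
        unfolding filterlim_at using bdry_curve_tendsto by simp
      then have A: "((\<lambda>s. ((bdry_curve T s - x0) \<bullet> v') / norm (bdry_curve T s - x0)) \<longlongrightarrow> 0) (at 0)"
        using v'(2) filterlim_compose by blast
      have B: "((\<lambda>s. (bdry_curve T s - x0) /\<^sub>R s) \<longlongrightarrow> T) (at 0)"
      proof -
        have "(bdry_curve T has_vector_derivative T) (at 0)"
          using bdry_curve_deriv[of T 0] T by (simp add: bdry_curve_0)
        then have "((\<lambda>h. norm (bdry_curve T h - x0 - h *\<^sub>R T) / norm h) \<longlongrightarrow> 0) (at 0)"
          by (simp add: has_vector_derivative_def has_derivative_at bdry_curve_0)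
        moreover have "\<forall>\<^sub>F h in at 0. norm (bdry_curve T h - x0 - h *\<^sub>R T) / norm h
            = norm ((bdry_curve T h - x0) /\<^sub>R h - T)"
          using eventually_neq_at_within[of "0::real" 0 UNIV]
        proof eventually_elim
          case (elim h)
          then have "(bdry_curve T h - x0) /\<^sub>R h - T = (bdry_curve T h - x0 - h *\<^sub>R T) /\<^sub>R h"
            by (simp add: scaleR_diff_right)
          then show ?case by (simp add: divide_inverse mult.commute)
        qed
        ultimately have "((\<lambda>h. norm ((bdry_curve T h - x0) /\<^sub>R h - T)) \<longlongrightarrow> 0) (at 0)"
          by (rule Lim_transform_eventually)
        then show ?thesis by (simp only: tendsto_norm_zero_iff LIM_zero_iff)
      qed
      have "((\<lambda>s. ((bdry_curve T s - x0) \<bullet> v') / norm (bdry_curve T s - x0) * norm ((bdry_curve T s - x0) /\<^sub>R s)) \<longlongrightarrow> 0 * norm T) (at 0)"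
        by (intro tendsto_intros A B)
      \<comment> \<open>Division by \<open>s\<close> changes sign at 0, division by the norm does
        not; absolute values make the two comparable on both sides.\<close>
      then have "((\<lambda>s. \<bar>((bdry_curve T s - x0) \<bullet> v') / norm (bdry_curve T s - x0) * norm ((bdry_curve T s - x0) /\<^sub>R s)\<bar>) \<longlongrightarrow> 0) (at 0)"
        using tendsto_rabs_zero by fastforce
      moreover have "\<forall>\<^sub>F s in at 0. \<bar>((bdry_curve T s - x0) \<bullet> v') / norm (bdry_curve T s - x0) * norm ((bdry_curve T s - x0) /\<^sub>R s)\<bar>
         = \<bar>((bdry_curve T s - x0) /\<^sub>R s) \<bullet> v'\<bar>"
        using eventually_neq_at_within[of "0::real" 0 UNIV]
      proof eventually_elim
        case (elim s)
        have "\<bar>(w \<bullet> v') / norm w * norm (w /\<^sub>R s)\<bar> = \<bar>(w /\<^sub>R s) \<bullet> v'\<bar>" if "w \<noteq> 0" for w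
          using that by (simp add: abs_mult)
        then show ?case using ne elim by simp
      qed
      ultimately have "((\<lambda>s. \<bar>((bdry_curve T s - x0) /\<^sub>R s) \<bullet> v'\<bar>) \<longlongrightarrow> 0) (at 0)"
        by (rule Lim_transform_eventually)
      moreover have "((\<lambda>s. \<bar>((bdry_curve T s - x0) /\<^sub>R s) \<bullet> v'\<bar>) \<longlongrightarrow> \<bar>T \<bullet> v'\<bar>) (at 0)"
        by (intro tendsto_intros B)
      ultimately show ?thesis using LIM_unique by fastforce
    qed simp
    \<comment> \<open>\<open>T\<close> is the part of \<open>v'\<close> orthogonal to
      \<open>N x0\<close>. By \<open>orth\<close> it is orthogonal to \<open>v'\<close> as well,
      hence to itself.\<close>
    define c where "c = (v' \<bullet> N x0) / (N x0 \<bullet> N x0)"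
    define T where "T = v' - c *\<^sub>R N x0"
    have TN: "T \<bullet> N x0 = 0" using N_nonzero[of x0] by (simp add: T_def c_def inner_diff_left)
    have "T \<bullet> T = T \<bullet> v' - c * (T \<bullet> N x0)" by (simp add: T_def inner_diff_right)
    then have "T = 0" using TN orth[OF TN] by simp
    then have v'c: "v' = c *\<^sub>R N x0" by (simp add: T_def)
    then have c1: "\<bar>c\<bar> * norm (N x0) = 1" using v'(1) by simp
    have "c \<ge> 0"
    proof (rule ccontr)
      assume "\<not> c \<ge> 0"
      then have "c = - 1 / norm (N x0)" using c1 Npos by (simp add: field_simps)
      then have "v' = - ?v" using v'c by (simp add: divide_inverse)
      with v'(3) have "\<forall>\<^sub>F t in at_right 0. x0 + t *\<^sub>R ?v \<in> \<Omega>"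
        by (auto elim: eventually_mono)
      with side have "\<forall>\<^sub>F t::real in at_right 0. False"
        by eventually_elim (use closure_subset[of \<Omega>] in auto)
      then show False by simp
    qed
    then have "c = 1 / norm (N x0)" using c1 Npos by (simp add: field_simps)
    then show ?thesis using v'c by (simp add: divide_inverse)
  qed
  show ?thesis unfolding outer_normal_def
  proof (rule the_equality)
    show "norm ?v = 1 \<and> ((\<lambda>y. (y - x0) \<bullet> ?v / norm (y - x0)) \<longlongrightarrow> 0) (at x0 within frontier \<Omega>) \<and>
      (\<forall>\<^sub>F t in at_right 0. x0 - t *\<^sub>R ?v \<in> \<Omega> \<and> x0 + t *\<^sub>R ?v \<notin> closure \<Omega>)"
      using tang side Npos by simp
  qed (use uniq in blast)
qed

text \<open>Without normal component \<open>g\<close> is itself tangential, so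
  \<open>tangential_gradient_zero\<close> can be used with \<open>T = g\<close>.\<close>

lemma boundary_gradient_zero_aux:
  assumes u: "\<And>x. x \<in> \<Omega> \<Longrightarrow> (u has_derivative (\<lambda>h. h \<bullet> G x)) (at x)"
    and u0: "\<And>z. z \<in> frontier \<Omega> \<Longrightarrow> (u \<longlongrightarrow> (0::real)) (at z within \<Omega>)"
    and G: "(G \<longlongrightarrow> g) (at x0 within \<Omega>)" and "g \<bullet> outer_normal \<Omega> x0 = 0"
  shows "g = 0"
proof -
  have gN: "g \<bullet> N x0 = 0" using assms(4) N_nonzero[of x0] by (simp add: outer_normal_eq)
  have "g \<bullet> g = 0" by (rule tangential_gradient_zero[OF u u0 G gN])
  then show ?thesis by simp
qed

end

lemma boundary_gradient_zero:
  fixes \<Omega> :: "'a::euclidean_space set"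
  assumes op: "open \<Omega>" and hb: "holder_boundary 2 \<alpha> \<Omega>" and x0: "x0 \<in> frontier \<Omega>"
    and u: "\<And>x. x \<in> \<Omega> \<Longrightarrow> (u has_derivative (\<lambda>h. h \<bullet> G x)) (at x)"
    and u0: "\<And>z. z \<in> frontier \<Omega> \<Longrightarrow> (u \<longlongrightarrow> (0::real)) (at z within \<Omega>)"
    and G: "(G \<longlongrightarrow> g) (at x0 within \<Omega>)" and g: "g \<bullet> outer_normal \<Omega> x0 = 0"
  shows "g = 0"
proof (rule graph_defining_function[OF op hb x0], goal_cases)
  case (1 r e F N)
  show ?case by (rule boundary_gradient_zero_aux[OF op x0 1 u u0 G g])
qed

section \<open>Trigonometric polynomials on a cube\<close>

text \<open>By \<open>lborel_eq\<close> Lebesgue measure is the image of a product of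
  one-dimensional measures over \<open>Basis\<close>, so integrals of products of functions of one
  coordinate factor.\<close>

lemma integral_lborel_prod:
  fixes f :: "'a::euclidean_space \<Rightarrow> real \<Rightarrow> complex"
  assumes i: "\<And>b. b \<in> Basis \<Longrightarrow> integrable lborel (f b)"
  shows "(LINT x|lborel. (\<Prod>b\<in>Basis. f b (x \<bullet> b))) = (\<Prod>b\<in>Basis. (LINT t|lborel. f b t))"
proof -
  interpret product_sigma_finite "\<lambda>b::'a. lborel :: real measure" by standard
  have [measurable]: "f b \<in> borel_measurable borel" if "b \<in> Basis" for b
    using borel_measurable_integrable[OF i[OF that]] by simp
  have "(LINT x|lborel. (\<Prod>b\<in>Basis. f b (x \<bullet> b))) =
      (LINT x|Pi\<^sub>M Basis (\<lambda>b. lborel). (\<Prod>b\<in>Basis. f b ((\<Sum>c\<in>Basis. x c *\<^sub>R c) \<bullet> b)))"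
    by (subst lborel_eq, subst integral_distr) (auto intro!: borel_measurable_prod)
  also have "\<dots> = (LINT x|Pi\<^sub>M Basis (\<lambda>b. lborel). (\<Prod>b\<in>Basis. f b (x b)))"
    by (intro Bochner_Integration.integral_cong prod.cong) (auto simp: inner_sum_left inner_Basis if_distrib cong: if_cong)
  also have "\<dots> = (\<Prod>b\<in>Basis. (LINT t|lborel. f b t))"
    by (rule product_integral_prod) (use i in auto)
  finally show ?thesis .
qed

lemma Basis_vec_real: "(Basis :: (real^'n) set) = range (\<lambda>i. axis i 1)"
  by (auto simp: Basis_vec_def)

lemma inj_axis_one: "inj (\<lambda>i::'n::finite. axis i (1::real))"
  by (auto simp: inj_on_def axis_eq_axis)

lemma sum_Basis_vec: "(\<Sum>b\<in>(Basis :: (real^'n) set). f b) = (\<Sum>i\<in>UNIV. f (axis i 1))"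
  unfolding Basis_vec_real by (subst sum.reindex) (auto simp: inj_axis_one)

lemma prod_Basis_vec: "(\<Prod>b\<in>(Basis :: (real^'n) set). f b) = (\<Prod>i\<in>UNIV. f (axis i 1))"
  unfolding Basis_vec_real by (subst prod.reindex) (auto simp: inj_axis_one)

text \<open>At these frequencies the interval of length 2 R is a whole number of periods, so the
  antiderivative takes equal values at its ends.\<close>

lemma integral_cis_interval:
  fixes m :: int
  assumes R: "R > 0"
  shows "(LINT t|lborel. indicator {-R..R} t *\<^sub>R cis (pi / R * m * t)) = (if m = 0 then of_real (2 * R) else 0)"
proof (cases "m = 0")
  case True
  then show ?thesis using R by (simp add: measure_lborel_Icc scaleR_conv_of_real)
next
  case False
  define a where "a = pi / R * m"
  have a: "a \<noteq> 0" using False R by (simp add: a_def)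
  have "(LINT t|lborel. indicator {-R..R} t *\<^sub>R cis (a * t)) = cis (a * R) / (\<i> * a) - cis (a * (-R)) / (\<i> * a)"
  proof (rule integral_FTC_Icc)
    show "((\<lambda>t. cis (a * t) / (\<i> * a)) has_vector_derivative cis (a * t)) (at t within {-R..R})" for t
    proof -
      have "((\<lambda>z. exp (\<i> * a * z)) has_field_derivative exp (\<i> * a * of_real t) * (\<i> * a)) (at (of_real t))"
        by (auto intro!: derivative_eq_intros)
      from DERIV_cdivide[OF this, of "\<i> * a"]
      have "((\<lambda>z. exp (\<i> * a * z) / (\<i> * a)) has_field_derivative exp (\<i> * a * of_real t)) (at (of_real t))"
        using a by simp
      from has_vector_derivative_real_field[OF this] show ?thesis by (simp add: cis_conv_exp mult.assoc)
    qed
    show "continuous_on {-R..R} (\<lambda>t. cis (a * t))" by (intro continuous_intros)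
  qed (use R in auto)
  also have "cis (a * (-R)) = cis (a * R)"
  proof -
    have "a * R = pi * m" using R by (simp add: a_def)
    moreover have "sin (pi * m) = 0" unfolding sin_zero_iff_int2 by (intro exI[of _ m]) simp
    ultimately show ?thesis by (auto simp: complex_eq_iff)
  qed
  finally show ?thesis using False by (simp add: a_def)
qed

section \<open>Fourier analysis on a cube with a shifted lattice of frequencies\<close>

definition cube :: "real \<Rightarrow> (real^'n) set" where
  "cube R = {x. \<forall>i. \<bar>x $ i\<bar> \<le> R}"

lemma cube_cbox: "cube R = cbox (\<chi> i. - R) (\<chi> i. R)"
  by (auto simp: cube_def mem_box_cart abs_le_iff minus_le_iff)

lemma compact_cube [simp]: "compact (cube R)"
  by (simp add: cube_cbox compact_cbox)

lemma indicator_cube: "indicator (cube R) x = (\<Prod>i\<in>UNIV. indicator {-R..R} (x $ i) :: real)"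
proof (cases "x \<in> cube R")
  case True
  have "indicator {-R..R} (x $ i) = (1::real)" for i
  proof -
    have "\<bar>x $ i\<bar> \<le> R" using True by (simp add: cube_def)
    then show ?thesis by (simp add: abs_le_iff)
  qed
  then show ?thesis using True by simp
next
  case False
  then obtain i where "\<bar>x $ i\<bar> > R" unfolding cube_def mem_Collect_eq not_all not_le by blast
  then have "indicator {-R..R} (x $ i) = (0::real)" by (auto simp: indicator_def)
  then have "(\<Prod>i\<in>UNIV. indicator {-R..R} (x $ i)) = (0::real)" by (intro prod_zero) auto
  then show ?thesis using False by simp
qed

definition int_vec :: "int^'n \<Rightarrow> real^'n" where
  "int_vec k = (\<chi> i. real_of_int (k $ i))"

lemma int_vec_simps [simp]: "int_vec 0 = 0" "int_vec (k + l) = int_vec k + int_vec l" "int_vec (k - l) = int_vec k - int_vec l"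
  "int_vec k $ i = of_int (k $ i)"
  by (auto simp: int_vec_def vec_eq_iff)

lemma cis_sum: "finite A \<Longrightarrow> cis (\<Sum>i\<in>A. f i) = (\<Prod>i\<in>A. cis (f i))"
  by (induction A rule: finite_induct) (auto simp: cis_mult[symmetric])

lemma integral_cis_cube:
  fixes k :: "int^'n"
  assumes R: "R > 0"
  shows "(LINT x:cube R|lborel. cis ((pi / R) *\<^sub>R int_vec k \<bullet> x)) = (if k = 0 then of_real ((2 * R) ^ CARD('n)) else 0)"
proof -
  \<comment> \<open>\<open>integral_lborel_prod\<close> indexes the factors by basis vectors;
    \<open>THE\<close> recovers the coordinate index.\<close>
  define f where "f b t = indicator {-R..R} t *\<^sub>R cis (pi / R * real_of_int (k $ (THE i. b = axis i 1)) * t)"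
    for b :: "real^'n" and t
  have the: "(THE j. axis i (1::real) = axis j 1) = i" for i :: 'n
    by (rule the_equality) (auto simp: axis_eq_axis)
  have "indicator (cube R) x *\<^sub>R cis ((pi / R) *\<^sub>R int_vec k \<bullet> x) = (\<Prod>b\<in>Basis. f b (x \<bullet> b))" for x :: "real^'n"
  proof -
    have "(pi / R) *\<^sub>R int_vec k \<bullet> x = (\<Sum>i\<in>UNIV. pi / R * real_of_int (k $ i) * x $ i)"
      by (simp add: inner_vec_def sum_distrib_left mult.assoc)
    moreover have "(\<Prod>b\<in>Basis. f b (x \<bullet> b)) = (\<Prod>i\<in>UNIV. indicator {-R..R} (x $ i) *\<^sub>R cis (pi / R * real_of_int (k $ i) * x $ i))"
      unfolding prod_Basis_vec by (simp add: f_def the inner_axis)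
    ultimately show ?thesis
      by (simp add: indicator_cube scaleR_conv_of_real cis_sum prod.distrib del: inner_scaleR_left)
  qed
  then have "(LINT x:cube R|lborel. cis ((pi / R) *\<^sub>R int_vec k \<bullet> x)) = (LINT x|lborel. (\<Prod>b\<in>Basis. f b (x \<bullet> b)))"
    by (simp add: set_lebesgue_integral_def del: inner_scaleR_left)
  also have "\<dots> = (\<Prod>b\<in>Basis. (LINT t|lborel. f b t))"
    unfolding f_def by (intro integral_lborel_prod borel_integrable_compact) (use R in \<open>auto intro!: continuous_intros\<close>)
  also have "\<dots> = (\<Prod>i\<in>UNIV. (LINT t|lborel. indicator {-R..R} t *\<^sub>R cis (pi / R * real_of_int (k $ i) * t)))"
    unfolding prod_Basis_vec by (simp add: f_def[abs_def] the)
  also have "\<dots> = (\<Prod>i\<in>UNIV. if k $ i = 0 then of_real (2 * R) else 0)"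
    unfolding integral_cis_interval[OF R] ..
  also have "\<dots> = (if k = 0 then of_real ((2 * R) ^ CARD('n)) else 0)"
  proof (cases "k = 0")
    case False
    then obtain i where "k $ i \<noteq> 0" by (auto simp: vec_eq_iff)
    then have "(\<Prod>i\<in>UNIV. if k $ i = 0 then of_real (2 * R) else 0) = (0::complex)" by (intro prod_zero) auto
    then show ?thesis using False by simp
  qed simp
  finally show ?thesis .
qed

text \<open>The shift \<open>\<theta>\<close> leaves orthogonality on the cube intact when
  \<open>\<omega> = pi / R\<close>, and will keep the symbol of the conjugated Laplacian away from
  0.\<close>

definition freq :: "real \<Rightarrow> real^'n \<Rightarrow> int^'n \<Rightarrow> real^'n" where
  "freq \<omega> \<theta> k = \<omega> *\<^sub>R (int_vec k + \<theta>)"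

text \<open>Without finite support of \<open>c\<close> the sum is \<open>0\<close>.\<close>

definition trigpoly :: "real \<Rightarrow> real^'n \<Rightarrow> (int^'n \<Rightarrow> complex) \<Rightarrow> real^'n \<Rightarrow> complex" where
  "trigpoly \<omega> \<theta> c x = (\<Sum>k | c k \<noteq> 0. c k * cis (freq \<omega> \<theta> k \<bullet> x))"

lemma trigpoly_eq:
  assumes "finite A" "{k. c k \<noteq> 0} \<subseteq> A"
  shows "trigpoly \<omega> \<theta> c x = (\<Sum>k\<in>A. c k * cis (freq \<omega> \<theta> k \<bullet> x))"
  unfolding trigpoly_def by (rule sum.mono_neutral_left) (use assms in auto)

lemma finite_support_lincomb:
  assumes "finite {k. c k \<noteq> (0::complex)}" "finite {k. d k \<noteq> 0}"
  shows "finite {k. c k + a * d k \<noteq> 0}"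
  by (rule finite_subset[of _ "{k. c k \<noteq> 0} \<union> {k. d k \<noteq> 0}"]) (use assms in auto)

lemma trigpoly_lincomb:
  assumes "finite {k. c k \<noteq> 0}" "finite {k. d k \<noteq> 0}"
  shows "trigpoly \<omega> \<theta> (\<lambda>k. c k + a * d k) x = trigpoly \<omega> \<theta> c x + a * trigpoly \<omega> \<theta> d x"
proof -
  let ?A = "{k. c k \<noteq> 0} \<union> {k. d k \<noteq> 0}"
  have A: "finite ?A" using assms by simp
  have "{k. c k \<noteq> 0} \<subseteq> ?A" "{k. d k \<noteq> 0} \<subseteq> ?A" "{k. c k + a * d k \<noteq> 0} \<subseteq> ?A" by auto
  note this[THEN trigpoly_eq[OF A], of \<omega> \<theta> x]
  then show ?thesis by (simp only:) (simp add: sum.distrib sum_distrib_left algebra_simps)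
qed

lemma continuous_on_trigpoly [continuous_intros]: "continuous_on S (trigpoly \<omega> \<theta> c)"
  unfolding trigpoly_def by (intro continuous_intros)

lemma set_integrable_cube:
  fixes f :: "real^'n \<Rightarrow> 'b::{banach,second_countable_topology}"
  shows "continuous_on (cube R) f \<Longrightarrow> set_integrable lborel (cube R) f"
  unfolding set_integrable_def by (intro borel_integrable_compact compact_cube)

definition cube_norm2 :: "real \<Rightarrow> (real^'n \<Rightarrow> complex) \<Rightarrow> real" where
  "cube_norm2 R f = (LINT x:cube R|lborel. (cmod (f x))\<^sup>2)"

lemma parseval:
  fixes \<theta> :: "real^'n"
  assumes R: "R > 0" and fin: "finite {k. c k \<noteq> 0}"
  shows "cube_norm2 R (trigpoly (pi / R) \<theta> c) = (2 * R) ^ CARD('n) * (\<Sum>k | c k \<noteq> 0. (cmod (c k))\<^sup>2)"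
proof -
  let ?A = "{k. c k \<noteq> 0}" and ?\<omega> = "pi / R"
  have e: "complex_of_real ((cmod (trigpoly ?\<omega> \<theta> c x))\<^sup>2)
      = (\<Sum>k\<in>?A. \<Sum>l\<in>?A. (c k * cnj (c l)) * cis (?\<omega> *\<^sub>R int_vec (k - l) \<bullet> x))" for x
  proof -
    have "complex_of_real ((cmod (trigpoly ?\<omega> \<theta> c x))\<^sup>2) = trigpoly ?\<omega> \<theta> c x * cnj (trigpoly ?\<omega> \<theta> c x)"
      by (rule complex_norm_square)
    also have "\<dots> = (\<Sum>k\<in>?A. \<Sum>l\<in>?A. (c k * cis (freq ?\<omega> \<theta> k \<bullet> x)) * cnj (c l * cis (freq ?\<omega> \<theta> l \<bullet> x)))"
      unfolding trigpoly_def cnj_sum sum_product ..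
    also have "\<dots> = (\<Sum>k\<in>?A. \<Sum>l\<in>?A. (c k * cnj (c l)) * cis (?\<omega> *\<^sub>R int_vec (k - l) \<bullet> x))"
    proof (intro sum.cong refl)
      fix k l
      \<comment> \<open>The shift cancels between \<open>k\<close> and \<open>l\<close>, leaving an
        unshifted lattice vector, to which \<open>integral_cis_cube\<close> applies.\<close>
      have "cis (freq ?\<omega> \<theta> k \<bullet> x) * cnj (cis (freq ?\<omega> \<theta> l \<bullet> x)) = cis (?\<omega> *\<^sub>R int_vec (k - l) \<bullet> x)"
        by (simp add: cis_cnj cis_mult freq_def inner_add_left inner_diff_left algebra_simps)
      then show "(c k * cis (freq ?\<omega> \<theta> k \<bullet> x)) * cnj (c l * cis (freq ?\<omega> \<theta> l \<bullet> x)) = (c k * cnj (c l)) * cis (?\<omega> *\<^sub>R int_vec (k - l) \<bullet> x)"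
        by (simp add: mult_ac)
    qed
    finally show ?thesis .
  qed
  have i: "integrable lborel (\<lambda>x. indicator (cube R) x *\<^sub>R ((c k * cnj (c l)) * cis (?\<omega> *\<^sub>R int_vec (k - l) \<bullet> x)))" for k l
    by (intro borel_integrable_compact compact_cube continuous_intros)
  have "complex_of_real (cube_norm2 R (trigpoly ?\<omega> \<theta> c))
     = (LINT x|lborel. indicator (cube R) x *\<^sub>R complex_of_real ((cmod (trigpoly ?\<omega> \<theta> c x))\<^sup>2))"
    unfolding cube_norm2_def set_lebesgue_integral_def integral_complex_of_real[symmetric]
    by (simp add: scaleR_conv_of_real)
  also have "\<dots> = (LINT x|lborel. (\<Sum>k\<in>?A. \<Sum>l\<in>?A. indicator (cube R) x *\<^sub>R ((c k * cnj (c l)) * cis (?\<omega> *\<^sub>R int_vec (k - l) \<bullet> x))))"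
    unfolding e scaleR_sum_right ..
  also have "\<dots> = (\<Sum>k\<in>?A. \<Sum>l\<in>?A. (LINT x|lborel. indicator (cube R) x *\<^sub>R ((c k * cnj (c l)) * cis (?\<omega> *\<^sub>R int_vec (k - l) \<bullet> x))))"
    using i by (simp add: Bochner_Integration.integral_sum Bochner_Integration.integrable_sum)
  also have "\<dots> = (\<Sum>k\<in>?A. \<Sum>l\<in>?A. (c k * cnj (c l)) * (if k - l = 0 then of_real ((2 * R) ^ CARD('n)) else 0))"
  proof (intro sum.cong refl)
    fix k l
    have "(LINT x|lborel. indicator (cube R) x *\<^sub>R ((c k * cnj (c l)) * cis (?\<omega> *\<^sub>R int_vec (k - l) \<bullet> x)))
       = (c k * cnj (c l)) * (LINT x:cube R|lborel. cis (?\<omega> *\<^sub>R int_vec (k - l) \<bullet> x))"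
      unfolding set_lebesgue_integral_def by (subst integral_mult_right_zero[symmetric]) (simp add: mult.left_commute)
    then show "(LINT x|lborel. indicator (cube R) x *\<^sub>R ((c k * cnj (c l)) * cis (?\<omega> *\<^sub>R int_vec (k - l) \<bullet> x)))
       = (c k * cnj (c l)) * (if k - l = 0 then of_real ((2 * R) ^ CARD('n)) else 0)"
      unfolding integral_cis_cube[OF R] .
  qed
  also have "\<dots> = (\<Sum>k\<in>?A. complex_of_real ((cmod (c k))\<^sup>2 * (2 * R) ^ CARD('n)))"
  proof (intro sum.cong refl)
    fix k assume k: "k \<in> ?A"
    have "(\<Sum>l\<in>?A. (c k * cnj (c l)) * (if k - l = 0 then of_real ((2 * R) ^ CARD('n)) else 0))
       = (\<Sum>l\<in>?A. if l = k then (c k * cnj (c k)) * of_real ((2 * R) ^ CARD('n)) else 0)"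
      by (intro sum.cong) auto
    also have "\<dots> = (c k * cnj (c k)) * of_real ((2 * R) ^ CARD('n))"
      using k fin by (simp add: sum.delta)
    finally show "(\<Sum>l\<in>?A. (c k * cnj (c l)) * (if k - l = 0 then of_real ((2 * R) ^ CARD('n)) else 0))
       = complex_of_real ((cmod (c k))\<^sup>2 * (2 * R) ^ CARD('n))"
      by (simp only: of_real_mult complex_norm_square)
  qed
  also have "\<dots> = complex_of_real ((2 * R) ^ CARD('n) * (\<Sum>k\<in>?A. (cmod (c k))\<^sup>2))"
    by (simp add: sum_distrib_left mult.commute)
  finally show ?thesis unfolding of_real_eq_iff .
qed

section \<open>Trigonometric polynomials as an algebra, and their density\<close>

definition is_trig :: "real \<Rightarrow> (real^'n \<Rightarrow> complex) \<Rightarrow> bool" where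
  "is_trig \<omega> f \<longleftrightarrow> (\<exists>c. finite {k. c k \<noteq> 0} \<and> f = trigpoly \<omega> 0 c)"

lemma is_trig_lincomb: "is_trig \<omega> f \<Longrightarrow> is_trig \<omega> g \<Longrightarrow> is_trig \<omega> (\<lambda>x. f x + a * g x)"
  unfolding is_trig_def
proof (elim exE conjE)
  fix c d assume "finite {k. c k \<noteq> 0}" "f = trigpoly \<omega> 0 c" "finite {k. d k \<noteq> 0}" "g = trigpoly \<omega> 0 d"
  then show "\<exists>c. finite {k. c k \<noteq> 0} \<and> (\<lambda>x. f x + a * g x) = trigpoly \<omega> 0 c"
    by (intro exI[of _ "\<lambda>k. c k + a * d k"]) (simp add: finite_support_lincomb trigpoly_lincomb fun_eq_iff)
qed

lemma is_trig_exp: "is_trig \<omega> (\<lambda>x. a * cis (\<omega> *\<^sub>R int_vec k \<bullet> x))"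
  unfolding is_trig_def
proof (intro exI[of _ "\<lambda>l. if l = k then a else 0"] conjI ext)
  show "finite {l. (if l = k then a else 0) \<noteq> 0}" by (rule finite_subset[of _ "{k}"]) auto
  show "a * cis (\<omega> *\<^sub>R int_vec k \<bullet> x) = trigpoly \<omega> 0 (\<lambda>l. if l = k then a else 0) x" for x
    by (subst trigpoly_eq[of "{k}"]) (auto simp: freq_def)
qed

lemma is_trig_zero: "is_trig \<omega> (\<lambda>x. 0)"
  unfolding is_trig_def by (rule exI[of _ "\<lambda>k. 0"]) (simp add: trigpoly_def fun_eq_iff)

lemma is_trig_const: "is_trig \<omega> (\<lambda>x. a)"
  using is_trig_exp[of \<omega> a 0] by simp

lemma is_trig_add: "is_trig \<omega> f \<Longrightarrow> is_trig \<omega> g \<Longrightarrow> is_trig \<omega> (\<lambda>x. f x + g x)"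
  using is_trig_lincomb[of \<omega> f g 1] by simp

lemma is_trig_sum: "(\<And>j. j \<in> J \<Longrightarrow> is_trig \<omega> (f j)) \<Longrightarrow> is_trig \<omega> (\<lambda>x. \<Sum>j\<in>J. f j x)"
  by (induction J rule: infinite_finite_induct) (auto simp: is_trig_zero intro: is_trig_add)

lemma is_trig_scale: "is_trig \<omega> f \<Longrightarrow> is_trig \<omega> (\<lambda>x. a * f x)"
  using is_trig_lincomb[OF is_trig_zero, of \<omega> f a] by simp

text \<open>As \<open>is_trig\<close> hides the coefficients, the product is merely expanded into
  exponentials; no formula for the convolution of coefficients has to be stated.\<close>

lemma is_trig_mult:
  assumes "is_trig \<omega> f" "is_trig \<omega> g"
  shows "is_trig \<omega> (\<lambda>x. f x * g x)"
proof -
  obtain c d where *: "f = trigpoly \<omega> 0 c" "g = trigpoly \<omega> 0 d" using assms unfolding is_trig_def by blast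
  have "f x * g x = (\<Sum>k | c k \<noteq> 0. \<Sum>l | d l \<noteq> 0. (c k * d l) * cis (\<omega> *\<^sub>R int_vec (k + l) \<bullet> x))" for x
    unfolding * trigpoly_def sum_product
    by (intro sum.cong refl) (simp add: freq_def cis_mult[symmetric] inner_add_left distrib_left mult_ac)
  then show ?thesis by (simp only:) (intro is_trig_sum is_trig_exp)
qed

text \<open>Embeds the torus into a Euclidean space, glueing opposite faces of the cube. On the
  compact image the Stone-Weierstrass theorem for polynomial functions is available.\<close>

definition torus_map :: "real \<Rightarrow> real^'n \<Rightarrow> complex^'n" where
  "torus_map \<omega> x = (\<chi> i. cis (\<omega> * x $ i))"

lemma is_trig_coordinates:
  "is_trig \<omega> (\<lambda>x::real^'n. complex_of_real (cos (\<omega> * x $ i)))" "is_trig \<omega> (\<lambda>x::real^'n. complex_of_real (sin (\<omega> * x $ i)))"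
proof -
  have p: "cis (\<omega> * x $ i) = cis (\<omega> *\<^sub>R int_vec (axis i 1) \<bullet> x)" "cis (- (\<omega> * x $ i)) = cis (\<omega> *\<^sub>R int_vec (- axis i 1) \<bullet> x)" for x :: "real^'n"
  proof -
    have "int_vec (axis i 1) = axis i 1" "int_vec (- axis i 1) = - (axis i 1 :: real^'n)"
      by (auto simp: vec_eq_iff axis_def int_vec_def)
    then show "cis (\<omega> * x $ i) = cis (\<omega> *\<^sub>R int_vec (axis i 1) \<bullet> x)" "cis (- (\<omega> * x $ i)) = cis (\<omega> *\<^sub>R int_vec (- axis i 1) \<bullet> x)"
      by (simp_all add: inner_axis')
  qed
  have t: "is_trig \<omega> (\<lambda>x::real^'n. a * cis (\<omega> * x $ i))" "is_trig \<omega> (\<lambda>x::real^'n. a * cis (- (\<omega> * x $ i)))" for a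
    unfolding p by (rule is_trig_exp)+
  have "complex_of_real (cos y) = 1/2 * cis y + 1/2 * cis (- y)"
    "complex_of_real (sin y) = (- \<i>/2) * cis y + (\<i>/2) * cis (- y)" for y
    by (auto simp: complex_eq_iff)
  then show "is_trig \<omega> (\<lambda>x::real^'n. complex_of_real (cos (\<omega> * x $ i)))" "is_trig \<omega> (\<lambda>x::real^'n. complex_of_real (sin (\<omega> * x $ i)))"
    by (simp_all only:) (intro is_trig_add t)+
qed

text \<open>A linear functional of the torus map is a combination of the cosines and sines of the
  coordinates; sums and products follow by induction.\<close>

lemma is_trig_polynomial:
  assumes "real_polynomial_function (f :: complex^'n \<Rightarrow> real)"
  shows "is_trig \<omega> (\<lambda>x. complex_of_real (f (torus_map \<omega> x)))"
  using assms
proof (induction rule: real_polynomial_function.induct)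
  case (linear f)
  interpret bounded_linear f by fact
  have eq: "complex_of_real (f (torus_map \<omega> x)) = (\<Sum>i\<in>UNIV. complex_of_real (f (axis i 1)) * complex_of_real (cos (\<omega> * x $ i))
       + complex_of_real (f (axis i \<i>)) * complex_of_real (sin (\<omega> * x $ i)))" for x
  proof -
    have "torus_map \<omega> x = (\<Sum>i\<in>UNIV. cos (\<omega> * x $ i) *\<^sub>R axis i 1 + sin (\<omega> * x $ i) *\<^sub>R axis i \<i>)"
      by (simp add: vec_eq_iff torus_map_def axis_def complex_eq_iff if_distrib sum.delta cong: if_cong)
    then have "f (torus_map \<omega> x) = (\<Sum>i\<in>UNIV. cos (\<omega> * x $ i) * f (axis i 1) + sin (\<omega> * x $ i) * f (axis i \<i>))"
      by (simp add: sum add scale)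
    then show ?thesis by (simp add: mult.commute)
  qed
  show ?case unfolding eq by (intro is_trig_sum is_trig_add is_trig_scale is_trig_coordinates)
next
  case (const c)
  show ?case by (rule is_trig_const)
next
  case (add f g)
  then show ?case by (simp add: is_trig_add)
next
  case (mult f g)
  then show ?case by (simp add: is_trig_mult)
qed

text \<open>Coordinates with the same image differ by 2 R n for an integer n. Within [-R, R] a
  nonzero n puts both on opposite faces, so a function vanishing on the faces takes equal values at
  identified points.\<close>

lemma torus_map_eq:
  assumes R: "R > 0" and x: "x \<in> cube R" "y \<in> cube R" and eq: "torus_map (pi / R) x = torus_map (pi / R) y"
  shows "x = y \<or> (\<exists>i. \<bar>x $ i\<bar> = R) \<and> (\<exists>i. \<bar>y $ i\<bar> = R)"
proof (cases "x = y")
  case False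
  then obtain i where i: "x $ i \<noteq> y $ i" by (auto simp: vec_eq_iff)
  have "cis (pi / R * x $ i) = cis (pi / R * y $ i)"
    using arg_cong[OF eq, of "\<lambda>z. z $ i"] by (simp add: torus_map_def)
  then have "sin (pi / R * x $ i) = sin (pi / R * y $ i) \<and> cos (pi / R * x $ i) = cos (pi / R * y $ i)"
    by (simp add: complex_eq_iff)
  then obtain n :: int where "pi / R * x $ i = pi / R * y $ i + 2 * pi * n"
    unfolding sin_cos_eq_iff by blast
  then have "pi * x $ i = pi * (y $ i + 2 * R * n)" using R by (simp add: field_simps)
  then have n: "x $ i = y $ i + 2 * R * n" by simp
  have xb: "\<bar>x $ i\<bar> \<le> R" "\<bar>y $ i\<bar> \<le> R" using x by (auto simp: cube_def)
  have "n \<noteq> 0" using i n by auto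
  then consider "n \<ge> 1" | "n \<le> -1" by linarith
  then have "\<bar>x $ i\<bar> = R \<and> \<bar>y $ i\<bar> = R"
  proof cases
    case 1
    then have "2 * R * n \<ge> 2 * R * 1" using R by (intro mult_left_mono) auto
    then show ?thesis using n xb by linarith
  next
    case 2
    then have "2 * R * n \<le> 2 * R * (-1)" using R by (intro mult_left_mono) auto
    then show ?thesis using n xb by linarith
  qed
  then show ?thesis by blast
qed simp

text \<open>A continuous function on the cube that vanishes on the boundary descends to the torus, where
  the Stone-Weierstrass theorem applies.\<close>

lemma trig_approximation:
  fixes F :: "real^'n \<Rightarrow> complex"
  assumes R: "R > 0" and F: "continuous_on (cube R) F"
    and F0: "\<And>x i. x \<in> cube R \<Longrightarrow> \<bar>x $ i\<bar> = R \<Longrightarrow> F x = 0" and \<eta>: "\<eta> > 0"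
  shows "\<exists>c. finite {k. c k \<noteq> 0} \<and> (\<forall>x\<in>cube R. cmod (F x - trigpoly (pi / R) \<theta> c x) \<le> \<eta>)"
proof -
  let ?\<omega> = "pi / R" and ?p = "torus_map (pi / R) :: real^'n \<Rightarrow> _"
  \<comment> \<open>Removes the shift: trigonometric polynomials with shift \<open>\<theta>\<close>
    are unshifted ones times a fixed exponential of modulus 1, so the error is unchanged.\<close>
  define F1 where "F1 x = F x * cis (- (?\<omega> *\<^sub>R \<theta> \<bullet> x))" for x
  have cF1: "continuous_on (cube R) F1" unfolding F1_def by (intro continuous_intros F)
  have F10: "F1 x = 0" if "x \<in> cube R" "\<bar>x $ i\<bar> = R" for x i
    using F0[OF that] by (simp add: F1_def)
  have cp: "continuous_on S ?p" for S unfolding torus_map_def by (intro continuous_intros)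
  define G where "G z = F1 (SOME x. x \<in> cube R \<and> ?p x = z)" for z
  have G: "G (?p x) = F1 x" if x: "x \<in> cube R" for x
  proof -
    define y where "y = (SOME y. y \<in> cube R \<and> ?p y = ?p x)"
    have "y \<in> cube R \<and> ?p y = ?p x"
      unfolding y_def by (rule someI[where x=x and P="\<lambda>y. y \<in> cube R \<and> ?p y = ?p x"]) (simp add: x)
    then have y: "y \<in> cube R" "?p y = ?p x" by auto
    have "F1 y = F1 x"
      using torus_map_eq[OF R y(1) x y(2)] F10[OF y(1)] F10[OF x] by auto
    then show ?thesis by (simp add: G_def y_def)
  qed
  \<comment> \<open>On the compact cube the torus map sends closed sets to closed sets, so it is a
    quotient map and continuity of \<open>F1\<close> descends to \<open>G\<close>.\<close>
  have cG: "continuous_on (?p ` cube R) G"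
    unfolding continuous_on_closed
  proof (intro allI impI)
    fix C assume C: "closedin (top_of_set (G ` ?p ` cube R)) C"
    have im: "G ` ?p ` cube R = F1 ` cube R" using G by (auto simp: image_iff)
    have "closedin (top_of_set (cube R)) (cube R \<inter> F1 -` C)"
      using continuous_on_closed[THEN iffD1, rule_format, OF cF1 C[unfolded im]] .
    then have "compact (cube R \<inter> F1 -` C)" using compact_cube closedin_compact by blast
    then have "compact (?p ` (cube R \<inter> F1 -` C))" using cp by (rule compact_continuous_image[rotated])
    moreover have "?p ` (cube R \<inter> F1 -` C) = ?p ` cube R \<inter> G -` C" using G by auto
    ultimately show "closedin (top_of_set (?p ` cube R)) (?p ` cube R \<inter> G -` C)"
      by (metis closed_subset compact_imp_closed inf_le1)
  qed
  have "compact (?p ` cube R)" using cp compact_cube by (rule compact_continuous_image)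
  from Stone_Weierstrass_polynomial_function[OF this cG \<eta>] obtain g
    where g: "polynomial_function g" "\<And>z. z \<in> ?p ` cube R \<Longrightarrow> norm (G z - g z) < \<eta>" by blast
  have "real_polynomial_function (Re \<circ> g)" "real_polynomial_function (Im \<circ> g)"
    using g(1) bounded_linear_Re bounded_linear_Im unfolding polynomial_function_def by blast+
  from this[THEN is_trig_polynomial[of _ ?\<omega>]]
  have "is_trig ?\<omega> (\<lambda>x. complex_of_real (Re (g (?p x))) + \<i> * complex_of_real (Im (g (?p x))))"
    by (intro is_trig_lincomb) (auto simp: comp_def)
  then have "is_trig ?\<omega> (\<lambda>x. g (?p x))" by (simp add: complex_eq[symmetric])
  then obtain c where c: "finite {k. c k \<noteq> 0}" "(\<lambda>x. g (?p x)) = trigpoly ?\<omega> 0 c" unfolding is_trig_def by blast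
  have "cmod (F x - trigpoly ?\<omega> \<theta> c x) \<le> \<eta>" if x: "x \<in> cube R" for x
  proof -
    have "trigpoly ?\<omega> \<theta> c x = trigpoly ?\<omega> 0 c x * cis (?\<omega> *\<^sub>R \<theta> \<bullet> x)"
      unfolding trigpoly_def sum_distrib_right
      by (intro sum.cong refl) (simp add: freq_def cis_mult[symmetric] inner_add_left distrib_left mult_ac)
    moreover have "F x = F1 x * cis (?\<omega> *\<^sub>R \<theta> \<bullet> x)" by (simp add: F1_def mult.assoc cis_mult)
    ultimately have "F x - trigpoly ?\<omega> \<theta> c x = (F1 x - trigpoly ?\<omega> 0 c x) * cis (?\<omega> *\<^sub>R \<theta> \<bullet> x)"
      by (simp add: algebra_simps)
    then have "cmod (F x - trigpoly ?\<omega> \<theta> c x) = cmod (G (?p x) - g (?p x))"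
      using G[OF x] fun_cong[OF c(2), of x] by (simp add: norm_mult)
    then show ?thesis using g(2)[of "?p x"] x by simp
  qed
  then show ?thesis using c(1) by blast
qed

section \<open>Complex geometrical optics solutions\<close>

lemma cube_norm2_nonneg: "0 \<le> cube_norm2 R f"
  unfolding cube_norm2_def set_lebesgue_integral_def by (intro integral_nonneg_AE AE_I2) simp

lemma cube_norm2_integrable:
  fixes f :: "real^'n \<Rightarrow> complex"
  shows "continuous_on (cube R) f \<Longrightarrow> set_integrable lborel (cube R) (\<lambda>x. (cmod (f x))\<^sup>2)"
  by (intro set_integrable_cube continuous_intros)

lemma cube_norm2_add_le:
  fixes f g :: "real^'n \<Rightarrow> complex"
  assumes "continuous_on (cube R) f" "continuous_on (cube R) g"
  shows "cube_norm2 R (\<lambda>x. f x + g x) \<le> 2 * cube_norm2 R f + 2 * cube_norm2 R g"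
proof -
  have le: "(cmod (a + b))\<^sup>2 \<le> 2 * (cmod a)\<^sup>2 + 2 * (cmod b)\<^sup>2" for a b :: complex
  proof -
    have "(cmod (a + b))\<^sup>2 \<le> (cmod a + cmod b)\<^sup>2" by (intro power_mono norm_triangle_ineq) auto
    also have "\<dots> \<le> 2 * (cmod a)\<^sup>2 + 2 * (cmod b)\<^sup>2"
      using zero_le_power2[of "cmod a - cmod b"] by (simp add: power2_eq_square algebra_simps)
    finally show ?thesis .
  qed
  have i: "set_integrable lborel (cube R) (\<lambda>x. 2 * (cmod (f x))\<^sup>2)" "set_integrable lborel (cube R) (\<lambda>x. 2 * (cmod (g x))\<^sup>2)"
    using assms by (auto intro!: set_integrable_cube continuous_intros simp del: set_integral_mult_right)
  have "cube_norm2 R (\<lambda>x. f x + g x) \<le> (LINT x:cube R|lborel. 2 * (cmod (f x))\<^sup>2 + 2 * (cmod (g x))\<^sup>2)"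
    unfolding cube_norm2_def
    by (intro set_integral_mono cube_norm2_integrable continuous_intros assms set_integral_add i le)
  also have "\<dots> = 2 * cube_norm2 R f + 2 * cube_norm2 R g"
    using i by (simp add: set_integral_add cube_norm2_def)
  finally show ?thesis .
qed

lemma cube_norm2_mono:
  fixes f g :: "real^'n \<Rightarrow> complex"
  assumes "continuous_on (cube R) f" "continuous_on (cube R) g"
    and le: "\<And>x. x \<in> cube R \<Longrightarrow> cmod (f x) \<le> M * cmod (g x)" and M: "M \<ge> 0"
  shows "cube_norm2 R f \<le> M\<^sup>2 * cube_norm2 R g"
proof -
  have "cube_norm2 R f \<le> (LINT x:cube R|lborel. M\<^sup>2 * (cmod (g x))\<^sup>2)"
    unfolding cube_norm2_def
  proof (intro set_integral_mono)
    show "set_integrable lborel (cube R) (\<lambda>x. M\<^sup>2 * (cmod (g x))\<^sup>2)"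
      by (intro set_integrable_cube continuous_intros assms)
    show "(cmod (f x))\<^sup>2 \<le> M\<^sup>2 * (cmod (g x))\<^sup>2" if "x \<in> cube R" for x
      using power_mono[OF le[OF that] norm_ge_zero, of 2] by (simp add: power_mult_distrib)
  qed (intro cube_norm2_integrable assms)
  then show ?thesis by (simp add: cube_norm2_def)
qed

lemma cube_norm2_bounded:
  fixes f :: "real^'n \<Rightarrow> complex"
  assumes "continuous_on (cube R) f" "\<And>x. x \<in> cube R \<Longrightarrow> cmod (f x) \<le> \<eta>" "\<eta> \<ge> 0"
  shows "cube_norm2 R f \<le> \<eta>\<^sup>2 * cube_norm2 R (\<lambda>x::real^'n. 1)"
  by (rule cube_norm2_mono) (use assms in \<open>auto intro!: continuous_intros\<close>)

lemma cube_norm2_uminus: "cube_norm2 R (\<lambda>x. - f x) = cube_norm2 R f"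
  by (simp add: cube_norm2_def)

text \<open>By Parseval a lower bound for the symbol bounds the inverse multiplier on L^2, uniformly
  in the number of frequencies.\<close>

lemma cube_norm2_multiplier:
  fixes \<theta> :: "real^'n"
  assumes R: "R > 0" and fin: "finite {k. c k \<noteq> 0}" and \<sigma>: "\<And>k. cmod (\<sigma> k) \<ge> \<kappa>" and \<kappa>: "\<kappa> > 0"
  shows "cube_norm2 R (trigpoly (pi / R) \<theta> (\<lambda>k. c k / \<sigma> k)) \<le> cube_norm2 R (trigpoly (pi / R) \<theta> c) / \<kappa>\<^sup>2"
proof -
  have s0: "\<sigma> k \<noteq> 0" for k using \<sigma>[of k] \<kappa> by auto
  then have supp: "{k. c k / \<sigma> k \<noteq> 0} = {k. c k \<noteq> 0}" by auto
  have "(\<Sum>k | c k \<noteq> 0. (cmod (c k / \<sigma> k))\<^sup>2) \<le> (\<Sum>k | c k \<noteq> 0. (cmod (c k))\<^sup>2 / \<kappa>\<^sup>2)"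
  proof (rule sum_mono)
    fix k
    have "cmod (c k / \<sigma> k) \<le> cmod (c k) / \<kappa>"
      unfolding norm_divide using \<sigma> \<kappa> by (intro divide_left_mono) (auto intro: mult_pos_pos simp: s0)
    then have "(cmod (c k / \<sigma> k))\<^sup>2 \<le> (cmod (c k) / \<kappa>)\<^sup>2" by (intro power_mono) auto
    then show "(cmod (c k / \<sigma> k))\<^sup>2 \<le> (cmod (c k))\<^sup>2 / \<kappa>\<^sup>2" by (simp add: power_divide)
  qed
  then have "(2 * R) ^ CARD('n) * (\<Sum>k | c k \<noteq> 0. (cmod (c k / \<sigma> k))\<^sup>2)
     \<le> (2 * R) ^ CARD('n) * ((\<Sum>k | c k \<noteq> 0. (cmod (c k))\<^sup>2) / \<kappa>\<^sup>2)"
    using R by (intro mult_left_mono) (auto simp: sum_divide_distrib)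
  moreover have "cube_norm2 R (trigpoly (pi / R) \<theta> (\<lambda>k. c k / \<sigma> k)) = (2 * R) ^ CARD('n) * (\<Sum>k | c k \<noteq> 0. (cmod (c k / \<sigma> k))\<^sup>2)"
    using parseval[OF R, of "\<lambda>k. c k / \<sigma> k" \<theta>] fin unfolding supp by simp
  ultimately show ?thesis using parseval[OF R fin, of \<theta>] by simp
qed

text \<open>Neumann iteration: the Fourier multiplier \<open>\<sigma>\<close> dominates multiplication by \<open>q\<close>, and the
  iterates are kept trigonometric polynomials by approximating \<open>q (1 + r)\<close>.\<close>

lemma neumann_trigpoly:
  fixes \<theta> :: "real^'n" and q :: "real^'n \<Rightarrow> real" and \<sigma> :: "int^'n \<Rightarrow> complex"
  assumes R: "R > 0" and q: "continuous_on (cube R) q"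
    and q0: "\<And>x i. x \<in> cube R \<Longrightarrow> \<bar>x $ i\<bar> = R \<Longrightarrow> q x = 0"
    and qM: "\<And>x. x \<in> cube R \<Longrightarrow> \<bar>q x\<bar> \<le> M" and M: "M > 0"
    and \<sigma>: "\<And>k. cmod (\<sigma> k) \<ge> \<kappa>" and \<kappa>: "\<kappa> \<ge> 4 * M" and \<epsilon>: "\<epsilon> > 0"
  shows "\<exists>c. finite {k. c k \<noteq> 0} \<and>
    cube_norm2 R (trigpoly (pi / R) \<theta> c) \<le> 16 * M\<^sup>2 / \<kappa>\<^sup>2 * cube_norm2 R (\<lambda>x::real^'n. 1) \<and>
    cube_norm2 R (\<lambda>x. trigpoly (pi / R) \<theta> (\<lambda>k. \<sigma> k * c k) x - of_real (q x) * (1 + trigpoly (pi / R) \<theta> c x)) \<le> \<epsilon>"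
proof -
  define V where "V = cube_norm2 R (\<lambda>x::real^'n. 1)"
  have V0: "V \<ge> 0" by (simp add: V_def cube_norm2_nonneg)
  have \<kappa>0: "\<kappa> > 0" using M \<kappa> by linarith
  have \<kappa>M: "16 * M\<^sup>2 \<le> \<kappa>\<^sup>2" using power_mono[OF \<kappa>, of 2] M by (simp add: power_mult_distrib)
  \<comment> \<open>Invariant of the iteration for the squared norm of r. Since
    \<open>b \<le> V\<close>, q (1 + r) has squared norm at most 4 M^2 V; doubling it and adding
    twice the approximation error M^2 V gives 10 M^2 V, which 16 M^2 V covers, and division by the
    symbol contributes \<kappa>^2.\<close>
  define b where "b = 16 * M\<^sup>2 / \<kappa>\<^sup>2 * V"
  have "16 * M\<^sup>2 / \<kappa>\<^sup>2 \<le> 1" using \<kappa>M \<kappa>0 by simp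
  then have bV: "b \<le> V" unfolding b_def using V0 by (metis mult_left_le_one_le mult_nonneg_nonneg zero_le_divide_iff zero_le_numeral zero_le_power2)
  have b0: "0 \<le> b" using V0 by (simp add: b_def)
  \<comment> \<open>The bound \<open>M\<close> on the approximation error serves the invariant
    \<open>b\<close>; the root gives \<open>\<eta>\<^sup>2 * V \<le> \<epsilon> / 12\<close> for the
    residual, with \<open>V + 1\<close> to avoid a zero denominator.\<close>
  define \<eta> where "\<eta> = min M (sqrt (\<epsilon> / (12 * (V + 1))))"
  have \<eta>: "\<eta> > 0" "\<eta> \<le> M" using M \<epsilon> V0 by (auto simp: \<eta>_def)
  have \<eta>V: "\<eta>\<^sup>2 * V \<le> \<epsilon> / 12"
  proof -
    have "\<eta>\<^sup>2 \<le> (sqrt (\<epsilon> / (12 * (V + 1))))\<^sup>2" using \<eta> by (intro power_mono) (auto simp: \<eta>_def)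
    then have "\<eta>\<^sup>2 \<le> \<epsilon> / (12 * (V + 1))" using \<epsilon> V0 by simp
    then have "\<eta>\<^sup>2 * V \<le> \<epsilon> / (12 * (V + 1)) * V" using V0 by (rule mult_right_mono)
    also have "\<dots> \<le> \<epsilon> / 12" using \<epsilon> V0 by (simp add: field_simps)
    finally show ?thesis .
  qed
  let ?T = "trigpoly (pi / R) \<theta>"
  define res where "res c x = ?T (\<lambda>k. \<sigma> k * c k) x - of_real (q x) * (1 + ?T c x)" for c x
  have cq: "continuous_on (cube R) (\<lambda>x. complex_of_real (q x))" by (intro continuous_intros q)
  have cres: "continuous_on (cube R) (res c)" for c unfolding res_def by (intro continuous_intros cq)
  have s0: "\<sigma> k \<noteq> 0" for k using \<sigma>[of k] \<kappa>0 by auto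
  \<comment> \<open>The new coefficients satisfy \<sigma> c' = t exactly, where t approximates q (1
    + r). The new residual is the approximation error minus q times the increment of r, and the
    increment is, up to the same error, the old residual divided by \<sigma>. As M / \<kappa> is at
    most 1/4, the squared residual shrinks by a factor 4.\<close>
  have step: "\<exists>c'. finite {k. c' k \<noteq> 0} \<and> cube_norm2 R (?T c') \<le> b \<and> cube_norm2 R (res c') \<le> cube_norm2 R (res c) / 4 + \<epsilon> / 4"
    if fin: "finite {k. c k \<noteq> 0}" and cb: "cube_norm2 R (?T c) \<le> b" for c
  proof -
    define F where "F x = complex_of_real (q x) * (1 + ?T c x)" for x
    have cF: "continuous_on (cube R) F" unfolding F_def by (intro continuous_intros cq)
    have F0: "F x = 0" if "x \<in> cube R" "\<bar>x $ i\<bar> = R" for x i using q0[OF that] by (simp add: F_def)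
    have "\<exists>t. finite {k. t k \<noteq> 0} \<and> (\<forall>x\<in>cube R. cmod (F x - ?T t x) \<le> \<eta>)"
      by (rule trig_approximation[OF R cF F0 \<eta>(1)])
    then obtain t where t: "finite {k. t k \<noteq> 0}" "\<And>x. x \<in> cube R \<Longrightarrow> cmod (F x - ?T t x) \<le> \<eta>"
      by blast
    define c' where "c' k = t k / \<sigma> k" for k
    have fc': "finite {k. c' k \<noteq> 0}" by (rule finite_subset[OF _ t(1)]) (auto simp: c'_def)
    have fsc: "finite {k. \<sigma> k * c k \<noteq> 0}" by (rule finite_subset[OF _ fin]) auto
    have sc': "(\<lambda>k. \<sigma> k * c' k) = t" by (auto simp: c'_def s0)
    have cT: "continuous_on (cube R) (?T d)" for d by (rule continuous_on_trigpoly)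
    have n1: "cube_norm2 R (\<lambda>x. ?T t x - F x) \<le> \<eta>\<^sup>2 * V"
      unfolding V_def using t(2) \<eta>(1) by (intro cube_norm2_bounded continuous_intros cT cF) (auto simp: norm_minus_commute)
    have nF: "cube_norm2 R F \<le> M\<^sup>2 * (2 * V + 2 * b)"
    proof -
      have "cube_norm2 R F \<le> M\<^sup>2 * cube_norm2 R (\<lambda>x. 1 + ?T c x)"
        unfolding F_def using qM M by (intro cube_norm2_mono continuous_intros cq cT) (auto simp: norm_mult mult_right_mono)
      also have "cube_norm2 R (\<lambda>x. 1 + ?T c x) \<le> 2 * V + 2 * cube_norm2 R (?T c)"
        unfolding V_def by (intro cube_norm2_add_le continuous_intros cT)
      also have "\<dots> \<le> 2 * V + 2 * b" using cb by simp
      finally show ?thesis by (simp add: mult_left_mono)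
    qed
    have "cube_norm2 R (?T t) = cube_norm2 R (\<lambda>x. F x + (?T t x - F x))" by simp
    also have "\<dots> \<le> 2 * cube_norm2 R F + 2 * cube_norm2 R (\<lambda>x. ?T t x - F x)"
      by (intro cube_norm2_add_le continuous_intros cT cF)
    also have "\<dots> \<le> 2 * (M\<^sup>2 * (2 * V + 2 * V)) + 2 * (M\<^sup>2 * V)"
    proof -
      have "M\<^sup>2 * (2 * V + 2 * b) \<le> M\<^sup>2 * (2 * V + 2 * V)" using bV by (intro mult_left_mono) auto
      moreover have "\<eta>\<^sup>2 * V \<le> M\<^sup>2 * V" using \<eta> V0 by (intro mult_right_mono power_mono) auto
      ultimately show ?thesis using nF n1 by linarith
    qed
    also have "\<dots> \<le> 16 * M\<^sup>2 * V" using V0 by (simp add: algebra_simps)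
    finally have nt: "cube_norm2 R (?T t) \<le> 16 * M\<^sup>2 * V" .
    have "cube_norm2 R (?T c') \<le> cube_norm2 R (?T t) / \<kappa>\<^sup>2"
      unfolding c'_def by (rule cube_norm2_multiplier[OF R t(1) \<sigma> \<kappa>0])
    also have "\<dots> \<le> (16 * M\<^sup>2 * V) / \<kappa>\<^sup>2" using nt by (intro divide_right_mono) auto
    finally have nc': "cube_norm2 R (?T c') \<le> b" by (simp add: b_def)
    \<comment> \<open>\<sigma> times the increment c' - c; as a function it is the approximation
      error minus the old residual.\<close>
    define d where "d k = t k + (-1) * (\<sigma> k * c k)" for k
    have fd: "finite {k. d k \<noteq> 0}" unfolding d_def by (rule finite_support_lincomb[OF t(1) fsc])
    have Td: "?T d x = (?T t x - F x) + - res c x" for x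
      unfolding d_def res_def F_def trigpoly_lincomb[OF t(1) fsc] by simp
    have nd: "cube_norm2 R (?T d) \<le> 2 * (\<eta>\<^sup>2 * V) + 2 * cube_norm2 R (res c)"
    proof -
      have "cube_norm2 R (?T d) = cube_norm2 R (\<lambda>x. (?T t x - F x) + - res c x)" by (simp only: Td[abs_def])
      also have "\<dots> \<le> 2 * cube_norm2 R (\<lambda>x. ?T t x - F x) + 2 * cube_norm2 R (\<lambda>x. - res c x)"
        by (intro cube_norm2_add_le continuous_intros cT cF cres)
      finally show ?thesis using n1 by (simp add: cube_norm2_uminus)
    qed
    have dc: "(\<lambda>k. d k / \<sigma> k) = (\<lambda>k. c' k + (-1) * c k)" using s0 by (auto simp: d_def c'_def diff_divide_distrib)
    have ndc: "cube_norm2 R (\<lambda>x. ?T c' x - ?T c x) \<le> cube_norm2 R (?T d) / \<kappa>\<^sup>2"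
    proof -
      have "?T (\<lambda>k. d k / \<sigma> k) x = ?T c' x - ?T c x" for x unfolding dc trigpoly_lincomb[OF fc' fin] by simp
      moreover have "cube_norm2 R (?T (\<lambda>k. d k / \<sigma> k)) \<le> cube_norm2 R (?T d) / \<kappa>\<^sup>2"
        by (rule cube_norm2_multiplier[OF R fd \<sigma> \<kappa>0])
      ultimately show ?thesis by (simp add: cube_norm2_def)
    qed
    have "cube_norm2 R (res c') = cube_norm2 R (\<lambda>x. (?T t x - F x) + of_real (- q x) * (?T c' x - ?T c x))"
      unfolding res_def sc' F_def by (simp add: algebra_simps)
    also have "\<dots> \<le> 2 * cube_norm2 R (\<lambda>x. ?T t x - F x) + 2 * cube_norm2 R (\<lambda>x. of_real (- q x) * (?T c' x - ?T c x))"
      by (intro cube_norm2_add_le continuous_intros cT cF q)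
    also have "cube_norm2 R (\<lambda>x. of_real (- q x) * (?T c' x - ?T c x)) \<le> M\<^sup>2 * cube_norm2 R (\<lambda>x. ?T c' x - ?T c x)"
      using qM M by (intro cube_norm2_mono continuous_intros q cT) (auto simp: norm_mult mult_right_mono)
    also have "\<dots> \<le> M\<^sup>2 * ((2 * (\<eta>\<^sup>2 * V) + 2 * cube_norm2 R (res c)) / \<kappa>\<^sup>2)"
      using ndc nd by (intro mult_left_mono order_trans[OF ndc divide_right_mono[OF nd]]) auto
    also have "\<dots> = (M\<^sup>2 / \<kappa>\<^sup>2) * (2 * (\<eta>\<^sup>2 * V) + 2 * cube_norm2 R (res c))" by simp
    also have "\<dots> \<le> 1 / 16 * (2 * (\<eta>\<^sup>2 * V) + 2 * cube_norm2 R (res c))"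
      using \<kappa>M \<kappa>0 V0 cube_norm2_nonneg[of R "res c"] by (intro mult_right_mono) (auto simp: divide_le_eq)
    finally have "cube_norm2 R (res c') \<le> 2 * cube_norm2 R (\<lambda>x. ?T t x - F x) + 2 * (1 / 16 * (2 * (\<eta>\<^sup>2 * V) + 2 * cube_norm2 R (res c)))"
      by simp
    also have "\<dots> \<le> cube_norm2 R (res c) / 4 + \<epsilon> / 4"
    proof -
      have "2 * a + 2 * (1 / 16 * (2 * b + 2 * d)) \<le> d / 4 + \<epsilon> / 4" if "a \<le> b" "b \<le> \<epsilon> / 12" for a b d :: real
        using that \<epsilon> by (simp add: field_simps)
      then show ?thesis using n1 \<eta>V by blast
    qed
    finally show ?thesis using fc' nc' by blast
  qed
  define D where "D = cube_norm2 R (res (\<lambda>k. 0))"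
  \<comment> \<open>The summand \<open>\<epsilon> / 2\<close> reproduces itself: a quarter of it
    plus \<open>\<epsilon> / 4\<close> stays below it.\<close>
  have iter: "\<exists>c. finite {k. c k \<noteq> 0} \<and> cube_norm2 R (?T c) \<le> b \<and> cube_norm2 R (res c) \<le> D / 4 ^ m + \<epsilon> / 2" for m
  proof (induction m)
    case 0
    have "?T (\<lambda>k. 0) = (\<lambda>x. 0)" by (simp add: trigpoly_def fun_eq_iff)
    then have "cube_norm2 R (?T (\<lambda>k. 0)) = 0" by (simp add: cube_norm2_def)
    then show ?case using b0 \<epsilon> by (intro exI[of _ "\<lambda>k. 0"]) (simp add: D_def)
  next
    case (Suc m)
    then obtain c where c: "finite {k. c k \<noteq> 0}" "cube_norm2 R (?T c) \<le> b" "cube_norm2 R (res c) \<le> D / 4 ^ m + \<epsilon> / 2" by blast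
    obtain c' where c': "finite {k. c' k \<noteq> 0}" "cube_norm2 R (?T c') \<le> b" "cube_norm2 R (res c') \<le> cube_norm2 R (res c) / 4 + \<epsilon> / 4"
      using step[OF c(1,2)] by blast
    have "cube_norm2 R (res c') \<le> (D / 4 ^ m + \<epsilon> / 2) / 4 + \<epsilon> / 4"
      by (rule order_trans[OF c'(3)]) (intro add_right_mono divide_right_mono c(3), simp)
    also have "\<dots> \<le> D / 4 ^ Suc m + \<epsilon> / 2" using \<epsilon> by (simp add: field_simps)
    finally show ?case using c'(1,2) by blast
  qed
  have D0: "D \<ge> 0" by (simp add: D_def cube_norm2_nonneg)
  obtain m where m: "2 * D / \<epsilon> < 4 ^ m" using real_arch_pow[of 4 "2 * D / \<epsilon>"] by auto
  have Dm: "D / 4 ^ m + \<epsilon> / 2 \<le> \<epsilon>" using m \<epsilon> by (simp add: field_simps)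
  obtain c where c: "finite {k. c k \<noteq> 0}" "cube_norm2 R (?T c) \<le> b" "cube_norm2 R (res c) \<le> D / 4 ^ m + \<epsilon> / 2"
    using iter by blast
  have "cube_norm2 R (res c) \<le> \<epsilon>" by (rule order_trans[OF c(3) Dm])
  then show ?thesis using c(1,2) unfolding res_def b_def V_def by blast
qed

text \<open>Bilinear, without conjugation: the Laplacian of \<open>exp (cdot \<mu> x)\<close> is
  then the sum of the squares of the entries of \<open>\<mu>\<close> times this function, and that
  sum can vanish for nonzero complex \<open>\<mu>\<close>.\<close>

definition cdot :: "complex^'n \<Rightarrow> real^'n \<Rightarrow> complex" where
  "cdot \<mu> x = (\<Sum>i\<in>UNIV. \<mu> $ i * of_real (x $ i))"

lemma cdot_bounded_linear: "bounded_linear (cdot \<mu>)"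
  unfolding cdot_def
  by (intro bounded_linear_sum bounded_linear_const_mult bounded_linear_compose[OF bounded_linear_of_real] bounded_linear_vec_nth)

lemma cdot_has_derivative: "((\<lambda>x. cdot \<mu> x) has_derivative cdot \<mu>) (at x)"
  by (rule bounded_linear_imp_has_derivative[OF cdot_bounded_linear])

lemma continuous_on_cdot [continuous_intros]: "continuous_on S (cdot \<mu>)"
  by (rule linear_continuous_on[OF cdot_bounded_linear])

lemma cdot_Basis: "cdot \<mu> h = (\<Sum>b\<in>Basis. of_real (h \<bullet> b) * cdot \<mu> b)"
proof -
  interpret bounded_linear "cdot \<mu>" by (rule cdot_bounded_linear)
  have "cdot \<mu> h = cdot \<mu> (\<Sum>b\<in>Basis. (h \<bullet> b) *\<^sub>R b)" by (simp add: euclidean_representation)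
  also have "\<dots> = (\<Sum>b\<in>Basis. (h \<bullet> b) *\<^sub>R cdot \<mu> b)" by (simp only: sum scale)
  finally show ?thesis by (simp add: scaleR_conv_of_real)
qed

lemma cdot_axis [simp]: "cdot \<mu> (axis i 1) = \<mu> $ i"
  by (simp add: cdot_def axis_def if_distrib cong: if_cong)

text \<open>Differentiation acts on the coefficients only, so the class is closed under it, and it
  contains both the leading exponential and its trigonometric correction.\<close>

definition expsum :: "'j set \<Rightarrow> ('j \<Rightarrow> complex) \<Rightarrow> ('j \<Rightarrow> complex^'n) \<Rightarrow> real^'n \<Rightarrow> complex" where
  "expsum J c \<mu> x = (\<Sum>j\<in>J. c j * exp (cdot (\<mu> j) x))"

lemma expsum_has_derivative:
  "(expsum J c \<mu> has_derivative (\<lambda>h. \<Sum>b\<in>Basis. of_real (h \<bullet> b) * expsum J (\<lambda>j. c j * cdot (\<mu> j) b) \<mu> x)) (at x)"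
proof -
  have "((\<lambda>x. exp (cdot (\<mu> j) x)) has_derivative (\<lambda>h. exp (cdot (\<mu> j) x) * cdot (\<mu> j) h)) (at x)" for j
    using has_derivative_compose[OF cdot_has_derivative DERIV_exp[unfolded has_field_derivative_def]] .
  then have "(expsum J c \<mu> has_derivative (\<lambda>h. \<Sum>j\<in>J. c j * (exp (cdot (\<mu> j) x) * cdot (\<mu> j) h))) (at x)"
    unfolding expsum_def by (intro has_derivative_sum has_derivative_mult_right)
  moreover have "(\<Sum>j\<in>J. c j * (exp (cdot (\<mu> j) x) * cdot (\<mu> j) h))
      = (\<Sum>b\<in>Basis. of_real (h \<bullet> b) * expsum J (\<lambda>j. c j * cdot (\<mu> j) b) \<mu> x)" for h
    unfolding expsum_def cdot_Basis[of _ h] sum_distrib_left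
    by (subst sum.swap) (simp add: mult_ac)
  ultimately show ?thesis by simp
qed

lemma expsum_smooth:
  fixes \<mu> :: "'j \<Rightarrow> complex^'n"
  assumes \<alpha>: "0 < \<alpha>" "\<alpha> < 1" and U: "open U" "bounded U"
  shows "holder_on k \<alpha> U (\<lambda>x. Re (expsum J c \<mu> x))"
    and "laplacian (\<lambda>x. Re (expsum J c \<mu> x)) x = Re (expsum J (\<lambda>j. c j * (\<Sum>i\<in>UNIV. (\<mu> j $ i)\<^sup>2)) \<mu> x)"
proof -
  \<comment> \<open>\<open>rev\<close> places the outermost derivative last, matching the factor
    that \<open>expsum_has_derivative\<close> appends on the right.\<close>
  define D where "D bs x = Re (expsum J (\<lambda>j. c j * (\<Prod>b\<leftarrow>rev bs. cdot (\<mu> j) b)) \<mu> x)" for bs x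
  have dD: "(D bs has_derivative (\<lambda>h. \<Sum>b\<in>Basis. (h \<bullet> b) * D (b # bs) x)) (at x)" for bs x
  proof -
    have "(D bs has_derivative (\<lambda>h. Re (\<Sum>b\<in>Basis. of_real (h \<bullet> b) * expsum J (\<lambda>j. c j * (\<Prod>b\<leftarrow>rev bs. cdot (\<mu> j) b) * cdot (\<mu> j) b) \<mu> x))) (at x)"
      unfolding D_def by (intro has_derivative_Re expsum_has_derivative)
    then show ?thesis by (simp add: D_def mult.assoc)
  qed
  have D0: "D [] = (\<lambda>x. Re (expsum J c \<mu> x))" by (simp add: D_def[abs_def])
  note S = smooth_family_holder_on[OF \<alpha> U dD]
  show "holder_on k \<alpha> U (\<lambda>x. Re (expsum J c \<mu> x))" using S(1) unfolding D0 .
  have "laplacian (\<lambda>x. Re (expsum J c \<mu> x)) x = (\<Sum>b\<in>Basis. D [b, b] x)"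
    unfolding laplacian_def D0[symmetric] by (intro sum.cong refl) (subst S(2), auto)
  also have "\<dots> = Re (expsum J (\<lambda>j. c j * (\<Sum>i\<in>UNIV. (\<mu> j $ i)\<^sup>2)) \<mu> x)"
    unfolding sum_Basis_vec D_def expsum_def Re_sum[symmetric] sum_distrib_left sum_distrib_right
    by (subst sum.swap) (simp add: power2_eq_square mult_ac)
  finally show "laplacian (\<lambda>x. Re (expsum J c \<mu> x)) x = Re (expsum J (\<lambda>j. c j * (\<Sum>i\<in>UNIV. (\<mu> j $ i)\<^sup>2)) \<mu> x)" .
qed

text \<open>Hoelder classes are real valued, hence the two parts. \<open>Lw\<close> is the Laplacian
  on \<open>\<Omega>\<close>, continued continuously to the whole space so that residuals can be
  measured on the cube.\<close>

definition complex_C2 :: "real \<Rightarrow> (real^'n) set \<Rightarrow> (real^'n \<Rightarrow> complex) \<Rightarrow> (real^'n \<Rightarrow> complex) \<Rightarrow> bool" where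
  "complex_C2 \<alpha> \<Omega> w Lw \<longleftrightarrow>
     holder_on 2 \<alpha> \<Omega> (\<lambda>x. Re (w x)) \<and> holder_on 2 \<alpha> \<Omega> (\<lambda>x. Im (w x)) \<and>
     (\<forall>x\<in>\<Omega>. laplacian (\<lambda>x. Re (w x)) x = Re (Lw x) \<and> laplacian (\<lambda>x. Im (w x)) x = Im (Lw x)) \<and>
     continuous_on UNIV w \<and> continuous_on UNIV Lw"

lemma continuous_on_expsum: "continuous_on S (expsum J c \<mu>)"
  unfolding expsum_def by (intro continuous_intros)

lemma expsum_complex_C2:
  fixes \<mu> :: "'j \<Rightarrow> complex^'n"
  assumes \<alpha>: "0 < \<alpha>" "\<alpha> < 1" and U: "open U" "bounded U"
  shows "complex_C2 \<alpha> U (expsum J c \<mu>) (expsum J (\<lambda>j. c j * (\<Sum>i\<in>UNIV. (\<mu> j $ i)\<^sup>2)) \<mu>)"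
proof -
  \<comment> \<open>Multiplying the coefficients by -i turns imaginary parts into real parts, which
    \<open>expsum_smooth\<close> handles.\<close>
  have Im: "Im (expsum J d \<mu> x) = Re (expsum J (\<lambda>j. - \<i> * d j) \<mu> x)" for d x
  proof -
    have "expsum J (\<lambda>j. - \<i> * d j) \<mu> x = - \<i> * expsum J d \<mu> x"
      by (simp add: expsum_def sum_distrib_left sum_negf mult.assoc)
    then show ?thesis by simp
  qed
  have Im': "Im (expsum J (\<lambda>j. c j * (\<Sum>i\<in>UNIV. (\<mu> j $ i)\<^sup>2)) \<mu> x)
      = Re (expsum J (\<lambda>j. (- \<i> * c j) * (\<Sum>i\<in>UNIV. (\<mu> j $ i)\<^sup>2)) \<mu> x)" for x
    unfolding Im by (simp only: mult.assoc)
  show ?thesis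
    unfolding complex_C2_def Im[of c] Im'
    by (intro conjI ballI expsum_smooth[OF assms] continuous_on_expsum)
qed

text \<open>For \<zeta> . \<zeta> = 0, conjugation with exp (\<zeta> . x) turns the Laplacian into
  the Fourier multiplier whose modulus \<open>symb\<close> bounds from below. The equation for the
  correction r becomes \<sigma> r = q (1 + r), which \<open>neumann_trigpoly\<close> solves
  approximately.\<close>

lemma cgo_approximate_solution:
  fixes \<zeta> :: "complex^'n" and \<theta> :: "real^'n" and q :: "real^'n \<Rightarrow> real"
  assumes \<alpha>: "0 < \<alpha>" "\<alpha> < 1" and \<Omega>: "open \<Omega>" "bounded \<Omega>"
    and R: "R > 0" and q: "continuous_on (cube R) q"
    and q0: "\<And>x i. x \<in> cube R \<Longrightarrow> \<bar>x $ i\<bar> = R \<Longrightarrow> q x = 0"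
    and qM: "\<And>x. x \<in> cube R \<Longrightarrow> \<bar>q x\<bar> \<le> M" and M: "M > 0"
    and \<zeta>: "(\<Sum>i\<in>UNIV. (\<zeta> $ i)\<^sup>2) = 0"
    and symb: "\<And>k. cmod (2 * \<i> * cdot \<zeta> (freq (pi / R) \<theta> k) - of_real ((norm (freq (pi / R) \<theta> k))\<^sup>2)) \<ge> \<kappa>"
    and \<kappa>: "\<kappa> \<ge> 4 * M" and \<epsilon>: "\<epsilon> > 0"
  shows "\<exists>w Lw r. complex_C2 \<alpha> \<Omega> w Lw \<and> continuous_on UNIV r \<and> (\<forall>x. w x = exp (cdot \<zeta> x) * (1 + r x)) \<and>
    cube_norm2 R r \<le> 16 * M\<^sup>2 / \<kappa>\<^sup>2 * cube_norm2 R (\<lambda>x::real^'n. 1) \<and>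
    cube_norm2 R (\<lambda>x. Lw x - of_real (q x) * w x) \<le> \<epsilon>"
proof -
  have "compact ((\<lambda>x. exp (cdot \<zeta> x)) ` cube R)" by (intro compact_continuous_image compact_cube continuous_intros)
  from compact_imp_bounded[OF this] obtain B where B: "B > 0" "\<And>x. x \<in> cube R \<Longrightarrow> cmod (exp (cdot \<zeta> x)) \<le> B"
    unfolding bounded_pos by auto
  define \<sigma> where "\<sigma> k = 2 * \<i> * cdot \<zeta> (freq (pi / R) \<theta> k) - of_real ((norm (freq (pi / R) \<theta> k))\<^sup>2)" for k
  \<comment> \<open>The residual finally gets multiplied by exp (\<zeta> . x), so the tolerance is
    divided by the square of its bound on the cube.\<close>
  have \<epsilon>B: "\<epsilon> / B\<^sup>2 > 0" using B \<epsilon> by simp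
  have "\<exists>c. finite {k. c k \<noteq> 0} \<and>
    cube_norm2 R (trigpoly (pi / R) \<theta> c) \<le> 16 * M\<^sup>2 / \<kappa>\<^sup>2 * cube_norm2 R (\<lambda>x::real^'n. 1) \<and>
    cube_norm2 R (\<lambda>x. trigpoly (pi / R) \<theta> (\<lambda>k. \<sigma> k * c k) x - of_real (q x) * (1 + trigpoly (pi / R) \<theta> c x)) \<le> \<epsilon> / B\<^sup>2"
    by (rule neumann_trigpoly[OF R q q0 qM M symb[folded \<sigma>_def] \<kappa> \<epsilon>B])
  then obtain c where c: "finite {k. c k \<noteq> 0}"
    "cube_norm2 R (trigpoly (pi / R) \<theta> c) \<le> 16 * M\<^sup>2 / \<kappa>\<^sup>2 * cube_norm2 R (\<lambda>x::real^'n. 1)"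
    "cube_norm2 R (\<lambda>x. trigpoly (pi / R) \<theta> (\<lambda>k. \<sigma> k * c k) x - of_real (q x) * (1 + trigpoly (pi / R) \<theta> c x)) \<le> \<epsilon> / B\<^sup>2"
    by blast
  define S where "S = {k. c k \<noteq> 0}"
  \<comment> \<open>\<open>None\<close> stands for the leading exponential, \<open>Some k\<close>
    for the term of the correction with frequency \<zeta> + i f, f being
    \<open>freq (pi / R) \<theta> k\<close>.\<close>
  define J where "J = insert None (Some ` S)"
  define \<mu> where "\<mu> j = (case j of None \<Rightarrow> \<zeta> | Some k \<Rightarrow> (\<chi> i. \<zeta> $ i + \<i> * of_real (freq (pi / R) \<theta> k $ i)))" for j
  define C where "C j = (case j of None \<Rightarrow> 1 | Some k \<Rightarrow> c k)" for j
  have fS: "finite S" using c by (simp add: S_def)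
  have sumJ: "(\<Sum>j\<in>J. g j) = g None + (\<Sum>k\<in>S. g (Some k))" for g :: "(int^'n) option \<Rightarrow> complex"
    unfolding J_def by (subst sum.insert) (auto simp: fS sum.reindex)
  have e: "exp (cdot (\<mu> (Some k)) x) = exp (cdot \<zeta> x) * cis (freq (pi / R) \<theta> k \<bullet> x)" for k x
  proof -
    have "cdot (\<mu> (Some k)) x = cdot \<zeta> x + \<i> * of_real (freq (pi / R) \<theta> k \<bullet> x)"
      by (simp add: cdot_def \<mu>_def inner_vec_def distrib_right sum.distrib sum_distrib_left mult.assoc)
    then show ?thesis by (simp add: exp_add cis_conv_exp)
  qed
  have eN: "exp (cdot (\<mu> None) x) = exp (cdot \<zeta> x)" for x by (simp add: \<mu>_def)
  have sq: "(\<Sum>i\<in>UNIV. (\<mu> (Some k) $ i)\<^sup>2) = \<sigma> k" for k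
  proof -
    have "(\<Sum>i\<in>UNIV. (\<mu> (Some k) $ i)\<^sup>2) = (\<Sum>i\<in>UNIV. (\<zeta> $ i)\<^sup>2 + 2 * \<i> * (\<zeta> $ i * of_real (freq (pi / R) \<theta> k $ i)) - of_real (freq (pi / R) \<theta> k $ i * freq (pi / R) \<theta> k $ i))"
      by (intro sum.cong refl) (simp add: \<mu>_def power2_eq_square algebra_simps)
    also have "\<dots> = \<sigma> k"
      by (simp add: sum.distrib sum_subtractf \<zeta> \<sigma>_def cdot_def sum_distrib_left power2_norm_eq_inner inner_vec_def)
    finally show ?thesis .
  qed
  define w where "w = expsum J C \<mu>"
  define Lw where "Lw = expsum J (\<lambda>j. C j * (\<Sum>i\<in>UNIV. (\<mu> j $ i)\<^sup>2)) \<mu>"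
  have w: "w x = exp (cdot \<zeta> x) * (1 + trigpoly (pi / R) \<theta> c x)" for x
    unfolding w_def expsum_def sumJ e eN trigpoly_def S_def[symmetric]
    by (simp add: C_def distrib_left sum_distrib_left mult_ac)
  have Lw: "Lw x = exp (cdot \<zeta> x) * trigpoly (pi / R) \<theta> (\<lambda>k. \<sigma> k * c k) x" for x
  proof -
    have "trigpoly (pi / R) \<theta> (\<lambda>k. \<sigma> k * c k) x = (\<Sum>k\<in>S. (\<sigma> k * c k) * cis (freq (pi / R) \<theta> k \<bullet> x))"
      using fS by (intro trigpoly_eq) (auto simp: S_def)
    moreover have "(\<Sum>i\<in>UNIV. (\<mu> None $ i)\<^sup>2) = 0" by (simp add: \<mu>_def \<zeta>)
    ultimately show ?thesis
      unfolding Lw_def expsum_def sumJ e eN sq by (simp add: C_def sum_distrib_left mult_ac)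
  qed
  have cq: "continuous_on (cube R) (\<lambda>x. complex_of_real (q x))" by (intro continuous_intros q)
  have "cube_norm2 R (\<lambda>x. Lw x - of_real (q x) * w x)
      \<le> B\<^sup>2 * cube_norm2 R (\<lambda>x. trigpoly (pi / R) \<theta> (\<lambda>k. \<sigma> k * c k) x - of_real (q x) * (1 + trigpoly (pi / R) \<theta> c x))"
  proof (rule cube_norm2_mono)
    show "continuous_on (cube R) (\<lambda>x. Lw x - of_real (q x) * w x)"
      unfolding w Lw by (intro continuous_intros cq)
    show "continuous_on (cube R) (\<lambda>x. trigpoly (pi / R) \<theta> (\<lambda>k. \<sigma> k * c k) x - of_real (q x) * (1 + trigpoly (pi / R) \<theta> c x))"
      by (intro continuous_intros cq)
    fix x :: "real^'n" assume x: "x \<in> cube R"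
    have "Lw x - of_real (q x) * w x = exp (cdot \<zeta> x) * (trigpoly (pi / R) \<theta> (\<lambda>k. \<sigma> k * c k) x - of_real (q x) * (1 + trigpoly (pi / R) \<theta> c x))"
      unfolding w Lw by (simp add: algebra_simps)
    then show "cmod (Lw x - of_real (q x) * w x) \<le> B * cmod (trigpoly (pi / R) \<theta> (\<lambda>k. \<sigma> k * c k) x - of_real (q x) * (1 + trigpoly (pi / R) \<theta> c x))"
      using B(2)[OF x] by (simp add: norm_mult mult_right_mono)
  qed (use B in simp)
  also have "\<dots> \<le> B\<^sup>2 * (\<epsilon> / B\<^sup>2)" using c(3) by (intro mult_left_mono) auto
  also have "\<dots> = \<epsilon>" using B by simp
  finally have res: "cube_norm2 R (\<lambda>x. Lw x - of_real (q x) * w x) \<le> \<epsilon>" .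
  show ?thesis
  proof (intro exI conjI allI)
    show "complex_C2 \<alpha> \<Omega> w Lw" unfolding w_def Lw_def by (rule expsum_complex_C2[OF \<alpha> \<Omega>])
    show "continuous_on UNIV (trigpoly (pi / R) \<theta> c)" by (intro continuous_intros)
  qed (rule w c(2) res)+
qed

section \<open>Linearisation of the Monge-Ampere problem\<close>

text \<open>In the Leibniz formula a permutation other than the identity moves at least two indices.
  After one factor is differentiated, another off-diagonal zero of the identity matrix remains, so
  only the identity permutation contributes, and it gives the trace.\<close>

lemma det_has_derivative_at_identity:
  fixes A :: "real \<Rightarrow> real^'n^'n"
  assumes d: "\<And>i j. ((\<lambda>t. A t $ i $ j) has_real_derivative B i j) (at 0)" and A0: "A 0 = mat 1"
  shows "((\<lambda>t. det (A t)) has_real_derivative (\<Sum>i\<in>UNIV. B i i)) (at 0)"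
proof -
  have dp: "((\<lambda>t. \<Prod>i\<in>UNIV. A t $ i $ p i) has_real_derivative (if p = id then \<Sum>i\<in>UNIV. B i i else 0)) (at 0)"
    if p: "p permutes UNIV" for p
  proof -
    have "((\<lambda>t. \<Prod>i\<in>UNIV. A t $ i $ p i) has_derivative
        (\<lambda>y. \<Sum>i\<in>UNIV. (B i (p i) * y) * (\<Prod>j\<in>UNIV - {i}. A 0 $ j $ p j))) (at 0)"
      using d by (intro has_derivative_prod) (simp add: has_field_derivative_def)
    moreover have "(\<Sum>i\<in>UNIV. (B i (p i) * y) * (\<Prod>j\<in>UNIV - {i}. A 0 $ j $ p j))
        = (if p = id then \<Sum>i\<in>UNIV. B i i else 0) * y" for y
    proof (cases "p = id")
      case True
      then show ?thesis by (simp add: A0 mat_def sum_distrib_right)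
    next
      case False
      have z: "(\<Prod>j\<in>UNIV - {i}. A 0 $ j $ p j) = 0" for i
      proof -
        have "\<exists>j. j \<noteq> i \<and> p j \<noteq> j"
        proof (rule ccontr)
          assume *: "\<not> ?thesis"
          have "p i = i"
          proof (rule ccontr)
            assume "p i \<noteq> i"
            then have "p (p i) = p i" using * by blast
            then show False using \<open>p i \<noteq> i\<close> permutes_inj[OF p] by (simp add: inj_eq)
          qed
          then have "p = id" using * by (auto simp: fun_eq_iff)
          then show False using False by simp
        qed
        then obtain j where "j \<noteq> i" "p j \<noteq> j" by blast
        then show ?thesis by (intro prod_zero) (auto simp: A0 mat_def intro!: bexI[of _ j])
      qed
      show ?thesis unfolding z using False by simp
    qed
    ultimately show ?thesis by (simp add: has_field_derivative_def)
  qed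
  have "((\<lambda>t. \<Sum>p | p permutes UNIV. of_int (sign p) * (\<Prod>i\<in>UNIV. A t $ i $ p i)) has_real_derivative
      (\<Sum>p | p permutes (UNIV::'n set). of_int (sign p) * (if p = id then \<Sum>i\<in>UNIV. B i i else 0))) (at 0)"
    using dp by (intro DERIV_sum DERIV_cmult) auto
  moreover have "(\<Sum>p | p permutes (UNIV::'n set). of_int (sign p) * (if p = id then \<Sum>i\<in>UNIV. B i i else 0)) = (\<Sum>i\<in>UNIV. B i i)"
  proof -
    have "(\<Sum>p | p permutes (UNIV::'n set). of_int (sign p) * (if p = id then \<Sum>i\<in>UNIV. B i i else 0))
       = (\<Sum>p | p permutes (UNIV::'n set). if p = id then \<Sum>i\<in>UNIV. B i i else 0)"
      by (intro sum.cong) auto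
    also have "\<dots> = (\<Sum>i\<in>UNIV. B i i)" by (simp add: sum.delta finite_permutations permutes_id)
    finally show ?thesis .
  qed
  ultimately show ?thesis by (simp add: det_def)
qed

lemma grad_eq_gradient: "grad u = gradient u"
  by (auto simp: fun_eq_iff vec_eq_iff grad_def gradient_def sum_Basis_vec axis_def if_distrib cong: if_cong)

lemma laplacian_eq_trace: "laplacian u x = (\<Sum>i\<in>UNIV. hessian u x $ i $ i)"
  by (simp add: laplacian_def sum_Basis_vec hessian_def)

lemma axis_directions [simp]: "[axis i (1::real)] \<in> directions 1" "[axis i (1::real), axis j 1] \<in> directions 2"
  by (auto simp: directions_def Basis_vec_real)

definition quadratic :: "'a::euclidean_space \<Rightarrow> real" where
  "quadratic x = (norm x)\<^sup>2 / 2"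

lemma quadratic_holder:
  fixes U :: "'a::euclidean_space set" and b c x :: 'a
  assumes \<alpha>: "0 < \<alpha>" "\<alpha> < 1" and U: "open U" "bounded U"
  shows "holder_on k \<alpha> U quadratic"
    and "c \<in> Basis \<Longrightarrow> b \<in> Basis \<Longrightarrow> pderivs [b, c] quadratic x = b \<bullet> c"
proof -
  define D :: "'a list \<Rightarrow> 'a \<Rightarrow> real" where
    "D bs x = (case bs of [] \<Rightarrow> quadratic x | [b] \<Rightarrow> x \<bullet> b | [b, c] \<Rightarrow> b \<bullet> c | _ \<Rightarrow> 0)" for bs x
  have dD: "(D bs has_derivative (\<lambda>h. \<Sum>b\<in>Basis. (h \<bullet> b) * D (b # bs) x)) (at x)" for bs x
  proof -
    show ?thesis
    \<comment> \<open>The rule serves only as a case split into lists of length 0, 1 and at least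
      2.\<close>
    proof (cases bs rule: remdups_adj.cases)
      case 1
      have "((\<lambda>x. x \<bullet> x) has_derivative (\<lambda>h. x \<bullet> h + h \<bullet> x)) (at x)"
        by (rule has_derivative_inner[OF has_derivative_ident has_derivative_ident])
      from has_derivative_scaleR_right[OF this, of "1 / 2"]
      have "((\<lambda>x. (x \<bullet> x) / 2) has_derivative (\<lambda>h. (x \<bullet> h + h \<bullet> x) / 2)) (at x)"
        by simp
      moreover have "(x \<bullet> h + h \<bullet> x) / 2 = (\<Sum>b\<in>Basis. (h \<bullet> b) * D [b] x)" for h
        by (simp add: D_def inner_commute[of x h] euclidean_inner[of h x])
      moreover have "D [] = (\<lambda>x. (x \<bullet> x) / 2)"
        by (simp add: D_def[abs_def] quadratic_def[abs_def] power2_norm_eq_inner)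
      ultimately show ?thesis unfolding 1 by simp
    next
      case (2 c)
      have "((\<lambda>x. x \<bullet> c) has_derivative (\<lambda>h. h \<bullet> c)) (at x)" by (auto intro!: derivative_eq_intros)
      moreover have "h \<bullet> c = (\<Sum>b\<in>Basis. (h \<bullet> b) * D [b, c] x)" for h
        unfolding D_def by (subst euclidean_inner[of h c]) (simp add: inner_commute[of c])
      moreover have "D [c] = (\<lambda>x. x \<bullet> c)" by (simp add: D_def[abs_def])
      ultimately show ?thesis unfolding 2 by simp
    next
      case (3 b c cs)
      then have "D bs = (\<lambda>x. case cs of [] \<Rightarrow> b \<bullet> c | _ \<Rightarrow> 0)" "\<And>e. D (e # bs) x = 0"
        by (auto simp: D_def fun_eq_iff split: list.split)
      then show ?thesis by simp
    qed
  qed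
  have D0: "D [] = quadratic" by (simp add: D_def[abs_def])
  note S = smooth_family_holder_on[OF \<alpha> U dD]
  show "holder_on k \<alpha> U quadratic" using S(1) unfolding D0 .
  show "pderivs [b, c] quadratic x = b \<bullet> c" if "c \<in> Basis" "b \<in> Basis"
    using S(2)[of "[b, c]"] that unfolding D0 by (simp add: D_def)
qed

lemma partial_z_eq:
  fixes a :: "(real^'n) \<times> real \<times> (real^'n) \<Rightarrow> real"
  assumes a: "holder_on 1 \<alpha> (\<Omega> \<times> UNIV \<times> UNIV) a" and x: "x \<in> \<Omega>"
  shows "((\<lambda>t. a (x, t, p)) has_real_derivative pderivs [(0, 1, 0)] a (x, z, p)) (at z)"
    and "partial_z a x z p = pderivs [(0, 1, 0)] a (x, z, p)"
proof -
  have "a differentiable (at (x, z, p))" using holder_onD(2)[OF a, of 0 "[]" "(x, z, p)"] x by simp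
  then have D: "(a has_derivative frechet_derivative a (at (x, z, p))) (at (x, z, p))"
    using frechet_derivative_works by blast
  interpret bounded_linear "frechet_derivative a (at (x, z, p))" using D by (rule has_derivative_bounded_linear)
  have "((\<lambda>t. (x, t, p)) has_derivative (\<lambda>t. (0, t, 0))) (at z)"
    by (intro has_derivative_Pair has_derivative_const has_derivative_ident)
  from has_derivative_compose[OF this D]
  have "((\<lambda>t. a (x, t, p)) has_derivative (\<lambda>t. frechet_derivative a (at (x, z, p)) (0, t, 0))) (at z)" .
  moreover have "frechet_derivative a (at (x, z, p)) (0, t, 0) = pderivs [(0, 1, 0)] a (x, z, p) * t" for t
  proof -
    have "(0, t, 0) = t *\<^sub>R (0 :: real^'n, 1 :: real, 0 :: real^'n)" by simp
    then have "frechet_derivative a (at (x, z, p)) (0, t, 0) = t *\<^sub>R frechet_derivative a (at (x, z, p)) (0, 1, 0)"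
      by (simp only: scale)
    then show ?thesis by (simp add: pderivs.simps)
  qed
  ultimately show d: "((\<lambda>t. a (x, t, p)) has_real_derivative pderivs [(0, 1, 0)] a (x, z, p)) (at z)"
    by (simp add: has_field_derivative_def)
  show "partial_z a x z p = pderivs [(0, 1, 0)] a (x, z, p)"
    unfolding partial_z_def by (rule DERIV_imp_deriv[OF d])
qed

text \<open>The Tietze extension and the integrability arguments want potentials on the closure,
  whereas \<open>partial_z\<close> is controlled inside only. The continuous extension of the
  derivative, which the Hoelder class of \<open>a\<close> provides, is composed with the graph of
  \<open>\<Phi>\<close>.\<close>

lemma partial_z_continuous_extension:
  fixes a :: "(real^'n) \<times> real \<times> (real^'n) \<Rightarrow> real"
  assumes a: "holder_on 1 \<alpha> (\<Omega> \<times> UNIV \<times> UNIV) a" and \<Phi>: "continuous_on UNIV \<Phi>"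
  shows "\<exists>g. continuous_on (closure \<Omega>) g \<and> (\<forall>x\<in>\<Omega>. g x = partial_z a x (\<Phi> x) 0)"
proof -
  have "[(0 :: real^'n, 1 :: real, 0 :: real^'n)] \<in> directions 1"
    by (simp add: directions_def Basis_prod_def)
  then obtain g where g: "continuous_on (closure (\<Omega> \<times> UNIV \<times> UNIV)) g"
    "\<And>y. y \<in> \<Omega> \<times> UNIV \<times> UNIV \<Longrightarrow> g y = pderivs [(0, 1, 0)] a y"
    using holder_onD(3)[OF a order_refl] by blast
  have "continuous_on (closure \<Omega>) (\<lambda>x. (x, \<Phi> x, 0 :: real^'n))"
    by (intro continuous_intros continuous_on_subset[OF \<Phi>]) auto
  then have "continuous_on (closure \<Omega>) (\<lambda>x. g (x, \<Phi> x, 0))"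
    by (rule continuous_on_compose2[OF g(1)]) (auto simp: closure_Times)
  then show ?thesis using g(2) partial_z_eq(2)[OF a] by (intro exI[of _ "\<lambda>x. g (x, \<Phi> x, 0)"]) auto
qed

section \<open>Boundary limits of gradients and differentiation of the solution operator\<close>

context
  fixes \<Omega> :: "(real^'n) set" and \<alpha> :: real
  assumes op: "open \<Omega>" and ne: "\<Omega> \<noteq> {}"
begin

text \<open>\<open>normal_deriv\<close> is built on \<open>Lim\<close>, which is informative only if
  the limit exists; the continuous extensions of the first derivatives provide it.\<close>

lemma gradient_limit:
  assumes "holder_on 2 \<alpha> \<Omega> u" "x0 \<in> frontier \<Omega>"
  shows "\<exists>g. (gradient u \<longlongrightarrow> g) (at x0 within \<Omega>)"
proof -
  have "\<exists>l. (pderivs [b] u \<longlongrightarrow> l) (at x0 within \<Omega>)" if b: "b \<in> Basis" for b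
  proof -
    obtain g where g: "continuous_on (closure \<Omega>) g" "\<forall>x\<in>\<Omega>. g x = pderivs [b] u x"
      using holder_onD(3)[OF assms(1), of 1 "[b]"] b by (auto simp: directions_def)
    have "x0 \<in> closure \<Omega>" using assms(2) by (simp add: frontier_def)
    then have "(g \<longlongrightarrow> g x0) (at x0 within \<Omega>)"
      using g(1) closure_subset[of \<Omega>] unfolding continuous_on_def by (meson tendsto_within_subset)
    moreover have "\<forall>\<^sub>F x in at x0 within \<Omega>. g x = pderivs [b] u x"
      using g(2) by (auto simp: eventually_at_filter)
    ultimately show ?thesis using Lim_transform_eventually by blast
  qed
  then obtain l where "\<And>b. b \<in> Basis \<Longrightarrow> (pderivs [b] u \<longlongrightarrow> l b) (at x0 within \<Omega>)" by metis
  then have "(gradient u \<longlongrightarrow> (\<Sum>b\<in>Basis. l b *\<^sub>R b)) (at x0 within \<Omega>)"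
    unfolding gradient_def[abs_def] by (intro tendsto_intros)
  then show ?thesis by blast
qed

lemma at_within_frontier_nontrivial:
  assumes "x0 \<in> frontier \<Omega>"
  shows "at x0 within \<Omega> \<noteq> bot"
proof -
  have "x0 \<notin> \<Omega>" "x0 \<in> closure \<Omega>" using assms op by (auto simp: frontier_def interior_open)
  then show ?thesis unfolding trivial_limit_within by (auto simp: closure_def)
qed

lemma normal_deriv_eq:
  assumes "(gradient u \<longlongrightarrow> g) (at x0 within \<Omega>)" "x0 \<in> frontier \<Omega>"
  shows "normal_deriv \<Omega> u x0 = g \<bullet> outer_normal \<Omega> x0"
  unfolding normal_deriv_def grad_eq_gradient
  using tendsto_Lim[OF at_within_frontier_nontrivial[OF assms(2)] assms(1)] by simp

text \<open>The Frechet derivative of the solution operator, tested along \<open>t \<mapsto> \<phi> + t w\<close>.\<close>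

lemma solution_expansion:
  assumes \<alpha>: "0 < \<alpha>" "\<alpha> < 1" and bd: "bounded \<Omega>"
    and \<Phi>: "\<Phi> = quadratic" and wp: "well_posed \<Omega> \<alpha> a \<Phi> \<delta> V"
    and w: "holder_on 2 \<alpha> \<Omega> w"
  defines "u \<equiv> \<lambda>t. solution_in \<Omega> a V (restrict (\<lambda>x. \<Phi> x + t * w x) (frontier \<Omega>))"
  shows "\<exists>v. holder_on 2 \<alpha> \<Omega> v \<and> u 0 = restrict \<Phi> (closure \<Omega>) \<and>
    (\<exists>t0>0. \<forall>t. \<bar>t\<bar> < t0 \<longrightarrow> restrict (\<lambda>x. \<Phi> x + t * w x) (frontier \<Omega>) \<in> bdry_ball \<Omega> \<alpha> (restrict \<Phi> (frontier \<Omega>)) \<delta> \<and>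
        holder_on 2 \<alpha> \<Omega> (u t) \<and> MA_solution \<Omega> a (\<lambda>x. \<Phi> x + t * w x) (u t)) \<and>
    (\<forall>\<epsilon>>0. \<exists>r>0. \<forall>t. \<bar>t\<bar> < r \<longrightarrow> (\<forall>j\<le>2. \<forall>bs\<in>directions j. \<forall>x\<in>\<Omega>.
        \<bar>pderivs bs (u t) x - pderivs bs \<Phi> x - t * pderivs bs v x\<bar> \<le> \<epsilon> * \<bar>t\<bar>))"
proof -
  let ?\<phi> = "restrict \<Phi> (frontier \<Omega>)" and ?S = "solution_in \<Omega> a V" and ?h = "restrict w (frontier \<Omega>)"
  define \<eta> where "\<eta> t = restrict (\<lambda>x. \<Phi> x + t * w x) (frontier \<Omega>)" for t
  have u: "u t = ?S (\<eta> t)" for t by (simp add: u_def \<eta>_def)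
  have \<Phi>h: "holder_on 2 \<alpha> \<Omega> \<Phi>" unfolding \<Phi> by (rule quadratic_holder(1)[OF \<alpha> op bd])
  note wp' = wp[unfolded well_posed_def Let_def]
  have \<delta>: "\<delta> > 0" and VH: "V \<subseteq> holder_space 2 \<alpha> \<Omega>"
    and ex1: "\<forall>\<eta>\<in>bdry_ball \<Omega> \<alpha> ?\<phi> \<delta>. \<exists>!u. u \<in> V \<and> MA_solution \<Omega> a \<eta> u"
    and C1: "\<exists>\<delta>'>0. \<delta>' \<le> \<delta> \<and> C1_on_bdry_ball \<Omega> \<alpha> ?S ?\<phi> \<delta>'"
    and S\<phi>: "?S ?\<phi> = restrict \<Phi> (closure \<Omega>)"
    using wp' by simp_all
  define C where "C = holder_norm 2 \<alpha> \<Omega> w"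
  have C0: "C \<ge> 0" unfolding C_def by (rule holder_norm_nonneg[OF op ne w])
  have tw: "holder_on 2 \<alpha> \<Omega> (\<lambda>x. t * w x)" "holder_norm 2 \<alpha> \<Omega> (\<lambda>x. t * w x) \<le> \<bar>t\<bar> * C" for t
    unfolding C_def using holder_on_scale[OF op w] holder_norm_scale_le[OF op ne w] by auto
  have bn: "bdry_norm 2 \<alpha> \<Omega> g \<le> \<bar>t\<bar> * C" if "\<And>x. x \<in> frontier \<Omega> \<Longrightarrow> t * w x = g x" for g t
    using bdry_norm_le[OF op ne tw(1)[of t] that] tw(2)[of t] by linarith
  have ball: "\<eta> t \<in> bdry_ball \<Omega> \<alpha> ?\<phi> d" if "\<bar>t\<bar> * C < d" for t d
  proof -
    have "\<eta> t \<in> bdry_space 2 \<alpha> \<Omega>"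
      unfolding \<eta>_def by (rule restrict_in_bdry_space[OF op holder_on_lincomb[OF op \<Phi>h w]])
    moreover have "bdry_norm 2 \<alpha> \<Omega> (\<lambda>x. \<eta> t x - ?\<phi> x) \<le> \<bar>t\<bar> * C"
      by (rule bn) (simp add: \<eta>_def)
    ultimately show ?thesis using that by (simp add: bdry_ball_def)
  qed
  have \<eta>0: "\<eta> 0 = ?\<phi>" by (simp add: \<eta>_def)
  obtain \<delta>' D where \<delta>': "\<delta>' > 0" "\<forall>\<eta>\<in>bdry_ball \<Omega> \<alpha> ?\<phi> \<delta>'. frechet_deriv_at \<Omega> \<alpha> ?S \<eta> (D \<eta>)"
    using C1 unfolding C1_on_bdry_ball_def by (elim exE conjE) (rule that)
  define L where "L = D ?\<phi>"
  have "?\<phi> \<in> bdry_ball \<Omega> \<alpha> ?\<phi> \<delta>'" using ball[of 0 \<delta>'] \<delta>'(1) by (simp add: \<eta>0)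
  then have fd: "frechet_deriv_at \<Omega> \<alpha> ?S ?\<phi> L" using \<delta>'(2) by (simp add: L_def)
  have LH: "\<And>h. h \<in> bdry_space 2 \<alpha> \<Omega> \<Longrightarrow> L h \<in> holder_space 2 \<alpha> \<Omega>"
    and Llin: "\<And>h k c. h \<in> bdry_space 2 \<alpha> \<Omega> \<Longrightarrow> k \<in> bdry_space 2 \<alpha> \<Omega> \<Longrightarrow>
        L (restrict (\<lambda>x. h x + c * k x) (frontier \<Omega>)) = restrict (\<lambda>x. L h x + c * L k x) (closure \<Omega>)"
    and Lfd: "\<And>\<epsilon>. \<epsilon> > 0 \<Longrightarrow> \<exists>r>0. \<forall>h\<in>bdry_space 2 \<alpha> \<Omega>. bdry_norm 2 \<alpha> \<Omega> h < r \<longrightarrow>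
        holder_norm 2 \<alpha> \<Omega> (\<lambda>x. ?S (restrict (\<lambda>y. ?\<phi> y + h y) (frontier \<Omega>)) x - ?S ?\<phi> x - L h x) \<le> \<epsilon> * bdry_norm 2 \<alpha> \<Omega> h"
    using fd unfolding frechet_deriv_at_def bounded_linear_op_def by simp_all
  have hb: "?h \<in> bdry_space 2 \<alpha> \<Omega>" by (rule restrict_in_bdry_space[OF op w])
  define v where "v = L ?h"
  have vh: "holder_on 2 \<alpha> \<Omega> v" using LH[OF hb] by (simp add: v_def holder_space_def)
  define k where "k t = restrict (\<lambda>x. t * w x) (frontier \<Omega>)" for t
  have kb: "k t \<in> bdry_space 2 \<alpha> \<Omega>" for t unfolding k_def by (rule restrict_in_bdry_space[OF op tw(1)])
  \<comment> \<open>\<open>bounded_linear_op\<close> states linearity for combinations h + c k, so L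
    0 = 0 is extracted with c = -1 before scalar multiples become available.\<close>
  have Lk0: "L (k 0) = restrict (\<lambda>x. 0) (closure \<Omega>)"
  proof -
    have "k 0 = restrict (\<lambda>x. ?h x + (-1) * ?h x) (frontier \<Omega>)" by (auto simp: k_def restrict_def)
    then show ?thesis using Llin[OF hb hb, of "-1"] by (simp add: restrict_def)
  qed
  have Lk: "L (k t) x = t * v x" if "x \<in> closure \<Omega>" for t x
  proof -
    have "k t = restrict (\<lambda>x. k 0 x + t * ?h x) (frontier \<Omega>)" by (auto simp: k_def restrict_def)
    then have "L (k t) = restrict (\<lambda>x. L (k 0) x + t * L ?h x) (closure \<Omega>)" using Llin[OF kb hb] by simp
    then show ?thesis using that by (simp add: Lk0 v_def)
  qed
  have sol: "holder_on 2 \<alpha> \<Omega> (u t)" "MA_solution \<Omega> a (\<lambda>x. \<Phi> x + t * w x) (u t)" "\<eta> t \<in> bdry_ball \<Omega> \<alpha> ?\<phi> \<delta>"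
    if t: "\<bar>t\<bar> * C < \<delta>" for t
  proof -
    show b: "\<eta> t \<in> bdry_ball \<Omega> \<alpha> ?\<phi> \<delta>" by (rule ball[OF t])
    have "u t \<in> V \<and> MA_solution \<Omega> a (\<eta> t) (u t)"
      unfolding u solution_in_def by (rule theI'[OF ex1[rule_format, OF b]])
    then show "holder_on 2 \<alpha> \<Omega> (u t)" "MA_solution \<Omega> a (\<lambda>x. \<Phi> x + t * w x) (u t)"
      using VH by (auto simp: holder_space_def MA_solution_def \<eta>_def)
  qed
  have small: "\<bar>t\<bar> * C < d" if "\<bar>t\<bar> < d / (C + 1)" "d > 0" for t d :: real
  proof -
    have "\<bar>t\<bar> * C \<le> \<bar>t\<bar> * (C + 1)" by (intro mult_left_mono) auto
    also have "\<dots> < d" using that C0 by (simp add: field_simps)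
    finally show ?thesis .
  qed
  have exp: "\<exists>r>0. \<forall>t. \<bar>t\<bar> < r \<longrightarrow> (\<forall>j\<le>2. \<forall>bs\<in>directions j. \<forall>x\<in>\<Omega>.
        \<bar>pderivs bs (u t) x - pderivs bs \<Phi> x - t * pderivs bs v x\<bar> \<le> \<epsilon> * \<bar>t\<bar>)" if \<epsilon>: "\<epsilon> > 0" for \<epsilon>
  proof -
    \<comment> \<open>The boundary norm of t w is at most |t| C; \<open>C + 1\<close> makes the
      division legitimate when \<open>C\<close> is 0.\<close>
    have "\<epsilon> / (C + 1) > 0" using \<epsilon> C0 by simp
    from Lfd[OF this] obtain r where r: "r > 0" and r': "\<forall>h\<in>bdry_space 2 \<alpha> \<Omega>. bdry_norm 2 \<alpha> \<Omega> h < r \<longrightarrow>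
        holder_norm 2 \<alpha> \<Omega> (\<lambda>x. ?S (restrict (\<lambda>y. ?\<phi> y + h y) (frontier \<Omega>)) x - ?S ?\<phi> x - L h x) \<le> \<epsilon> / (C + 1) * bdry_norm 2 \<alpha> \<Omega> h"
      by (elim exE conjE) (rule that)
    show ?thesis
    proof (intro exI[of _ "min r \<delta> / (C + 1)"] conjI allI impI ballI)
      show "0 < min r \<delta> / (C + 1)" using r \<delta> C0 by simp
      fix t :: real and j :: nat and bs :: "(real^'n) list" and x
      assume t: "\<bar>t\<bar> < min r \<delta> / (C + 1)" and j: "j \<le> 2" "bs \<in> directions j" and x: "x \<in> \<Omega>"
      have tC: "\<bar>t\<bar> * C < r" "\<bar>t\<bar> * C < \<delta>" using small[OF t] r \<delta> by auto
      \<comment> \<open>Written with the factors -1 and -t so that the rules for u + c v apply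
        twice.\<close>
      define f where "f x = (u t x + (-1) * \<Phi> x) + (-t) * v x" for x
      have h1: "holder_on 2 \<alpha> \<Omega> (\<lambda>x. u t x + (-1) * \<Phi> x)" by (rule holder_on_lincomb[OF op sol(1)[OF tC(2)] \<Phi>h])
      have fh: "holder_on 2 \<alpha> \<Omega> f" unfolding f_def by (rule holder_on_lincomb[OF op h1 vh])
      have pf: "pderivs bs f x = pderivs bs (u t) x - pderivs bs \<Phi> x - t * pderivs bs v x"
        unfolding f_def pderivs_holder_lincomb(1)[OF op h1 vh j x] pderivs_holder_lincomb(1)[OF op sol(1)[OF tC(2)] \<Phi>h j x]
        by simp
      have bk: "bdry_norm 2 \<alpha> \<Omega> (k t) \<le> \<bar>t\<bar> * C" by (rule bn) (simp add: k_def)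
      have \<eta>k: "restrict (\<lambda>y. ?\<phi> y + k t y) (frontier \<Omega>) = \<eta> t" by (auto simp: k_def \<eta>_def restrict_def)
      have "\<bar>pderivs bs f x\<bar> \<le> holder_norm 2 \<alpha> \<Omega> f" by (rule abs_pderivs_le_holder_norm[OF op ne fh j x])
      also have "\<dots> = holder_norm 2 \<alpha> \<Omega> (\<lambda>x. ?S (restrict (\<lambda>y. ?\<phi> y + k t y) (frontier \<Omega>)) x - ?S ?\<phi> x - L (k t) x)"
      proof (rule holder_norm_cong[OF op])
        fix y assume "y \<in> \<Omega>"
        then have "y \<in> closure \<Omega>" using closure_subset by blast
        then show "f y = ?S (restrict (\<lambda>y. ?\<phi> y + k t y) (frontier \<Omega>)) y - ?S ?\<phi> y - L (k t) y"
          unfolding \<eta>k S\<phi> f_def by (simp add: Lk u)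
      qed
      also have "\<dots> \<le> \<epsilon> / (C + 1) * bdry_norm 2 \<alpha> \<Omega> (k t)" using bk tC(1) by (intro r'[rule_format] kb) linarith
      also have "\<dots> \<le> \<epsilon> / (C + 1) * (\<bar>t\<bar> * C)" using bk \<epsilon> C0 by (intro mult_left_mono) auto
      also have "\<dots> = (\<epsilon> * \<bar>t\<bar>) * (C / (C + 1))" by simp
      also have "\<dots> \<le> (\<epsilon> * \<bar>t\<bar>) * 1" using \<epsilon> C0 by (intro mult_left_mono) auto
      finally show "\<bar>pderivs bs (u t) x - pderivs bs \<Phi> x - t * pderivs bs v x\<bar> \<le> \<epsilon> * \<bar>t\<bar>" unfolding pf by simp
    qed
  qed
  show ?thesis
  proof (intro exI[of _ v] conjI)
    show "holder_on 2 \<alpha> \<Omega> v" by (rule vh)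
    show "u 0 = restrict \<Phi> (closure \<Omega>)" unfolding u \<eta>0 by (rule S\<phi>)
    show "\<exists>t0>0. \<forall>t. \<bar>t\<bar> < t0 \<longrightarrow> restrict (\<lambda>x. \<Phi> x + t * w x) (frontier \<Omega>) \<in> bdry_ball \<Omega> \<alpha> (restrict \<Phi> (frontier \<Omega>)) \<delta> \<and>
        holder_on 2 \<alpha> \<Omega> (u t) \<and> MA_solution \<Omega> a (\<lambda>x. \<Phi> x + t * w x) (u t)"
    proof (intro exI[of _ "\<delta> / (C + 1)"] conjI allI impI)
      show "0 < \<delta> / (C + 1)" using \<delta> C0 by simp
      fix t assume "\<bar>t\<bar> < \<delta> / (C + 1)"
      note s = small[OF this \<delta>]
      show "restrict (\<lambda>x. \<Phi> x + t * w x) (frontier \<Omega>) \<in> bdry_ball \<Omega> \<alpha> (restrict \<Phi> (frontier \<Omega>)) \<delta>"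
        using sol(3)[OF s] unfolding \<eta>_def .
      show "holder_on 2 \<alpha> \<Omega> (u t)" by (rule sol(1)[OF s])
      show "MA_solution \<Omega> a (\<lambda>x. \<Phi> x + t * w x) (u t)" by (rule sol(2)[OF s])
    qed
  next
    show "\<forall>\<epsilon>>0. \<exists>r>0. \<forall>t. \<bar>t\<bar> < r \<longrightarrow> (\<forall>j\<le>2. \<forall>bs\<in>directions j. \<forall>x\<in>\<Omega>.
        \<bar>pderivs bs (u t) x - pderivs bs \<Phi> x - t * pderivs bs v x\<bar> \<le> \<epsilon> * \<bar>t\<bar>)"
      by (intro allI impI) (rule exp)
  qed
qed

end

lemma le_mult_epsilon_imp_le_zero:
  fixes c K :: real
  assumes "\<And>\<epsilon>. \<epsilon> > 0 \<Longrightarrow> c \<le> K * \<epsilon>"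
  shows "c \<le> 0"
proof (rule field_le_epsilon)
  fix e :: real assume e: "e > 0"
  have "c \<le> K * (e / (\<bar>K\<bar> + 1))" using e by (intro assms) auto
  also have "\<dots> \<le> \<bar>K\<bar> * (e / (\<bar>K\<bar> + 1))" using e by (intro mult_right_mono) auto
  also have "\<dots> \<le> e" using e by (simp add: field_simps)
  finally show "c \<le> 0 + e" by simp
qed

lemma DERIV_of_linear_approximation:
  fixes G :: "real \<Rightarrow> real"
  assumes "\<And>\<epsilon>. \<epsilon> > 0 \<Longrightarrow> \<exists>r>0. \<forall>t. \<bar>t\<bar> < r \<longrightarrow> \<bar>G t - G 0 - t * D\<bar> \<le> \<epsilon> * \<bar>t\<bar>"
  shows "(G has_real_derivative D) (at 0)"
  unfolding DERIV_def
proof (rule LIM_I)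
  fix e :: real assume e: "0 < e"
  obtain r where r: "r > 0" "\<And>t. \<bar>t\<bar> < r \<Longrightarrow> \<bar>G t - G 0 - t * D\<bar> \<le> e / 2 * \<bar>t\<bar>"
    using assms[of "e / 2"] e by auto
  show "\<exists>s>0. \<forall>h. h \<noteq> 0 \<and> norm (h - 0) < s \<longrightarrow> norm ((G (0 + h) - G 0) / h - D) < e"
  proof (intro exI[of _ r] conjI allI impI)
    fix h :: real assume h: "h \<noteq> 0 \<and> norm (h - 0) < r"
    have "(G (0 + h) - G 0) / h - D = (G h - G 0 - h * D) / h" using h by (simp add: field_simps)
    then have "\<bar>(G (0 + h) - G 0) / h - D\<bar> = \<bar>G h - G 0 - h * D\<bar> / \<bar>h\<bar>" by (simp add: abs_divide)
    also have "\<dots> \<le> e / 2" using r(2)[of h] h by (simp add: divide_le_eq)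
    finally show "norm ((G (0 + h) - G 0) / h - D) < e" using e by simp
  qed (use r in simp)
qed

context
  fixes \<Omega> :: "(real^'n) set" and \<alpha> :: real
  assumes op: "open \<Omega>" and ne: "\<Omega> \<noteq> {}" and \<alpha>: "0 < \<alpha>" "\<alpha> < 1" and bd: "bounded \<Omega>"
begin

lemma tendsto_frontier_value:
  assumes "holder_on 2 \<alpha> \<Omega> u" "z \<in> frontier \<Omega>"
  shows "(u \<longlongrightarrow> u z) (at z within \<Omega>)"
proof -
  have "z \<in> closure \<Omega>" using assms(2) by (simp add: frontier_def)
  then show ?thesis
    using holder_onD(1)[OF assms(1)] closure_subset[of \<Omega>] unfolding continuous_on_def
    by (meson tendsto_within_subset)
qed

text \<open>At a fixed interior point the equation is differentiated at t = 0. On the left the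
  Hessian of \<open>quadratic\<close> is the identity, which leaves the trace; on the right the
  chain rule involves z alone, because \<open>a\<close> does not see the gradient. Boundary values
  follow from the expansion of order 0, passed to the closure.\<close>

lemma linearised_equation:
  fixes a :: "(real^'n) \<times> real \<times> (real^'n) \<Rightarrow> real"
  assumes a: "holder_on 1 \<alpha> (\<Omega> \<times> UNIV \<times> UNIV) a"
    and indep: "\<And>x z p. x \<in> \<Omega> \<Longrightarrow> a (x, z, p) = a (x, z, 0)"
    and v: "holder_on 2 \<alpha> \<Omega> v" and u0: "u 0 = restrict quadratic (closure \<Omega>)"
    and t0: "t0 > 0" "\<And>t. \<bar>t\<bar> < t0 \<Longrightarrow> holder_on 2 \<alpha> \<Omega> (u t) \<and> MA_solution \<Omega> a (\<lambda>x. quadratic x + t * w x) (u t)"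
    and exp: "\<And>\<epsilon>. \<epsilon> > 0 \<Longrightarrow> \<exists>r>0. \<forall>t. \<bar>t\<bar> < r \<longrightarrow> (\<forall>j\<le>2. \<forall>bs\<in>directions j. \<forall>x\<in>\<Omega>.
        \<bar>pderivs bs (u t) x - pderivs bs quadratic x - t * pderivs bs v x\<bar> \<le> \<epsilon> * \<bar>t\<bar>)"
  shows "x \<in> frontier \<Omega> \<Longrightarrow> v x = w x"
    and "x \<in> \<Omega> \<Longrightarrow> laplacian v x = partial_z a x (quadratic x) 0 * v x"
proof -
  have Qh: "holder_on 2 \<alpha> \<Omega> quadratic" by (rule quadratic_holder(1)[OF \<alpha> op bd])
  {
    assume x: "x \<in> frontier \<Omega>"
    then have xc: "x \<in> closure \<Omega>" by (simp add: frontier_def)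
    have "\<bar>w x - v x\<bar> \<le> 1 * \<epsilon>" if \<epsilon>: "\<epsilon> > 0" for \<epsilon>
    proof -
      obtain r where r: "r > 0" and r': "\<forall>t. \<bar>t\<bar> < r \<longrightarrow> (\<forall>j\<le>2. \<forall>bs\<in>directions j. \<forall>x\<in>\<Omega>.
        \<bar>pderivs bs (u t) x - pderivs bs quadratic x - t * pderivs bs v x\<bar> \<le> \<epsilon> * \<bar>t\<bar>)"
        using exp[OF \<epsilon>] by (elim exE conjE) (rule that)
      define t where "t = min r t0 / 2"
      have t: "0 < t" "\<bar>t\<bar> < r" "\<bar>t\<bar> < t0" using r t0(1) by (auto simp: t_def)
      \<comment> \<open>The expansion is given on \<open>\<Omega>\<close> only; continuity carries
        it to the frontier point, where \<open>u t\<close> is prescribed.\<close>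
      have "norm (u t x - quadratic x - t * v x) \<le> \<epsilon> * t"
      proof (rule continuous_on_closure_norm_le[OF _ _ xc])
        show "continuous_on (closure \<Omega>) (\<lambda>x. u t x - quadratic x - t * v x)"
          using t0(2)[OF t(3)] v Qh by (intro continuous_intros holder_onD(1)) auto
        show "\<forall>y\<in>\<Omega>. norm (u t y - quadratic y - t * v y) \<le> \<epsilon> * t"
          using r'[rule_format, OF t(2), of 0 "[]"] t(1) by simp
      qed
      moreover have "u t x = quadratic x + t * w x" using t0(2)[OF t(3)] x by (simp add: MA_solution_def)
      ultimately have "\<bar>t * (w x - v x)\<bar> \<le> \<epsilon> * t" by (simp add: algebra_simps)
      then show ?thesis using t(1) by (simp add: abs_mult)
    qed
    from le_mult_epsilon_imp_le_zero[OF this] show "v x = w x" by simp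
  }
  {
    assume x: "x \<in> \<Omega>"
    then have xc: "x \<in> closure \<Omega>" using closure_subset by blast
    have u0': "pderivs bs (u 0) x = pderivs bs quadratic x" for bs
    proof (rule pderivs_cong[OF op _ x])
      fix y assume "y \<in> \<Omega>"
      then have "y \<in> closure \<Omega>" using closure_subset by blast
      then show "u 0 y = quadratic y" by (simp add: u0)
    qed
    have dG: "((\<lambda>t. pderivs bs (u t) x) has_real_derivative pderivs bs v x) (at 0)" if "j \<le> 2" "bs \<in> directions j" for j bs
    proof (rule DERIV_of_linear_approximation)
      fix \<epsilon> :: real assume "\<epsilon> > 0"
      from exp[OF this] show "\<exists>r>0. \<forall>t. \<bar>t\<bar> < r \<longrightarrow> \<bar>pderivs bs (u t) x - pderivs bs (u 0) x - t * pderivs bs v x\<bar> \<le> \<epsilon> * \<bar>t\<bar>"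
        unfolding u0' using that x by (elim exE conjE) (rule exI, rule conjI, assumption, simp)
    qed
    have "((\<lambda>t. det (hessian (u t) x)) has_real_derivative (\<Sum>i\<in>UNIV. pderivs [axis i 1, axis i 1] v x)) (at 0)"
    proof (rule det_has_derivative_at_identity[where B="\<lambda>i j. pderivs [axis i 1, axis j 1] v x"])
      show "((\<lambda>t. hessian (u t) x $ i $ j) has_real_derivative pderivs [axis i 1, axis j 1] v x) (at 0)" for i j
        using dG[of 2 "[axis i 1, axis j 1]"] by (simp add: hessian_def)
      show "hessian (u 0) x = mat 1"
        unfolding vec_eq_iff hessian_def using quadratic_holder(2)[OF \<alpha> op bd, of "axis _ 1" "axis _ 1"]
        by (simp add: u0' mat_def Basis_vec_real inner_axis_axis)
    qed
    then have d1: "((\<lambda>t. det (hessian (u t) x)) has_real_derivative laplacian v x) (at 0)"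
      by (simp add: laplacian_eq_trace hessian_def)
    have "((\<lambda>z. a (x, z, 0)) has_real_derivative partial_z a x (quadratic x) 0) (at (u 0 x))"
      using partial_z_eq[OF a x, where p=0 and z="quadratic x"] xc by (simp add: u0)
    moreover have "((\<lambda>t. u t x) has_real_derivative v x) (at 0)" using dG[of 0 "[]"] by simp
    ultimately have d2: "((\<lambda>t. a (x, u t x, 0)) has_real_derivative partial_z a x (quadratic x) 0 * v x) (at 0)"
      by (rule DERIV_chain2)
    have "((\<lambda>t. det (hessian (u t) x)) has_real_derivative partial_z a x (quadratic x) 0 * v x) (at 0)"
    proof (rule has_field_derivative_transform_within_open[OF d2 open_ball[of 0 t0]])
      fix t :: real assume "t \<in> ball 0 t0"
      then have "MA_solution \<Omega> a (\<lambda>x. quadratic x + t * w x) (u t)" using t0(2)[of t] by simp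
      then have "det (hessian (u t) x) = a (x, u t x, grad (u t) x)" using x by (simp add: MA_solution_def)
      then show "a (x, u t x, 0) = det (hessian (u t) x)" using indep[OF x, of "u t x" "grad (u t) x"] by simp
    qed (use t0 in simp)
    with d1 show "laplacian v x = partial_z a x (quadratic x) 0 * v x" by (rule DERIV_unique)
  }
qed

text \<open>For one small t all four gradients have limits at \<open>x0\<close>, so the difference
  of the two uniform expansions can be passed to the boundary. Paired with the normal, the nonlinear
  terms cancel; dividing by t leaves a multiple of \<epsilon>.\<close>

lemma linearised_normal_derivative:
  assumes v1: "holder_on 2 \<alpha> \<Omega> v1" and v2: "holder_on 2 \<alpha> \<Omega> v2"
    and t0: "t0 > 0" "\<And>t. \<bar>t\<bar> < t0 \<Longrightarrow> holder_on 2 \<alpha> \<Omega> (u1 t) \<and> holder_on 2 \<alpha> \<Omega> (u2 t) \<and>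
        normal_deriv \<Omega> (u1 t) x0 = normal_deriv \<Omega> (u2 t) x0"
    and exp1: "\<And>\<epsilon>. \<epsilon> > 0 \<Longrightarrow> \<exists>r>0. \<forall>t. \<bar>t\<bar> < r \<longrightarrow> (\<forall>j\<le>2. \<forall>bs\<in>directions j. \<forall>x\<in>\<Omega>.
        \<bar>pderivs bs (u1 t) x - pderivs bs \<Phi> x - t * pderivs bs v1 x\<bar> \<le> \<epsilon> * \<bar>t\<bar>)"
    and exp2: "\<And>\<epsilon>. \<epsilon> > 0 \<Longrightarrow> \<exists>r>0. \<forall>t. \<bar>t\<bar> < r \<longrightarrow> (\<forall>j\<le>2. \<forall>bs\<in>directions j. \<forall>x\<in>\<Omega>.
        \<bar>pderivs bs (u2 t) x - pderivs bs \<Phi> x - t * pderivs bs v2 x\<bar> \<le> \<epsilon> * \<bar>t\<bar>)"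
    and x0: "x0 \<in> frontier \<Omega>"
    and g1: "(gradient v1 \<longlongrightarrow> g1) (at x0 within \<Omega>)" and g2: "(gradient v2 \<longlongrightarrow> g2) (at x0 within \<Omega>)"
  shows "(g1 - g2) \<bullet> outer_normal \<Omega> x0 = 0"
proof -
  let ?\<nu> = "outer_normal \<Omega> x0"
  have "\<bar>(g1 - g2) \<bullet> ?\<nu>\<bar> \<le> (2 * DIM(real^'n) * norm ?\<nu>) * \<epsilon>" if \<epsilon>: "\<epsilon> > 0" for \<epsilon>
  proof -
    obtain r1 where r1: "r1 > 0" and r1': "\<forall>t. \<bar>t\<bar> < r1 \<longrightarrow> (\<forall>j\<le>2. \<forall>bs\<in>directions j. \<forall>x\<in>\<Omega>.
        \<bar>pderivs bs (u1 t) x - pderivs bs \<Phi> x - t * pderivs bs v1 x\<bar> \<le> \<epsilon> * \<bar>t\<bar>)"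
      using exp1[OF \<epsilon>] by (elim exE conjE) (rule that)
    obtain r2 where r2: "r2 > 0" and r2': "\<forall>t. \<bar>t\<bar> < r2 \<longrightarrow> (\<forall>j\<le>2. \<forall>bs\<in>directions j. \<forall>x\<in>\<Omega>.
        \<bar>pderivs bs (u2 t) x - pderivs bs \<Phi> x - t * pderivs bs v2 x\<bar> \<le> \<epsilon> * \<bar>t\<bar>)"
      using exp2[OF \<epsilon>] by (elim exE conjE) (rule that)
    define t where "t = min (min r1 r2) t0 / 2"
    have t: "0 < t" "\<bar>t\<bar> < r1" "\<bar>t\<bar> < r2" "\<bar>t\<bar> < t0" using r1 r2 t0(1) by (auto simp: t_def)
    note H = t0(2)[OF t(4)]
    obtain G1 G2 where G1: "(gradient (u1 t) \<longlongrightarrow> G1) (at x0 within \<Omega>)" and G2: "(gradient (u2 t) \<longlongrightarrow> G2) (at x0 within \<Omega>)"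
      using gradient_limit[OF op ne _ x0] H by blast
    have eq: "(G1 - G2) \<bullet> ?\<nu> = 0"
      using H normal_deriv_eq[OF op ne G1 x0] normal_deriv_eq[OF op ne G2 x0] by (simp add: inner_diff_left)
    define f where "f x = gradient (u1 t) x - gradient (u2 t) x - t *\<^sub>R (gradient v1 x - gradient v2 x)" for x
    have fl: "(f \<longlongrightarrow> G1 - G2 - t *\<^sub>R (g1 - g2)) (at x0 within \<Omega>)"
      unfolding f_def by (intro tendsto_intros G1 G2 g1 g2)
    have fb: "norm (f x) \<le> DIM(real^'n) * (2 * \<epsilon> * t)" if x: "x \<in> \<Omega>" for x
    proof -
      have "norm (f x) = norm (\<Sum>b\<in>Basis. (pderivs [b] (u1 t) x - pderivs [b] (u2 t) x - t * (pderivs [b] v1 x - pderivs [b] v2 x)) *\<^sub>R b)"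
        by (simp add: f_def gradient_def scaleR_diff_left sum_subtractf scaleR_sum_right scaleR_diff_right right_diff_distrib)
      also have "\<dots> \<le> (\<Sum>b\<in>(Basis::(real^'n) set). 2 * \<epsilon> * t)"
      proof (rule order_trans[OF norm_sum sum_mono])
        fix b :: "real^'n" assume b: "b \<in> Basis"
        then have bd: "[b] \<in> directions 1" by (simp add: directions_def)
        have "\<bar>pderivs [b] (u1 t) x - pderivs [b] \<Phi> x - t * pderivs [b] v1 x\<bar> \<le> \<epsilon> * t"
          "\<bar>pderivs [b] (u2 t) x - pderivs [b] \<Phi> x - t * pderivs [b] v2 x\<bar> \<le> \<epsilon> * t"
          using r1'[rule_format, OF t(2) _ bd x] r2'[rule_format, OF t(3) _ bd x] t(1) by simp_all
        then have "\<bar>pderivs [b] (u1 t) x - pderivs [b] (u2 t) x - t * (pderivs [b] v1 x - pderivs [b] v2 x)\<bar> \<le> 2 * \<epsilon> * t"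
          unfolding right_diff_distrib by linarith
        then show "norm ((pderivs [b] (u1 t) x - pderivs [b] (u2 t) x - t * (pderivs [b] v1 x - pderivs [b] v2 x)) *\<^sub>R b) \<le> 2 * \<epsilon> * t"
          using b by simp
      qed
      finally show ?thesis by simp
    qed
    have "norm (G1 - G2 - t *\<^sub>R (g1 - g2)) \<le> DIM(real^'n) * (2 * \<epsilon> * t)"
      by (rule Lim_norm_ubound[OF at_within_frontier_nontrivial[OF op ne x0] fl])
         (use fb in \<open>auto simp: eventually_at_filter\<close>)
    then have "\<bar>(G1 - G2 - t *\<^sub>R (g1 - g2)) \<bullet> ?\<nu>\<bar> \<le> (DIM(real^'n) * (2 * \<epsilon> * t)) * norm ?\<nu>"
      by (intro order_trans[OF Cauchy_Schwarz_ineq2] mult_right_mono) auto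
    moreover have "(G1 - G2 - t *\<^sub>R (g1 - g2)) \<bullet> ?\<nu> = - (t * ((g1 - g2) \<bullet> ?\<nu>))"
      using eq by (simp add: inner_diff_left)
    ultimately have "t * \<bar>(g1 - g2) \<bullet> ?\<nu>\<bar> \<le> t * ((2 * DIM(real^'n) * norm ?\<nu>) * \<epsilon>)"
      using t(1) by (simp add: abs_mult mult_ac)
    then show ?thesis using t(1) by simp
  qed
  from le_mult_epsilon_imp_le_zero[OF this] show ?thesis by simp
qed

lemma gradient_has_derivative:
  assumes "holder_on 2 \<alpha> \<Omega> u" "x \<in> \<Omega>"
  shows "(u has_derivative (\<lambda>h. h \<bullet> gradient u x)) (at x)"
proof -
  have "(u has_derivative (\<lambda>h. \<Sum>b\<in>Basis. (h \<bullet> b) * pderivs [b] u x)) (at x)"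
    using pderivs_has_derivative[of "[]" u x] holder_onD(2)[OF assms(1), of 0 "[]" x] assms(2) by simp
  then show ?thesis by (simp add: gradient_def inner_sum_right mult.commute)
qed

text \<open>Besides \<open>v1\<close> and \<open>v2\<close> there is an auxiliary \<open>v\<close>,
  which solves the first equation with the boundary values of \<open>v2\<close>. Linearised,
  equality of the Cauchy data says that z = v - v2 has zero Cauchy data. In Green's formula for z
  and \<open>v1\<close> the terms containing \<open>v\<close> cancel, leaving (q1 - q2) v1
  v2.\<close>

lemma linearised_orthogonality:
  fixes a1 a2 :: "(real^'n) \<times> real \<times> (real^'n) \<Rightarrow> real"
  assumes hb: "holder_boundary 2 \<alpha> \<Omega>"
    and a1: "holder_on 1 \<alpha> (\<Omega> \<times> UNIV \<times> UNIV) a1" and a2: "holder_on 1 \<alpha> (\<Omega> \<times> UNIV \<times> UNIV) a2"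
    and indep1: "\<forall>x\<in>\<Omega>. \<forall>z p. a1 (x, z, p) = a1 (x, z, 0)" and indep2: "\<forall>x\<in>\<Omega>. \<forall>z p. a2 (x, z, p) = a2 (x, z, 0)"
    and wp1: "well_posed \<Omega> \<alpha> a1 quadratic \<delta>1 V1" and wp2: "well_posed \<Omega> \<alpha> a2 quadratic \<delta>2 V2"
    and cd: "cauchy_data \<Omega> \<alpha> a1 quadratic \<delta>1 V1 = cauchy_data \<Omega> \<alpha> a2 quadratic \<delta>2 V2"
    and w1: "holder_on 2 \<alpha> \<Omega> w1" and w2: "holder_on 2 \<alpha> \<Omega> w2"
  shows "\<exists>v1 v2. holder_on 2 \<alpha> \<Omega> v1 \<and> holder_on 2 \<alpha> \<Omega> v2 \<and>
     (\<forall>x\<in>frontier \<Omega>. v1 x = w1 x \<and> v2 x = w2 x) \<and>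
     (\<forall>x\<in>\<Omega>. laplacian v1 x = partial_z a1 x (quadratic x) 0 * v1 x \<and> laplacian v2 x = partial_z a2 x (quadratic x) 0 * v2 x) \<and>
     (LINT x:\<Omega>|lborel. (partial_z a1 x (quadratic x) 0 - partial_z a2 x (quadratic x) 0) * (v1 x * v2 x)) = 0"
proof -
  let ?q1 = "\<lambda>x. partial_z a1 x (quadratic x) 0" and ?q2 = "\<lambda>x. partial_z a2 x (quadratic x) 0"
  define \<eta> where "\<eta> w t = restrict (\<lambda>x. quadratic x + t * w x) (frontier \<Omega>)" for w t
  have ex: "\<exists>v t0. holder_on 2 \<alpha> \<Omega> v \<and> t0 > 0 \<and>
      (\<forall>t. \<bar>t\<bar> < t0 \<longrightarrow> \<eta> w t \<in> bdry_ball \<Omega> \<alpha> (restrict quadratic (frontier \<Omega>)) \<delta> \<and> holder_on 2 \<alpha> \<Omega> (solution_in \<Omega> a V (\<eta> w t))) \<and>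
      (\<forall>\<epsilon>>0. \<exists>r>0. \<forall>t. \<bar>t\<bar> < r \<longrightarrow> (\<forall>j\<le>2. \<forall>bs\<in>directions j. \<forall>x\<in>\<Omega>.
        \<bar>pderivs bs (solution_in \<Omega> a V (\<eta> w t)) x - pderivs bs quadratic x - t * pderivs bs v x\<bar> \<le> \<epsilon> * \<bar>t\<bar>)) \<and>
      (\<forall>x\<in>frontier \<Omega>. v x = w x) \<and> (\<forall>x\<in>\<Omega>. laplacian v x = partial_z a x (quadratic x) 0 * v x)"
    if a: "holder_on 1 \<alpha> (\<Omega> \<times> UNIV \<times> UNIV) a" and indep: "\<forall>x\<in>\<Omega>. \<forall>z p. a (x, z, p) = a (x, z, 0)"
      and wp: "well_posed \<Omega> \<alpha> a quadratic \<delta> V" and w: "holder_on 2 \<alpha> \<Omega> w"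
    for a :: "(real^'n) \<times> real \<times> (real^'n) \<Rightarrow> real" and \<delta> V w
  proof -
    obtain v t0 where v: "holder_on 2 \<alpha> \<Omega> v" and u0: "solution_in \<Omega> a V (\<eta> w 0) = restrict quadratic (closure \<Omega>)"
      and t0: "t0 > 0" and sol: "\<forall>t. \<bar>t\<bar> < t0 \<longrightarrow> \<eta> w t \<in> bdry_ball \<Omega> \<alpha> (restrict quadratic (frontier \<Omega>)) \<delta> \<and>
        holder_on 2 \<alpha> \<Omega> (solution_in \<Omega> a V (\<eta> w t)) \<and> MA_solution \<Omega> a (\<lambda>x. quadratic x + t * w x) (solution_in \<Omega> a V (\<eta> w t))"
      and exp: "\<forall>\<epsilon>>0. \<exists>r>0. \<forall>t. \<bar>t\<bar> < r \<longrightarrow> (\<forall>j\<le>2. \<forall>bs\<in>directions j. \<forall>x\<in>\<Omega>.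
        \<bar>pderivs bs (solution_in \<Omega> a V (\<eta> w t)) x - pderivs bs quadratic x - t * pderivs bs v x\<bar> \<le> \<epsilon> * \<bar>t\<bar>)"
      using solution_expansion[OF op ne \<alpha> bd refl wp w] unfolding \<eta>_def[symmetric]
      by (elim exE conjE) (rule that)
    have s: "holder_on 2 \<alpha> \<Omega> (solution_in \<Omega> a V (\<eta> w t)) \<and> MA_solution \<Omega> a (\<lambda>x. quadratic x + t * w x) (solution_in \<Omega> a V (\<eta> w t))"
      if "\<bar>t\<bar> < t0" for t using sol that by blast
    note L = linearised_equation[where u="\<lambda>t. solution_in \<Omega> a V (\<eta> w t)", OF a indep[rule_format] v u0 t0 s exp[rule_format]]
    have L1: "v x = w x" if "x \<in> frontier \<Omega>" for x by (rule L(1)) (assumption | rule that)+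
    have L2: "laplacian v x = partial_z a x (quadratic x) 0 * v x" if "x \<in> \<Omega>" for x by (rule L(2)) (assumption | rule that)+
    show ?thesis
      by (rule exI[of _ v], rule exI[of _ t0]) (use v t0 sol exp L1 L2 in simp)
  qed
  obtain v1 where v1: "holder_on 2 \<alpha> \<Omega> v1" "\<forall>x\<in>frontier \<Omega>. v1 x = w1 x" "\<forall>x\<in>\<Omega>. laplacian v1 x = ?q1 x * v1 x"
    using ex[OF a1 indep1 wp1 w1] by (elim exE conjE) (rule that)
  obtain v t1 where v: "holder_on 2 \<alpha> \<Omega> v" and t1: "t1 > 0"
    and s1: "\<forall>t. \<bar>t\<bar> < t1 \<longrightarrow> \<eta> w2 t \<in> bdry_ball \<Omega> \<alpha> (restrict quadratic (frontier \<Omega>)) \<delta>1 \<and> holder_on 2 \<alpha> \<Omega> (solution_in \<Omega> a1 V1 (\<eta> w2 t))"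
    and e1: "\<forall>\<epsilon>>0. \<exists>r>0. \<forall>t. \<bar>t\<bar> < r \<longrightarrow> (\<forall>j\<le>2. \<forall>bs\<in>directions j. \<forall>x\<in>\<Omega>.
        \<bar>pderivs bs (solution_in \<Omega> a1 V1 (\<eta> w2 t)) x - pderivs bs quadratic x - t * pderivs bs v x\<bar> \<le> \<epsilon> * \<bar>t\<bar>)"
    and vb: "\<forall>x\<in>frontier \<Omega>. v x = w2 x" and vl: "\<forall>x\<in>\<Omega>. laplacian v x = ?q1 x * v x"
    using ex[OF a1 indep1 wp1 w2] by (elim exE conjE) (rule that)
  obtain v2 t2 where v2: "holder_on 2 \<alpha> \<Omega> v2" and t2: "t2 > 0"
    and s2: "\<forall>t. \<bar>t\<bar> < t2 \<longrightarrow> \<eta> w2 t \<in> bdry_ball \<Omega> \<alpha> (restrict quadratic (frontier \<Omega>)) \<delta>2 \<and> holder_on 2 \<alpha> \<Omega> (solution_in \<Omega> a2 V2 (\<eta> w2 t))"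
    and e2: "\<forall>\<epsilon>>0. \<exists>r>0. \<forall>t. \<bar>t\<bar> < r \<longrightarrow> (\<forall>j\<le>2. \<forall>bs\<in>directions j. \<forall>x\<in>\<Omega>.
        \<bar>pderivs bs (solution_in \<Omega> a2 V2 (\<eta> w2 t)) x - pderivs bs quadratic x - t * pderivs bs v2 x\<bar> \<le> \<epsilon> * \<bar>t\<bar>)"
    and v2b: "\<forall>x\<in>frontier \<Omega>. v2 x = w2 x" and v2l: "\<forall>x\<in>\<Omega>. laplacian v2 x = ?q2 x * v2 x"
    using ex[OF a2 indep2 wp2 w2] by (elim exE conjE) (rule that)
  \<comment> \<open>The boundary value is the first component of each pair, so it singles out the
    matching element of the other set, although radii and neighbourhoods may differ.\<close>
  have nd: "normal_deriv \<Omega> (solution_in \<Omega> a1 V1 \<eta>) x0 = normal_deriv \<Omega> (solution_in \<Omega> a2 V2 \<eta>) x0"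
    if b: "\<eta> \<in> bdry_ball \<Omega> \<alpha> (restrict quadratic (frontier \<Omega>)) \<delta>1" and x0: "x0 \<in> frontier \<Omega>" for \<eta> x0
  proof -
    have "(\<eta>, restrict (normal_deriv \<Omega> (solution_in \<Omega> a1 V1 \<eta>)) (frontier \<Omega>)) \<in> cauchy_data \<Omega> \<alpha> a1 quadratic \<delta>1 V1"
      unfolding cauchy_data_def using b by (rule imageI)
    then have "restrict (normal_deriv \<Omega> (solution_in \<Omega> a1 V1 \<eta>)) (frontier \<Omega>) = restrict (normal_deriv \<Omega> (solution_in \<Omega> a2 V2 \<eta>)) (frontier \<Omega>)"
      unfolding cd unfolding cauchy_data_def by auto
    from fun_cong[OF this, of x0] show ?thesis using x0 by simp
  qed
  define z where "z x = v x + (-1) * v2 x" for x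
  have zh: "holder_on 2 \<alpha> \<Omega> z" unfolding z_def by (rule holder_on_lincomb[OF op v v2])
  have zp: "pderivs bs z x = pderivs bs v x - pderivs bs v2 x" if "j \<le> 2" "bs \<in> directions j" "x \<in> \<Omega>" for j bs x
    unfolding z_def pderivs_holder_lincomb(1)[OF op v v2 that] by simp
  have z0: "(z \<longlongrightarrow> 0) (at x0 within \<Omega>)" if "x0 \<in> frontier \<Omega>" for x0
    using tendsto_frontier_value[OF zh that] vb v2b that by (simp add: z_def)
  have zg: "gradient z x = gradient v x - gradient v2 x" if "x \<in> \<Omega>" for x
  proof -
    have "pderivs [b] z x = pderivs [b] v x - pderivs [b] v2 x" if "b \<in> Basis" for b
      using zp[of 1 "[b]" x] that \<open>x \<in> \<Omega>\<close> by (simp add: directions_def)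
    then show ?thesis by (simp add: gradient_def sum_subtractf scaleR_diff_left)
  qed
  have dz0: "(gradient z \<longlongrightarrow> 0) (at x0 within \<Omega>)" if x0: "x0 \<in> frontier \<Omega>" for x0
  proof -
    obtain g1 g2 where g1: "(gradient v \<longlongrightarrow> g1) (at x0 within \<Omega>)" and g2: "(gradient v2 \<longlongrightarrow> g2) (at x0 within \<Omega>)"
      using gradient_limit[OF op ne v x0] gradient_limit[OF op ne v2 x0] by blast
    have t12: "min t1 t2 > 0" using t1 t2 by simp
    have s: "holder_on 2 \<alpha> \<Omega> (solution_in \<Omega> a1 V1 (\<eta> w2 t)) \<and> holder_on 2 \<alpha> \<Omega> (solution_in \<Omega> a2 V2 (\<eta> w2 t)) \<and>
        normal_deriv \<Omega> (solution_in \<Omega> a1 V1 (\<eta> w2 t)) x0 = normal_deriv \<Omega> (solution_in \<Omega> a2 V2 (\<eta> w2 t)) x0"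
      if "\<bar>t\<bar> < min t1 t2" for t
      using s1 s2 that nd[OF _ x0] by auto
    have orth: "(g1 - g2) \<bullet> outer_normal \<Omega> x0 = 0"
      by (rule linearised_normal_derivative[where ?u1.0="\<lambda>t. solution_in \<Omega> a1 V1 (\<eta> w2 t)"
            and ?u2.0="\<lambda>t. solution_in \<Omega> a2 V2 (\<eta> w2 t)", OF v v2 t12 s e1[rule_format] e2[rule_format] x0 g1 g2])
    have "((\<lambda>x. gradient v x - gradient v2 x) \<longlongrightarrow> g1 - g2) (at x0 within \<Omega>)" by (intro tendsto_intros g1 g2)
    moreover have "\<forall>\<^sub>F x in at x0 within \<Omega>. gradient v x - gradient v2 x = gradient z x"
      using zg by (auto simp: eventually_at_filter)
    ultimately have zl: "(gradient z \<longlongrightarrow> g1 - g2) (at x0 within \<Omega>)" by (rule Lim_transform_eventually)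
    \<comment> \<open>Linearised data control only the normal component; the tangential ones vanish
      because z is 0 along the boundary.\<close>
    have "g1 - g2 = 0"
      by (rule boundary_gradient_zero[OF op hb x0 gradient_has_derivative[OF zh] z0 zl orth])
    then show ?thesis using zl by simp
  qed
  have neg: "negligible (frontier \<Omega>)" by (rule negligible_frontier[OF op bd hb])
  have "(LINT x:\<Omega>|lborel. v1 x * laplacian z x - z x * laplacian v1 x) = 0"
    by (rule green_zero[OF op bd neg zh v1(1) z0 dz0])
  moreover have "(LINT x:\<Omega>|lborel. v1 x * laplacian z x - z x * laplacian v1 x) = (LINT x:\<Omega>|lborel. (?q1 x - ?q2 x) * (v1 x * v2 x))"
  proof (rule set_lebesgue_integral_cong)
    show "\<forall>x. x \<in> \<Omega> \<longrightarrow> v1 x * laplacian z x - z x * laplacian v1 x = (?q1 x - ?q2 x) * (v1 x * v2 x)"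
    proof (intro allI impI)
      fix x assume x: "x \<in> \<Omega>"
      have "laplacian z x = laplacian v x - laplacian v2 x"
        using zp[of 2 "[_, _]" x] x by (simp add: laplacian_def sum_subtractf directions_def)
      also have "\<dots> = ?q1 x * v x - ?q2 x * v2 x" using vl v2l x by simp
      finally have lz: "laplacian z x = ?q1 x * v x - ?q2 x * v2 x" .
      have "laplacian v1 x = ?q1 x * v1 x" using v1(3) x by simp
      then show "v1 x * laplacian z x - z x * laplacian v1 x = (?q1 x - ?q2 x) * (v1 x * v2 x)"
        unfolding lz by (simp add: z_def algebra_simps)
    qed
  qed (use op in simp)
  ultimately have "(LINT x:\<Omega>|lborel. (?q1 x - ?q2 x) * (v1 x * v2 x)) = 0" by simp
  then show ?thesis using v1 v2 v2b v2l by (intro exI[of _ v1] exI[of _ v2]) simp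
qed

end

section \<open>Uniqueness of the potential in the linearised problem\<close>

definition complexify :: "real^'n \<Rightarrow> real^'n \<Rightarrow> complex^'n" where
  "complexify x y = (\<chi> i. Complex (x $ i) (y $ i))"

lemma cdot_complexify: "cdot (complexify x y) z = Complex (x \<bullet> z) (y \<bullet> z)"
  by (simp add: cdot_def complexify_def complex_eq_iff inner_vec_def)

lemma sum_squares_complexify:
  "(\<Sum>i\<in>UNIV. (complexify x y $ i)\<^sup>2) = Complex ((norm x)\<^sup>2 - (norm y)\<^sup>2) (2 * (x \<bullet> y))"
  by (simp add: complexify_def complex_eq_iff power2_eq_square inner_vec_def sum_subtractf sum.distrib sum_distrib_left
      power2_norm_eq_inner[unfolded power2_eq_square])

text \<open>The reason for a shift by half a step: half-integers keep distance 1/2 from 0.\<close>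

lemma abs_int_plus_half: "1 / 2 \<le> \<bar>real_of_int N + 1 / 2\<bar>"
proof (cases "N \<ge> 0")
  case False
  then have "real_of_int N \<le> -1" by linarith
  then show ?thesis by linarith
qed simp

text \<open>Two coordinates of \<open>k\<close> are rotated by a right angle, or a coordinate
  direction is taken in which \<open>k\<close> vanishes. Integrality matters: \<open>m\<close> then
  has integer inner products with the lattice.\<close>

lemma orthogonal_int_vec:
  fixes k :: "int^'n"
  assumes n: "CARD('n) \<ge> 2"
  shows "\<exists>m::int^'n. m \<noteq> 0 \<and> int_vec m \<bullet> int_vec k = 0"
proof -
  obtain i j :: 'n where ij: "i \<noteq> j"
    using n card_le_Suc0_iff_eq[of "UNIV :: 'n set"] by fastforce
  show ?thesis
  proof (cases "k $ i = 0")
    case True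
    have "int_vec (axis i 1) = (axis i 1 :: real^'n)" by (auto simp: vec_eq_iff axis_def int_vec_def)
    then show ?thesis using True by (intro exI[of _ "axis i 1"]) (auto simp: inner_axis' axis_eq_0_iff)
  next
    case False
    define m :: "int^'n" where "m = (\<chi> l. if l = i then k $ j else if l = j then - k $ i else 0)"
    have "m $ j \<noteq> 0" using False ij by (simp add: m_def)
    then have "m \<noteq> 0" by (metis zero_index)
    have "int_vec m \<bullet> int_vec k = (\<Sum>l\<in>UNIV. of_int (m $ l * k $ l))" by (simp add: inner_vec_def)
    also have "\<dots> = (\<Sum>l\<in>{i, j}. of_int (m $ l * k $ l))"
      by (rule sum.mono_neutral_right) (auto simp: m_def)
    also have "\<dots> = 0" using ij by (simp add: m_def)
    finally show ?thesis using \<open>m \<noteq> 0\<close> by blast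
  qed
qed

text \<open>The real part of \<open>\<zeta>\<close> points along an integer vector \<open>m\<close>, and the lattice is shifted by
  \<open>m / (2 |m|\<^sup>2)\<close>, so that it avoids the characteristic hyperplane orthogonal to \<open>m\<close>.\<close>

lemma cgo_frequencies:
  fixes k :: "int^'n"
  assumes n: "CARD('n) \<ge> 3" and \<omega>: "\<omega> > 0"
  shows "\<exists>\<theta> \<mu>. \<mu> > 0 \<and> (\<forall>\<rho>\<ge>norm (\<omega> *\<^sub>R int_vec k). \<exists>\<zeta>1 \<zeta>2 :: complex^'n.
     (\<Sum>i\<in>UNIV. (\<zeta>1 $ i)\<^sup>2) = 0 \<and> (\<Sum>i\<in>UNIV. (\<zeta>2 $ i)\<^sup>2) = 0 \<and>
     (\<forall>x. cdot \<zeta>1 x + cdot \<zeta>2 x = \<i> * of_real (\<omega> *\<^sub>R int_vec k \<bullet> x)) \<and>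
     (\<forall>l. \<mu> * \<rho> \<le> cmod (2 * \<i> * cdot \<zeta>1 (freq \<omega> \<theta> l) - of_real ((norm (freq \<omega> \<theta> l))\<^sup>2))) \<and>
     (\<forall>l. \<mu> * \<rho> \<le> cmod (2 * \<i> * cdot \<zeta>2 (freq \<omega> \<theta> l) - of_real ((norm (freq \<omega> \<theta> l))\<^sup>2))))"
proof -
  obtain m :: "int^'n" where m: "m \<noteq> 0" "int_vec m \<bullet> int_vec k = 0" using orthogonal_int_vec[of k] n by auto
  define mm where "mm = int_vec m"
  define \<xi> where "\<xi> = \<omega> *\<^sub>R int_vec k"
  have mm0: "mm \<noteq> 0" using m(1) by (auto simp: mm_def vec_eq_iff)
  have m\<xi>: "mm \<bullet> \<xi> = 0" using m(2) by (simp add: mm_def \<xi>_def)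
  \<comment> \<open>Dimension at least 3 is spent here, on a direction \<open>b\<close> orthogonal
    to both \<open>mm\<close> and \<open>\<xi>\<close>.\<close>
  have "dim {mm, \<xi>} \<le> card {mm, \<xi>}" by (rule dim_le_card') simp
  also have "\<dots> \<le> 2" by (simp add: card_insert_if)
  also have "\<dots> < DIM(real^'n)" using n by simp
  finally obtain b0 where b0: "b0 \<noteq> 0" "\<And>y. y \<in> span {mm, \<xi>} \<Longrightarrow> orthogonal b0 y"
    using orthogonal_to_subspace_exists[of "{mm, \<xi>}"] by auto
  define b where "b = b0 /\<^sub>R norm b0"
  have b: "norm b = 1" "mm \<bullet> b = 0" "\<xi> \<bullet> b = 0"
    using b0(1) b0(2)[OF span_base, of mm] b0(2)[OF span_base, of \<xi>]
    by (auto simp: b_def orthogonal_def inner_commute)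
  define a where "a = mm /\<^sub>R norm mm"
  have a: "norm a = 1" "a \<bullet> \<xi> = 0" "a \<bullet> b = 0" using mm0 m\<xi> b(2) by (auto simp: a_def)
  \<comment> \<open>Normalised so that \<open>mm \<bullet> \<theta> = 1 / 2\<close>: pairing
    \<open>mm\<close> with a point of the shifted lattice gives a half-integer, so the frequencies
    stay away from the hyperplane orthogonal to \<open>a\<close>.\<close>
  define \<theta> where "\<theta> = mm /\<^sub>R (2 * (norm mm)\<^sup>2)"
  have m\<theta>: "mm \<bullet> \<theta> = 1 / 2" using mm0 by (simp add: \<theta>_def power2_norm_eq_inner)
  have af: "\<omega> / (2 * norm mm) \<le> \<bar>a \<bullet> freq \<omega> \<theta> l\<bar>" for l
  proof -
    define S where "S = (\<Sum>i\<in>UNIV. m $ i * l $ i)"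
    have S: "mm \<bullet> int_vec l = real_of_int S" by (simp add: mm_def inner_vec_def S_def)
    have "a \<bullet> freq \<omega> \<theta> l = (\<omega> / norm mm) * (mm \<bullet> int_vec l + mm \<bullet> \<theta>)"
      unfolding a_def freq_def by (simp add: inner_add_right divide_inverse mult_ac distrib_left)
    then have "a \<bullet> freq \<omega> \<theta> l = (\<omega> / norm mm) * (real_of_int S + 1 / 2)"
      by (simp only: S m\<theta>)
    then have "\<bar>a \<bullet> freq \<omega> \<theta> l\<bar> = (\<omega> / norm mm) * \<bar>real_of_int S + 1 / 2\<bar>"
      using \<omega> by (simp only: abs_mult) simp
    moreover have "(\<omega> / norm mm) * (1 / 2) \<le> (\<omega> / norm mm) * \<bar>real_of_int S + 1 / 2\<bar>"
      using \<omega> by (intro mult_left_mono abs_int_plus_half) auto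
    ultimately show ?thesis by simp
  qed
  show ?thesis
  proof (intro exI[of _ \<theta>] exI[of _ "\<omega> / norm mm"] conjI allI impI)
    show "0 < \<omega> / norm mm" using \<omega> mm0 by simp
    fix \<rho> assume \<rho>: "norm (\<omega> *\<^sub>R int_vec k) \<le> \<rho>"
    then have \<rho>\<xi>: "norm \<xi> \<le> \<rho>" "\<rho> \<ge> 0" using order_trans[OF norm_ge_zero \<rho>] by (simp_all only: \<xi>_def)
    \<comment> \<open>Makes real and imaginary part of \<zeta> equally long, which together with
      their orthogonality is \<zeta> . \<zeta> = 0. The radicand is nonnegative because \<rho> is at
      least |\<xi>|.\<close>
    define \<tau> where "\<tau> = sqrt (\<rho>\<^sup>2 - (norm \<xi>)\<^sup>2 / 4)"
    have "(norm \<xi>)\<^sup>2 \<le> \<rho>\<^sup>2" using \<rho>\<xi> by (intro power_mono) auto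
    then have "0 \<le> \<rho>\<^sup>2 - (norm \<xi>)\<^sup>2 / 4" using zero_le_power2[of "norm \<xi>"] by linarith
    then have \<tau>: "\<tau>\<^sup>2 = \<rho>\<^sup>2 - (norm \<xi>)\<^sup>2 / 4" by (simp add: \<tau>_def)
    define \<zeta>1 where "\<zeta>1 = complexify (\<rho> *\<^sub>R a) ((1/2) *\<^sub>R \<xi> + \<tau> *\<^sub>R b)"
    define \<zeta>2 where "\<zeta>2 = complexify ((-\<rho>) *\<^sub>R a) ((1/2) *\<^sub>R \<xi> + (-\<tau>) *\<^sub>R b)"
    have n2: "(norm ((1/2) *\<^sub>R \<xi> + t *\<^sub>R b))\<^sup>2 = (norm \<xi>)\<^sup>2 / 4 + t\<^sup>2" for t
      using b unfolding power2_norm_eq_inner power2_eq_square[of t]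
      by (simp add: inner_add_left inner_add_right inner_commute[of b \<xi>] norm_eq_1)
    have na: "(norm (t *\<^sub>R a))\<^sup>2 = t\<^sup>2" for t using a by (simp add: power_mult_distrib)
    have sq: "(\<Sum>i\<in>UNIV. (complexify (s *\<^sub>R a) ((1/2) *\<^sub>R \<xi> + t *\<^sub>R b) $ i)\<^sup>2) = 0" if "s\<^sup>2 = \<rho>\<^sup>2" "t\<^sup>2 = \<tau>\<^sup>2" for s t
      unfolding sum_squares_complexify n2 na using that a by (simp add: \<tau> complex_eq_iff inner_add_right)
    \<comment> \<open>The imaginary part alone gives the bound: |f|^2 and the contribution of Im
      \<zeta> are real, so what is left is 2 s (a . f).\<close>
    have symb: "\<omega> / norm mm * \<rho> \<le> cmod (2 * \<i> * cdot (complexify (s *\<^sub>R a) y) (freq \<omega> \<theta> l) - of_real ((norm (freq \<omega> \<theta> l))\<^sup>2))"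
      if "\<bar>s\<bar> = \<rho>" for s y l
    proof -
      have "\<omega> / norm mm * \<rho> = 2 * \<rho> * (\<omega> / (2 * norm mm))" by simp
      also have "\<dots> \<le> 2 * \<rho> * \<bar>a \<bullet> freq \<omega> \<theta> l\<bar>" using \<rho>\<xi> by (intro mult_left_mono af) auto
      also have "\<dots> = \<bar>Im (2 * \<i> * cdot (complexify (s *\<^sub>R a) y) (freq \<omega> \<theta> l) - of_real ((norm (freq \<omega> \<theta> l))\<^sup>2))\<bar>"
        using that by (simp add: cdot_complexify abs_mult)
      also have "\<dots> \<le> cmod (2 * \<i> * cdot (complexify (s *\<^sub>R a) y) (freq \<omega> \<theta> l) - of_real ((norm (freq \<omega> \<theta> l))\<^sup>2))"
        by (rule abs_Im_le_cmod)
      finally show ?thesis .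
    qed
    show "\<exists>\<zeta>1 \<zeta>2 :: complex^'n.
     (\<Sum>i\<in>UNIV. (\<zeta>1 $ i)\<^sup>2) = 0 \<and> (\<Sum>i\<in>UNIV. (\<zeta>2 $ i)\<^sup>2) = 0 \<and>
     (\<forall>x. cdot \<zeta>1 x + cdot \<zeta>2 x = \<i> * of_real (\<omega> *\<^sub>R int_vec k \<bullet> x)) \<and>
     (\<forall>l. \<omega> / norm mm * \<rho> \<le> cmod (2 * \<i> * cdot \<zeta>1 (freq \<omega> \<theta> l) - of_real ((norm (freq \<omega> \<theta> l))\<^sup>2))) \<and>
     (\<forall>l. \<omega> / norm mm * \<rho> \<le> cmod (2 * \<i> * cdot \<zeta>2 (freq \<omega> \<theta> l) - of_real ((norm (freq \<omega> \<theta> l))\<^sup>2)))"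
    proof (rule exI[of _ \<zeta>1], rule exI[of _ \<zeta>2], intro conjI allI)
      show "(\<Sum>i\<in>UNIV. (\<zeta>1 $ i)\<^sup>2) = 0" unfolding \<zeta>1_def by (rule sq) auto
      show "(\<Sum>i\<in>UNIV. (\<zeta>2 $ i)\<^sup>2) = 0" unfolding \<zeta>2_def by (rule sq) auto
      show "cdot \<zeta>1 x + cdot \<zeta>2 x = \<i> * of_real (\<omega> *\<^sub>R int_vec k \<bullet> x)" for x
        unfolding \<zeta>1_def \<zeta>2_def cdot_complexify \<xi>_def[symmetric]
        by (simp add: complex_eq_iff inner_add_left inner_diff_left)
    qed (unfold \<zeta>1_def \<zeta>2_def, rule symb, use \<rho>\<xi> in simp, rule symb, use \<rho>\<xi> in simp)
  qed
qed

text \<open>Tietze's theorem on the union of \<open>K\<close> and the faces of the cube, which are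
  disjoint closed sets as \<open>K\<close> lies in the open cube. Zero on the faces is what makes
  the extension a function on the torus. Its sign off \<open>K\<close> is not controlled; the energy
  estimate is applied with the original potential on \<open>\<Omega>\<close>.\<close>

lemma extend_to_cube:
  fixes g :: "real^'n \<Rightarrow> real"
  assumes K: "compact K" "\<forall>x\<in>K. \<forall>i. \<bar>x $ i\<bar> < R" and g: "continuous_on K g"
  shows "\<exists>Q M. M > 0 \<and> continuous_on UNIV Q \<and> (\<forall>x\<in>K. Q x = g x) \<and>
     (\<forall>x\<in>cube R. \<forall>i. \<bar>x $ i\<bar> = R \<longrightarrow> Q x = 0) \<and> (\<forall>x. \<bar>Q x\<bar> \<le> M)"
proof -
  define B where "B = {x :: real^'n. x \<in> cube R \<and> (\<exists>i. \<bar>x $ i\<bar> = R)}"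
  have "B = cube R \<inter> (\<Union>i. {x. \<bar>x $ i\<bar> = R})" by (auto simp: B_def)
  moreover have "closed {x :: real^'n. \<bar>x $ i\<bar> = R}" for i by (intro closed_Collect_eq continuous_intros)
  ultimately have cB: "closed B" by (simp add: closed_Int closed_UN compact_imp_closed)
  have cK: "closed K" using K(1) by (rule compact_imp_closed)
  have disj: "K \<inter> B = {}" using K(2) by (fastforce simp: B_def)
  have "compact (g ` K)" using g K(1) by (rule compact_continuous_image)
  from compact_imp_bounded[OF this] obtain M where M: "M > 0" "\<And>x. x \<in> K \<Longrightarrow> \<bar>g x\<bar> \<le> M"
    unfolding bounded_pos by auto
  define f where "f x = (if x \<in> K then g x else 0)" for x
  have "continuous_on (K \<union> B) f"
    unfolding f_def by (intro continuous_on_cases cK cB g continuous_on_const) (use disj in auto)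
  moreover have "closedin (top_of_set UNIV) (K \<union> B)" using cK cB by (intro closed_subset closed_Un) auto
  moreover have "norm (f x) \<le> M" if "x \<in> K \<union> B" for x using M by (auto simp: f_def)
  ultimately obtain Q where Q: "continuous_on UNIV Q" "\<And>x. x \<in> K \<union> B \<Longrightarrow> Q x = f x" "\<And>x. x \<in> UNIV \<Longrightarrow> norm (Q x) \<le> M"
    using Tietze[of "K \<union> B" f UNIV M] M(1) by (metis less_imp_le)
  have "Q x = 0" if "x \<in> cube R" "\<bar>x $ i\<bar> = R" for x i
  proof -
    have "x \<in> B" using that by (auto simp: B_def)
    then show ?thesis using Q(2)[of x] disj by (auto simp: f_def)
  qed
  then show ?thesis using M(1) Q by (intro exI[of _ Q] exI[of _ M]) (auto simp: f_def)
qed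

lemma abs_mult_le_weighted:
  fixes a b s :: real
  assumes "s > 0"
  shows "\<bar>a * b\<bar> \<le> (s * a\<^sup>2 + b\<^sup>2 / s) / 2"
proof -
  have "0 \<le> (s * \<bar>a\<bar> - \<bar>b\<bar>)\<^sup>2 / s" using assms by simp
  also have "(s * \<bar>a\<bar> - \<bar>b\<bar>)\<^sup>2 / s = s * a\<^sup>2 + b\<^sup>2 / s - 2 * \<bar>a * b\<bar>"
    using assms by (simp add: power2_eq_square abs_mult field_simps)
  finally show ?thesis by simp
qed

text \<open>A small weight \<open>s\<close> goes to the sizes of \<open>w1\<close> and
  \<open>w2\<close>, a large weight 1 / s to the errors, which can be made small after
  \<open>s\<close> has been fixed.\<close>

lemma product_perturbation:
  fixes w1 w2 v1 v2 s :: real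
  assumes s: "s > 0"
  shows "\<bar>w1 * w2 - v1 * v2\<bar> \<le> (s * (w1\<^sup>2 + w2\<^sup>2) + (1 + 1 / s) * ((w1 - v1)\<^sup>2 + (w2 - v2)\<^sup>2)) / 2"
proof -
  have "w1 * w2 - v1 * v2 = w2 * (w1 - v1) + w1 * (w2 - v2) - (w1 - v1) * (w2 - v2)" by (simp add: algebra_simps)
  then have "\<bar>w1 * w2 - v1 * v2\<bar> \<le> \<bar>w2 * (w1 - v1)\<bar> + \<bar>w1 * (w2 - v2)\<bar> + \<bar>(w1 - v1) * (w2 - v2)\<bar>" by linarith
  also have "\<dots> \<le> (s * w2\<^sup>2 + (w1 - v1)\<^sup>2 / s) / 2 + (s * w1\<^sup>2 + (w2 - v2)\<^sup>2 / s) / 2 + (1 * (w1 - v1)\<^sup>2 + (w2 - v2)\<^sup>2 / 1) / 2"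
    by (intro add_mono abs_mult_le_weighted s) auto
  also have "\<dots> = (s * (w1\<^sup>2 + w2\<^sup>2) + (1 + 1 / s) * ((w1 - v1)\<^sup>2 + (w2 - v2)\<^sup>2)) / 2"
    by (simp add: algebra_simps add_divide_distrib)
  finally show ?thesis .
qed

section \<open>Equality of two nonnegative potentials from the orthogonality relation
  \<open>orth\<close>\<close>

context
  fixes \<Omega> :: "(real^'n) set" and \<alpha> R :: real and q1 q2 :: "real^'n \<Rightarrow> real"
  assumes op: "open \<Omega>" and ne: "\<Omega> \<noteq> {}" and \<alpha>: "0 < \<alpha>" "\<alpha> < 1" and bd: "bounded \<Omega>" and neg: "negligible (frontier \<Omega>)"
    and R: "\<And>x. x \<in> closure \<Omega> \<Longrightarrow> norm x < R"
    and q1c: "continuous_on (closure \<Omega>) q1" and q2c: "continuous_on (closure \<Omega>) q2"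
    and q1p: "\<And>x. x \<in> \<Omega> \<Longrightarrow> q1 x \<ge> 0" and q2p: "\<And>x. x \<in> \<Omega> \<Longrightarrow> q2 x \<ge> 0"
    and orth: "\<And>w1 w2. holder_on 2 \<alpha> \<Omega> w1 \<Longrightarrow> holder_on 2 \<alpha> \<Omega> w2 \<Longrightarrow>
      \<exists>v1 v2. holder_on 2 \<alpha> \<Omega> v1 \<and> holder_on 2 \<alpha> \<Omega> v2 \<and>
       (\<forall>x\<in>frontier \<Omega>. v1 x = w1 x \<and> v2 x = w2 x) \<and>
       (\<forall>x\<in>\<Omega>. laplacian v1 x = q1 x * v1 x \<and> laplacian v2 x = q2 x * v2 x) \<and>
       (LINT x:\<Omega>|lborel. (q1 x - q2 x) * (v1 x * v2 x)) = 0"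
begin

lemma compact_closure_domain: "compact (closure \<Omega>)"
  using bd by (simp add: compact_closure)

lemma bounded_image_closure:
  fixes f :: "real^'n \<Rightarrow> 'b::real_normed_vector"
  assumes "continuous_on (closure \<Omega>) f"
  shows "bounded (f ` \<Omega>)"
proof -
  have "compact (f ` closure \<Omega>)" using assms compact_closure_domain by (rule compact_continuous_image)
  then show ?thesis using closure_subset by (metis bounded_subset compact_imp_bounded image_mono)
qed

lemma integrable_closure:
  fixes f :: "real^'n \<Rightarrow> 'b::{banach,second_countable_topology}"
  assumes "continuous_on (closure \<Omega>) f"
  shows "set_integrable lborel \<Omega> f"
  by (rule set_integrable_bounded_continuous[OF op bd continuous_on_subset[OF assms closure_subset] bounded_image_closure[OF assms]])

text \<open>The difference of \<open>w\<close> and the exact solution \<open>v\<close> vanishes on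
  the boundary and inherits the residual of \<open>w\<close>, so \<open>energy_estimate\<close>
  applies to it.\<close>

lemma approximate_solution_error:
  assumes qc: "continuous_on (closure \<Omega>) q" and qp: "\<And>x. x \<in> \<Omega> \<Longrightarrow> q x \<ge> 0"
    and w: "holder_on 2 \<alpha> \<Omega> w" and l: "\<And>x. x \<in> \<Omega> \<Longrightarrow> laplacian w x = l x"
    and v: "holder_on 2 \<alpha> \<Omega> v" "\<And>x. x \<in> frontier \<Omega> \<Longrightarrow> v x = w x" "\<And>x. x \<in> \<Omega> \<Longrightarrow> laplacian v x = q x * v x"
  shows "(LINT x:\<Omega>|lborel. (w x - v x)\<^sup>2) \<le> 16 * R^4 * (LINT x:\<Omega>|lborel. (l x - q x * w x)\<^sup>2)"
proof -
  define e where "e x = w x + (-1) * v x" for x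
  have eh: "holder_on 2 \<alpha> \<Omega> e" unfolding e_def by (rule holder_on_lincomb[OF op w v(1)])
  have e0: "(e \<longlongrightarrow> 0) (at z within \<Omega>)" if "z \<in> frontier \<Omega>" for z
    using tendsto_frontier_value[OF op ne \<alpha> bd eh that] v(2)[OF that] by (simp add: e_def)
  have "(LINT x:\<Omega>|lborel. (e x)\<^sup>2) \<le> 16 * R^4 * (LINT x:\<Omega>|lborel. (laplacian e x - q x * e x)\<^sup>2)"
  proof (rule energy_estimate[OF op bd neg eh e0 qp])
    show "continuous_on \<Omega> q" using qc closure_subset by (rule continuous_on_subset)
    show "bounded (q ` \<Omega>)" using qc by (rule bounded_image_closure)
    show "norm x \<le> R" if "x \<in> \<Omega>" for x using R[of x] that closure_subset by force
  qed
  also have "(LINT x:\<Omega>|lborel. (laplacian e x - q x * e x)\<^sup>2) = (LINT x:\<Omega>|lborel. (l x - q x * w x)\<^sup>2)"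
  proof (rule set_lebesgue_integral_cong)
    show "\<forall>x. x \<in> \<Omega> \<longrightarrow> (laplacian e x - q x * e x)\<^sup>2 = (l x - q x * w x)\<^sup>2"
    proof (intro allI impI)
      fix x assume x: "x \<in> \<Omega>"
      have "pderivs [b, b] e x = pderivs [b, b] w x + (-1) * pderivs [b, b] v x" if "b \<in> Basis" for b
        unfolding e_def using that by (intro pderivs_holder_lincomb(1)[OF op w v(1) order_refl _ x]) (simp add: directions_def)
      then have "laplacian e x = l x - q x * v x"
        using l[OF x] v(3)[OF x] by (simp add: laplacian_def sum_subtractf)
      then show "(laplacian e x - q x * e x)\<^sup>2 = (l x - q x * w x)\<^sup>2" by (simp add: e_def algebra_simps)
    qed
  qed (use op in simp)
  finally show ?thesis by (simp add: e_def)
qed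

text \<open>The pairing of the exact solutions with the same boundary values is 0. So the pairing of
  \<open>w1\<close> and \<open>w2\<close> equals the change caused by replacing them with exact
  solutions, which the residuals control in L^2. The weight \<open>s\<close> stays free for
  balancing.\<close>

lemma real_pairing_bound:
  assumes P: "\<And>x. x \<in> \<Omega> \<Longrightarrow> \<bar>q1 x - q2 x\<bar> \<le> P" and s: "s > 0"
    and w1: "holder_on 2 \<alpha> \<Omega> w1" "\<And>x. x \<in> \<Omega> \<Longrightarrow> laplacian w1 x = l1 x"
    and w2: "holder_on 2 \<alpha> \<Omega> w2" "\<And>x. x \<in> \<Omega> \<Longrightarrow> laplacian w2 x = l2 x"
  shows "\<bar>LINT x:\<Omega>|lborel. (q1 x - q2 x) * (w1 x * w2 x)\<bar> \<le>
    P / 2 * (s * ((LINT x:\<Omega>|lborel. (w1 x)\<^sup>2) + (LINT x:\<Omega>|lborel. (w2 x)\<^sup>2)) +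
      (1 + 1 / s) * (16 * R^4) * ((LINT x:\<Omega>|lborel. (l1 x - q1 x * w1 x)\<^sup>2) + (LINT x:\<Omega>|lborel. (l2 x - q2 x * w2 x)\<^sup>2)))"
proof -
  obtain v1 v2 where v1: "holder_on 2 \<alpha> \<Omega> v1" and v2: "holder_on 2 \<alpha> \<Omega> v2"
    and b: "\<forall>x\<in>frontier \<Omega>. v1 x = w1 x \<and> v2 x = w2 x"
    and lap: "\<forall>x\<in>\<Omega>. laplacian v1 x = q1 x * v1 x \<and> laplacian v2 x = q2 x * v2 x"
    and o: "(LINT x:\<Omega>|lborel. (q1 x - q2 x) * (v1 x * v2 x)) = 0"
    using orth[OF w1(1) w2(1)] by (elim exE conjE) (rule that)
  note cont = holder_onD(1)[OF v1] holder_onD(1)[OF v2] holder_onD(1)[OF w1(1)] holder_onD(1)[OF w2(1)] q1c q2c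
  obtain x0 where "x0 \<in> \<Omega>" using ne by blast
  then have P0: "P \<ge> 0" using P[of x0] by linarith
  define E where "E x = (w1 x - v1 x)\<^sup>2 + (w2 x - v2 x)\<^sup>2" for x
  define W where "W x = (w1 x)\<^sup>2 + (w2 x)\<^sup>2" for x
  have ci: "set_integrable lborel \<Omega> E" "set_integrable lborel \<Omega> W"
    unfolding E_def W_def by (intro integrable_closure continuous_intros cont)+
  have sI: "set_integrable lborel \<Omega> (\<lambda>x. P / 2 * (s * W x + (1 + 1 / s) * E x))"
    by (intro set_integrable_mult_right set_integral_add ci)
  have "(LINT x:\<Omega>|lborel. (q1 x - q2 x) * (w1 x * w2 x))
      = (LINT x:\<Omega>|lborel. (q1 x - q2 x) * (w1 x * w2 x)) - (LINT x:\<Omega>|lborel. (q1 x - q2 x) * (v1 x * v2 x))"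
    by (simp add: o)
  also have "\<dots> = (LINT x:\<Omega>|lborel. (q1 x - q2 x) * (w1 x * w2 x) - (q1 x - q2 x) * (v1 x * v2 x))"
    by (intro set_integral_diff(2)[symmetric] integrable_closure continuous_intros cont)
  also have "\<dots> = (LINT x:\<Omega>|lborel. (q1 x - q2 x) * (w1 x * w2 x - v1 x * v2 x))"
    by (simp add: right_diff_distrib)
  finally have "\<bar>LINT x:\<Omega>|lborel. (q1 x - q2 x) * (w1 x * w2 x)\<bar> = norm (LINT x:\<Omega>|lborel. (q1 x - q2 x) * (w1 x * w2 x - v1 x * v2 x))"
    by simp
  also have "\<dots> \<le> (LINT x:\<Omega>|lborel. norm ((q1 x - q2 x) * (w1 x * w2 x - v1 x * v2 x)))"
    by (intro set_integral_norm_bound integrable_closure continuous_intros cont)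
  also have "\<dots> \<le> (LINT x:\<Omega>|lborel. P / 2 * (s * W x + (1 + 1 / s) * E x))"
  proof (rule set_integral_mono[OF _ sI])
    show "set_integrable lborel \<Omega> (\<lambda>x. norm ((q1 x - q2 x) * (w1 x * w2 x - v1 x * v2 x)))"
      by (intro integrable_closure continuous_intros cont)
    fix x assume x: "x \<in> \<Omega>"
    have "norm ((q1 x - q2 x) * (w1 x * w2 x - v1 x * v2 x)) \<le> P * ((s * W x + (1 + 1 / s) * E x) / 2)"
      unfolding real_norm_def abs_mult W_def E_def using P0
      by (intro mult_mono P x product_perturbation s) auto
    then show "norm ((q1 x - q2 x) * (w1 x * w2 x - v1 x * v2 x)) \<le> P / 2 * (s * W x + (1 + 1 / s) * E x)" by simp
  qed
  also have "\<dots> = P / 2 * (s * (LINT x:\<Omega>|lborel. W x) + (1 + 1 / s) * (LINT x:\<Omega>|lborel. E x))"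
    using ci by (simp add: set_integral_add)
  also have "(LINT x:\<Omega>|lborel. W x) = (LINT x:\<Omega>|lborel. (w1 x)\<^sup>2) + (LINT x:\<Omega>|lborel. (w2 x)\<^sup>2)"
    unfolding W_def by (intro set_integral_add integrable_closure continuous_intros cont)
  also have "P / 2 * (s * ((LINT x:\<Omega>|lborel. (w1 x)\<^sup>2) + (LINT x:\<Omega>|lborel. (w2 x)\<^sup>2)) + (1 + 1 / s) * (LINT x:\<Omega>|lborel. E x))
     \<le> P / 2 * (s * ((LINT x:\<Omega>|lborel. (w1 x)\<^sup>2) + (LINT x:\<Omega>|lborel. (w2 x)\<^sup>2)) +
      (1 + 1 / s) * (16 * R^4 * (LINT x:\<Omega>|lborel. (l1 x - q1 x * w1 x)\<^sup>2) + 16 * R^4 * (LINT x:\<Omega>|lborel. (l2 x - q2 x * w2 x)\<^sup>2)))"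
  proof -
    have "(LINT x:\<Omega>|lborel. E x) = (LINT x:\<Omega>|lborel. (w1 x - v1 x)\<^sup>2) + (LINT x:\<Omega>|lborel. (w2 x - v2 x)\<^sup>2)"
      unfolding E_def by (intro set_integral_add integrable_closure continuous_intros cont)
    also have "\<dots> \<le> 16 * R^4 * (LINT x:\<Omega>|lborel. (l1 x - q1 x * w1 x)\<^sup>2) + 16 * R^4 * (LINT x:\<Omega>|lborel. (l2 x - q2 x * w2 x)\<^sup>2)"
      using b lap by (intro add_mono approximate_solution_error[OF q1c q1p w1 v1] approximate_solution_error[OF q2c q2p w2 v2]) auto
    finally show ?thesis using P0 s by (intro mult_left_mono add_left_mono) auto
  qed
  finally show ?thesis by (simp add: algebra_simps)
qed

text \<open>\<open>orth\<close> concerns real functions. Since the potentials are real, real and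
  imaginary parts of \<open>w1\<close> and \<open>w2\<close> are approximate solutions with no
  larger residuals. Four real pairings, each with the factor P / 2, make 2 P.\<close>

lemma complex_pairing_bound:
  assumes P: "\<And>x. x \<in> \<Omega> \<Longrightarrow> \<bar>q1 x - q2 x\<bar> \<le> P" and s: "s > 0"
    and w1: "complex_C2 \<alpha> \<Omega> w1 l1" and w2: "complex_C2 \<alpha> \<Omega> w2 l2"
  shows "cmod (LINT x:\<Omega>|lborel. of_real (q1 x - q2 x) * (w1 x * w2 x)) \<le>
    2 * P * (s * ((LINT x:\<Omega>|lborel. (cmod (w1 x))\<^sup>2) + (LINT x:\<Omega>|lborel. (cmod (w2 x))\<^sup>2)) +
      (1 + 1 / s) * (16 * R^4) * ((LINT x:\<Omega>|lborel. (cmod (l1 x - of_real (q1 x) * w1 x))\<^sup>2) + (LINT x:\<Omega>|lborel. (cmod (l2 x - of_real (q2 x) * w2 x))\<^sup>2)))"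
    (is "_ \<le> 2 * P * ?B")
proof -
  note C1 = w1[unfolded complex_C2_def] and C2 = w2[unfolded complex_C2_def]
  have cU: "continuous_on (closure \<Omega>) w1" "continuous_on (closure \<Omega>) w2" "continuous_on (closure \<Omega>) l1" "continuous_on (closure \<Omega>) l2"
    using C1 C2 by (auto intro: continuous_on_subset)
  note cont = cU q1c q2c
  obtain x0 where "x0 \<in> \<Omega>" using ne by blast
  then have P0: "P \<ge> 0" using P[of x0] by linarith
  have piece: "\<bar>LINT x:\<Omega>|lborel. (q1 x - q2 x) * (f1 x * f2 x)\<bar> \<le> P / 2 * ?B"
    if f1: "holder_on 2 \<alpha> \<Omega> f1" "\<And>x. x \<in> \<Omega> \<Longrightarrow> laplacian f1 x = m1 x" "continuous_on (closure \<Omega>) m1"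
      and f2: "holder_on 2 \<alpha> \<Omega> f2" "\<And>x. x \<in> \<Omega> \<Longrightarrow> laplacian f2 x = m2 x" "continuous_on (closure \<Omega>) m2"
      and b1: "\<And>x. \<bar>f1 x\<bar> \<le> cmod (w1 x)" "\<And>x. \<bar>m1 x - q1 x * f1 x\<bar> \<le> cmod (l1 x - of_real (q1 x) * w1 x)"
      and b2: "\<And>x. \<bar>f2 x\<bar> \<le> cmod (w2 x)" "\<And>x. \<bar>m2 x - q2 x * f2 x\<bar> \<le> cmod (l2 x - of_real (q2 x) * w2 x)"
    for f1 f2 m1 m2
  proof -
    note c2 = cont f1(3) f2(3) holder_onD(1)[OF f1(1)] holder_onD(1)[OF f2(1)]
    have "\<bar>LINT x:\<Omega>|lborel. (q1 x - q2 x) * (f1 x * f2 x)\<bar> \<le>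
      P / 2 * (s * ((LINT x:\<Omega>|lborel. (f1 x)\<^sup>2) + (LINT x:\<Omega>|lborel. (f2 x)\<^sup>2)) +
      (1 + 1 / s) * (16 * R^4) * ((LINT x:\<Omega>|lborel. (m1 x - q1 x * f1 x)\<^sup>2) + (LINT x:\<Omega>|lborel. (m2 x - q2 x * f2 x)\<^sup>2)))"
      by (rule real_pairing_bound[OF P s f1(1,2) f2(1,2)])
    also have "\<dots> \<le> P / 2 * ?B"
    proof (intro mult_left_mono add_mono)
      show "(LINT x:\<Omega>|lborel. (f1 x)\<^sup>2) \<le> (LINT x:\<Omega>|lborel. (cmod (w1 x))\<^sup>2)"
        using b1(1) by (intro set_integral_mono integrable_closure continuous_intros c2) (metis abs_le_square_iff abs_norm_cancel)
      show "(LINT x:\<Omega>|lborel. (f2 x)\<^sup>2) \<le> (LINT x:\<Omega>|lborel. (cmod (w2 x))\<^sup>2)"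
        using b2(1) by (intro set_integral_mono integrable_closure continuous_intros c2) (metis abs_le_square_iff abs_norm_cancel)
      show "(LINT x:\<Omega>|lborel. (m1 x - q1 x * f1 x)\<^sup>2) \<le> (LINT x:\<Omega>|lborel. (cmod (l1 x - of_real (q1 x) * w1 x))\<^sup>2)"
        using b1(2) by (intro set_integral_mono integrable_closure continuous_intros c2) (metis abs_le_square_iff abs_norm_cancel)
      show "(LINT x:\<Omega>|lborel. (m2 x - q2 x * f2 x)\<^sup>2) \<le> (LINT x:\<Omega>|lborel. (cmod (l2 x - of_real (q2 x) * w2 x))\<^sup>2)"
        using b2(2) by (intro set_integral_mono integrable_closure continuous_intros c2) (metis abs_le_square_iff abs_norm_cancel)
    qed (use s P0 in auto)
    finally show ?thesis .
  qed
  have re: "\<bar>Re z\<bar> \<le> cmod z" "\<bar>Im z\<bar> \<le> cmod z" for z by (rule abs_Re_le_cmod abs_Im_le_cmod)+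
  have re2: "\<bar>Re l - q * Re w\<bar> \<le> cmod (l - of_real q * w)" "\<bar>Im l - q * Im w\<bar> \<le> cmod (l - of_real q * w)" for l w :: complex and q
    using re[of "l - of_real q * w"] by simp_all
  define J where "J f g = (LINT x:\<Omega>|lborel. (q1 x - q2 x) * (f (w1 x) * g (w2 x)))" for f g :: "complex \<Rightarrow> real"
  have Jb: "\<bar>J f g\<bar> \<le> P / 2 * ?B" if "f = Re \<or> f = Im" "g = Re \<or> g = Im" for f g
    unfolding J_def
    by (rule piece[where ?m1.0="\<lambda>x. f (l1 x)" and ?m2.0="\<lambda>x. g (l2 x)"])
       (use that C1 C2 re re2 cU in \<open>auto intro!: continuous_intros\<close>)
  have ic: "set_integrable lborel \<Omega> (\<lambda>x. of_real (q1 x - q2 x) * (w1 x * w2 x))"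
    by (intro integrable_closure continuous_intros cont)
  have ir: "set_integrable lborel \<Omega> (\<lambda>x. (q1 x - q2 x) * (f (w1 x) * g (w2 x)))" if "f = Re \<or> f = Im" "g = Re \<or> g = Im" for f g
    using that by (auto intro!: integrable_closure continuous_intros cont)
  let ?I = "LINT x:\<Omega>|lborel. of_real (q1 x - q2 x) * (w1 x * w2 x)"
  have "Re ?I = (LINT x:\<Omega>|lborel. (q1 x - q2 x) * (Re (w1 x) * Re (w2 x)) - (q1 x - q2 x) * (Im (w1 x) * Im (w2 x)))"
    unfolding set_lebesgue_integral_def
    by (subst integral_Re[symmetric]) (use ic in \<open>auto simp: set_integrable_def algebra_simps\<close>)
  also have "\<dots> = J Re Re - J Im Im" unfolding J_def by (intro set_integral_diff ir) auto
  finally have RI: "Re ?I = J Re Re - J Im Im" .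
  have "Im ?I = (LINT x:\<Omega>|lborel. (q1 x - q2 x) * (Re (w1 x) * Im (w2 x)) + (q1 x - q2 x) * (Im (w1 x) * Re (w2 x)))"
    unfolding set_lebesgue_integral_def
    by (subst integral_Im[symmetric]) (use ic in \<open>auto simp: set_integrable_def algebra_simps\<close>)
  also have "\<dots> = J Re Im + J Im Re" unfolding J_def by (intro set_integral_add ir) auto
  finally have II: "Im ?I = J Re Im + J Im Re" .
  have "cmod ?I \<le> \<bar>Re ?I\<bar> + \<bar>Im ?I\<bar>" by (rule cmod_le)
  also have "\<dots> \<le> \<bar>J Re Re\<bar> + \<bar>J Im Im\<bar> + \<bar>J Re Im\<bar> + \<bar>J Im Re\<bar>" unfolding RI II by linarith
  also have "\<dots> \<le> P / 2 * ?B + P / 2 * ?B + P / 2 * ?B + P / 2 * ?B" by (intro add_mono Jb) auto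
  finally show ?thesis by simp
qed


lemma integral_le_cube:
  fixes f g :: "real^'n \<Rightarrow> real"
  assumes f: "continuous_on (closure \<Omega>) f" and g: "continuous_on (cube R) g"
    and le: "\<And>x. x \<in> \<Omega> \<Longrightarrow> f x \<le> g x" and g0: "\<And>x. g x \<ge> 0"
  shows "(LINT x:\<Omega>|lborel. f x) \<le> (LINT x:cube R|lborel. g x)"
  unfolding set_lebesgue_integral_def
proof (rule integral_mono)
  show "integrable lborel (\<lambda>x. indicat_real \<Omega> x *\<^sub>R f x)"
    using integrable_closure[OF f] by (simp add: set_integrable_def)
  show "integrable lborel (\<lambda>x. indicat_real (cube R) x *\<^sub>R g x)"
    using set_integrable_cube[OF g] by (simp add: set_integrable_def)
  fix x
  have "x \<in> cube R" if "x \<in> \<Omega>"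
  proof -
    have "norm x < R" using that closure_subset R by blast
    then have "\<bar>x $ i\<bar> \<le> R" for i using component_le_norm_cart[of x i] by linarith
    then show ?thesis by (simp add: cube_def)
  qed
  then show "indicat_real \<Omega> x *\<^sub>R f x \<le> indicat_real (cube R) x *\<^sub>R g x"
    using le g0 by (auto simp: indicator_def)
qed

text \<open>In the product w1 w2 the exponential growth cancels, because the real parts of \<zeta>1
  and \<zeta>2 are opposite, and cis (\<xi> . x) (1 + r1) (1 + r2) is left. The terms with r1 or r2
  contribute O(1 / \<kappa>).\<close>

lemma fourier_coefficient_zero:
  fixes k :: "int^'n"
  assumes n: "CARD('n) \<ge> 3"
  shows "(LINT x:\<Omega>|lborel. of_real (q1 x - q2 x) * cis ((pi / R) *\<^sub>R int_vec k \<bullet> x)) = 0"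
proof -
  obtain x0 where x0: "x0 \<in> \<Omega>" using ne by blast
  have "x0 \<in> closure \<Omega>" using x0 closure_subset by blast
  from R[OF this] have R0: "R > 0" using norm_ge_zero[of x0] by linarith
  have comp: "\<forall>x\<in>closure \<Omega>. \<forall>i. \<bar>x $ i\<bar> < R"
  proof (intro ballI allI)
    fix x i assume "x \<in> closure \<Omega>"
    from R[OF this] show "\<bar>x $ i\<bar> < R" using component_le_norm_cart[of x i] by linarith
  qed
  obtain Q1 M1 where M1: "M1 > 0" and Q1: "continuous_on UNIV Q1" "\<forall>x\<in>closure \<Omega>. Q1 x = q1 x"
    "\<forall>x\<in>cube R. \<forall>i. \<bar>x $ i\<bar> = R \<longrightarrow> Q1 x = 0" "\<forall>x. \<bar>Q1 x\<bar> \<le> M1"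
    using extend_to_cube[OF compact_closure_domain comp q1c] by (elim exE conjE) (rule that)
  obtain Q2 M2 where M2: "M2 > 0" and Q2: "continuous_on UNIV Q2" "\<forall>x\<in>closure \<Omega>. Q2 x = q2 x"
    "\<forall>x\<in>cube R. \<forall>i. \<bar>x $ i\<bar> = R \<longrightarrow> Q2 x = 0" "\<forall>x. \<bar>Q2 x\<bar> \<le> M2"
    using extend_to_cube[OF compact_closure_domain comp q2c] by (elim exE conjE) (rule that)
  \<comment> \<open>One constant serves as bound for either extended potential and for their
    difference.\<close>
  define P where "P = M1 + M2"
  have P0: "P > 0" using M1 M2 by (simp add: P_def)
  have PM: "\<bar>Q1 x\<bar> \<le> P" "\<bar>Q2 x\<bar> \<le> P" for x
    using Q1(4)[rule_format, of x] Q2(4)[rule_format, of x] M1 M2 by (auto simp: P_def)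
  have Pb: "\<bar>q1 x - q2 x\<bar> \<le> P" if "x \<in> \<Omega>" for x
  proof -
    have "x \<in> closure \<Omega>" using that closure_subset by blast
    then have "q1 x = Q1 x" "q2 x = Q2 x" using Q1(2) Q2(2) by auto
    then show ?thesis using Q1(4)[rule_format, of x] Q2(4)[rule_format, of x] by (simp add: P_def)
  qed
  define V where "V = cube_norm2 R (\<lambda>x::real^'n. 1)"
  have V0: "V \<ge> 0" by (simp add: V_def cube_norm2_nonneg)
  define \<xi> where "\<xi> = (pi / R) *\<^sub>R int_vec k"
  have \<omega>: "pi / R > 0" using R0 by simp
  obtain \<theta> \<mu> where \<mu>: "\<mu> > 0" and freq: "\<forall>\<rho>\<ge>norm \<xi>. \<exists>\<zeta>1 \<zeta>2 :: complex^'n.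
     (\<Sum>i\<in>UNIV. (\<zeta>1 $ i)\<^sup>2) = 0 \<and> (\<Sum>i\<in>UNIV. (\<zeta>2 $ i)\<^sup>2) = 0 \<and>
     (\<forall>x. cdot \<zeta>1 x + cdot \<zeta>2 x = \<i> * of_real (\<xi> \<bullet> x)) \<and>
     (\<forall>l. \<mu> * \<rho> \<le> cmod (2 * \<i> * cdot \<zeta>1 (freq (pi / R) \<theta> l) - of_real ((norm (freq (pi / R) \<theta> l))\<^sup>2))) \<and>
     (\<forall>l. \<mu> * \<rho> \<le> cmod (2 * \<i> * cdot \<zeta>2 (freq (pi / R) \<theta> l) - of_real ((norm (freq (pi / R) \<theta> l))\<^sup>2)))"
    using cgo_frequencies[OF n \<omega>, of k] unfolding \<xi>_def[symmetric] by (elim exE conjE) (rule that)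
  have cU: "continuous_on S (\<lambda>x. cis (\<xi> \<bullet> x))" for S by (intro continuous_intros)
  have cQ: "continuous_on (cube R) Q1" "continuous_on (cube R) Q2" using Q1(1) Q2(1) continuous_on_subset by blast+
  \<comment> \<open>For fixed \<kappa> the pairing is made as small as desired: \<kappa> determines
    \<zeta>1 and \<zeta>2 and hence the size of the exponentials, then \<open>s\<close>, and last
    the admissible residual \<open>\<epsilon>\<close>.\<close>
  have rem: "\<exists>r1 r2. continuous_on UNIV r1 \<and> continuous_on UNIV r2 \<and>
      cube_norm2 R r1 \<le> 16 * P\<^sup>2 / \<kappa>\<^sup>2 * V \<and> cube_norm2 R r2 \<le> 16 * P\<^sup>2 / \<kappa>\<^sup>2 * V \<and>
      cmod (LINT x:\<Omega>|lborel. of_real (q1 x - q2 x) * (cis (\<xi> \<bullet> x) * ((1 + r1 x) * (1 + r2 x)))) \<le> \<eta>"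
    if \<kappa>: "\<kappa> \<ge> 4 * P" "\<kappa> \<ge> \<mu> * norm \<xi>" and \<eta>: "\<eta> > 0" for \<kappa> \<eta>
  proof -
    have \<kappa>0: "\<kappa> > 0" using \<kappa>(1) P0 by linarith
    \<comment> \<open>\<open>cgo_frequencies\<close> is used with \<rho> = \<kappa> / \<mu>, so that
      its symbol bound \<mu> \<rho> is \<kappa>.\<close>
    have \<xi>\<kappa>: "norm \<xi> \<le> \<kappa> / \<mu>" using \<kappa>(2) \<mu> by (simp add: le_divide_eq mult.commute)
    obtain \<zeta>1 \<zeta>2 :: "complex^'n" where \<zeta>: "(\<Sum>i\<in>UNIV. (\<zeta>1 $ i)\<^sup>2) = 0" "(\<Sum>i\<in>UNIV. (\<zeta>2 $ i)\<^sup>2) = 0"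
      and sum\<zeta>: "\<forall>x. cdot \<zeta>1 x + cdot \<zeta>2 x = \<i> * of_real (\<xi> \<bullet> x)"
      and s1: "\<forall>l. \<mu> * (\<kappa> / \<mu>) \<le> cmod (2 * \<i> * cdot \<zeta>1 (freq (pi / R) \<theta> l) - of_real ((norm (freq (pi / R) \<theta> l))\<^sup>2))"
      and s2: "\<forall>l. \<mu> * (\<kappa> / \<mu>) \<le> cmod (2 * \<i> * cdot \<zeta>2 (freq (pi / R) \<theta> l) - of_real ((norm (freq (pi / R) \<theta> l))\<^sup>2))"
      using freq[rule_format, OF \<xi>\<kappa>] by (elim exE conjE) (rule that)
    have \<mu>\<kappa>: "\<mu> * (\<kappa> / \<mu>) = \<kappa>" using \<mu> by simp
    have expb: "\<exists>B>0. \<forall>x\<in>cube R. cmod (exp (cdot \<zeta> x)) \<le> B" for \<zeta> :: "complex^'n"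
    proof -
      have "compact ((\<lambda>x. exp (cdot \<zeta> x)) ` cube R)" by (intro compact_continuous_image compact_cube continuous_intros)
      from compact_imp_bounded[OF this] show ?thesis unfolding bounded_pos by auto
    qed
    obtain B1 where B1: "B1 > 0" "\<forall>x\<in>cube R. cmod (exp (cdot \<zeta>1 x)) \<le> B1" using expb by blast
    obtain B2 where B2: "B2 > 0" "\<forall>x\<in>cube R. cmod (exp (cdot \<zeta>2 x)) \<le> B2" using expb by blast
    \<comment> \<open>Bounds the two squared norms of \<open>w1\<close> and \<open>w2\<close>
      together, since |1 + r|^2 integrates to at most 2 V + 2 V. Then \<open>s\<close> and
      \<open>\<epsilon>\<close> are chosen so that each of the two parts of
      \<open>complex_pairing_bound\<close> costs at most \<eta> / 2.\<close>
    define A where "A = 4 * B1\<^sup>2 * V + 4 * B2\<^sup>2 * V"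
    have A0: "A \<ge> 0" using V0 by (simp add: A_def)
    define s where "s = \<eta> / (4 * P * (A + 1))"
    have s: "s > 0" using \<eta> P0 A0 by (simp add: s_def)
    define \<epsilon> where "\<epsilon> = \<eta> / (8 * P * (1 + 1 / s) * (16 * R^4))"
    have \<epsilon>: "\<epsilon> > 0" unfolding \<epsilon>_def using \<eta> P0 s R0 by (intro divide_pos_pos mult_pos_pos add_pos_pos) auto
    have cgo: "\<exists>w l r. complex_C2 \<alpha> \<Omega> w l \<and> continuous_on UNIV r \<and> (\<forall>x. w x = exp (cdot \<zeta> x) * (1 + r x)) \<and>
        cube_norm2 R r \<le> 16 * P\<^sup>2 / \<kappa>\<^sup>2 * cube_norm2 R (\<lambda>x::real^'n. 1) \<and>
        cube_norm2 R (\<lambda>x. l x - of_real (Q x) * w x) \<le> \<epsilon>"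
      if "continuous_on (cube R) Q" "\<forall>x\<in>cube R. \<forall>i. \<bar>x $ i\<bar> = R \<longrightarrow> Q x = 0" "\<And>x. \<bar>Q x\<bar> \<le> P"
        "(\<Sum>i\<in>UNIV. (\<zeta> $ i)\<^sup>2) = 0" "\<forall>l. \<mu> * (\<kappa> / \<mu>) \<le> cmod (2 * \<i> * cdot \<zeta> (freq (pi / R) \<theta> l) - of_real ((norm (freq (pi / R) \<theta> l))\<^sup>2))"
      for Q and \<zeta> :: "complex^'n"
      by (rule cgo_approximate_solution[OF \<alpha> op bd R0 that(1) _ _ P0 that(4) that(5)[unfolded \<mu>\<kappa>, rule_format] \<kappa>(1) \<epsilon>])
         (use that(2,3) in auto)
    obtain w1 l1 r1 where w1: "complex_C2 \<alpha> \<Omega> w1 l1" and r1: "continuous_on UNIV r1" and e1: "\<forall>x. w1 x = exp (cdot \<zeta>1 x) * (1 + r1 x)"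
      and n1: "cube_norm2 R r1 \<le> 16 * P\<^sup>2 / \<kappa>\<^sup>2 * cube_norm2 R (\<lambda>x::real^'n. 1)"
      and res1: "cube_norm2 R (\<lambda>x. l1 x - of_real (Q1 x) * w1 x) \<le> \<epsilon>"
      using cgo[OF cQ(1) Q1(3) PM(1) \<zeta>(1) s1] by (elim exE conjE) (rule that)
    obtain w2 l2 r2 where w2: "complex_C2 \<alpha> \<Omega> w2 l2" and r2: "continuous_on UNIV r2" and e2: "\<forall>x. w2 x = exp (cdot \<zeta>2 x) * (1 + r2 x)"
      and n2: "cube_norm2 R r2 \<le> 16 * P\<^sup>2 / \<kappa>\<^sup>2 * cube_norm2 R (\<lambda>x::real^'n. 1)"
      and res2: "cube_norm2 R (\<lambda>x. l2 x - of_real (Q2 x) * w2 x) \<le> \<epsilon>"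
      using cgo[OF cQ(2) Q2(3) PM(2) \<zeta>(2) s2] by (elim exE conjE) (rule that)
    have small: "16 * P\<^sup>2 / \<kappa>\<^sup>2 * V \<le> V"
    proof -
      have "16 * P\<^sup>2 \<le> \<kappa>\<^sup>2" using power_mono[OF \<kappa>(1), of 2] P0 by (simp add: power_mult_distrib)
      then have "16 * P\<^sup>2 / \<kappa>\<^sup>2 \<le> 1" using \<kappa>0 by simp
      from mult_right_mono[OF this V0] show ?thesis by simp
    qed
    have wn: "(LINT x:\<Omega>|lborel. (cmod (w x))\<^sup>2) \<le> 4 * B\<^sup>2 * V"
      if w: "complex_C2 \<alpha> \<Omega> w l" and r: "continuous_on UNIV r" and e: "\<forall>x. w x = exp (cdot \<zeta> x) * (1 + r x)"
        and nr: "cube_norm2 R r \<le> 16 * P\<^sup>2 / \<kappa>\<^sup>2 * cube_norm2 R (\<lambda>x::real^'n. 1)"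
        and B: "B > 0" "\<forall>x\<in>cube R. cmod (exp (cdot \<zeta> x)) \<le> B" for w l r B and \<zeta> :: "complex^'n"
    proof -
      have cw: "continuous_on S w" and cr: "continuous_on S r" for S
        using w r unfolding complex_C2_def by (auto intro: continuous_on_subset)
      have "(LINT x:\<Omega>|lborel. (cmod (w x))\<^sup>2) \<le> cube_norm2 R w"
        unfolding cube_norm2_def by (intro integral_le_cube continuous_intros cw) auto
      also have "\<dots> \<le> B\<^sup>2 * cube_norm2 R (\<lambda>x. 1 + r x)"
      proof (rule cube_norm2_mono)
        show "cmod (w x) \<le> B * cmod (1 + r x)" if "x \<in> cube R" for x
          using e B(2) that by (simp add: norm_mult mult_right_mono)
      qed (use B in \<open>auto intro!: continuous_intros cw cr\<close>)
      also have "\<dots> \<le> B\<^sup>2 * (2 * V + 2 * cube_norm2 R r)"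
        unfolding V_def by (intro mult_left_mono cube_norm2_add_le continuous_intros cr) auto
      also have "\<dots> \<le> B\<^sup>2 * (2 * V + 2 * V)"
        using order_trans[OF nr[folded V_def] small] by (intro mult_left_mono add_left_mono) auto
      finally show ?thesis by simp
    qed
    have rn: "(LINT x:\<Omega>|lborel. (cmod (l x - of_real (q x) * w x))\<^sup>2) \<le> \<epsilon>"
      if w: "complex_C2 \<alpha> \<Omega> w l" and Q: "continuous_on UNIV Q" "\<forall>x\<in>closure \<Omega>. Q x = q x"
        and res: "cube_norm2 R (\<lambda>x. l x - of_real (Q x) * w x) \<le> \<epsilon>" for w l Q q
    proof -
      have cw: "continuous_on S w" and cl: "continuous_on S l" and cQ: "continuous_on S Q" for S
        using w Q unfolding complex_C2_def by (auto intro: continuous_on_subset)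
      have "continuous_on (closure \<Omega>) q" using cQ[of "closure \<Omega>"] Q(2) by (metis continuous_on_cong)
      then have "(LINT x:\<Omega>|lborel. (cmod (l x - of_real (q x) * w x))\<^sup>2) \<le> cube_norm2 R (\<lambda>x. l x - of_real (Q x) * w x)"
        unfolding cube_norm2_def using Q(2) closure_subset[of \<Omega>]
        by (intro integral_le_cube continuous_intros cw cl cQ) auto
      then show ?thesis using res by (rule order_trans)
    qed
    have "cmod (LINT x:\<Omega>|lborel. of_real (q1 x - q2 x) * (w1 x * w2 x)) \<le>
      2 * P * (s * ((LINT x:\<Omega>|lborel. (cmod (w1 x))\<^sup>2) + (LINT x:\<Omega>|lborel. (cmod (w2 x))\<^sup>2)) +
      (1 + 1 / s) * (16 * R^4) * ((LINT x:\<Omega>|lborel. (cmod (l1 x - of_real (q1 x) * w1 x))\<^sup>2) + (LINT x:\<Omega>|lborel. (cmod (l2 x - of_real (q2 x) * w2 x))\<^sup>2)))"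
      by (rule complex_pairing_bound[OF Pb s w1 w2])
    also have "\<dots> \<le> 2 * P * (s * A + (1 + 1 / s) * (16 * R^4) * (\<epsilon> + \<epsilon>))"
      unfolding A_def using P0 s
      by (intro mult_left_mono add_mono wn[OF w1 r1 e1 n1 B1] wn[OF w2 r2 e2 n2 B2] rn[OF w1 Q1(1,2) res1] rn[OF w2 Q2(1,2) res2]) auto
    also have "\<dots> \<le> \<eta>"
    proof -
      have "2 * P * (s * A) \<le> 2 * P * (s * (A + 1))" using P0 s by (intro mult_left_mono) auto
      also have "\<dots> = \<eta> / 2" using P0 A0 by (simp add: s_def)
      finally have "2 * P * (s * A) \<le> \<eta> / 2" .
      moreover define X where "X = (1 + 1 / s) * (16 * R^4)"
      have "8 * P * X > 0" unfolding X_def using P0 s R0 by (intro mult_pos_pos add_pos_pos) auto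
      then have "8 * P * X * (\<eta> / (8 * P * X)) = \<eta>" by (metis less_irrefl nonzero_mult_div_cancel_left times_divide_eq_right)
      then have "8 * P * X * \<epsilon> = \<eta>" by (simp only: \<epsilon>_def X_def mult.assoc)
      then have "2 * P * (X * (\<epsilon> + \<epsilon>)) = \<eta> / 2" by (simp add: algebra_simps)
      ultimately have "2 * P * (s * A) + 2 * P * (X * (\<epsilon> + \<epsilon>)) \<le> \<eta>" by linarith
      then show ?thesis by (simp only: X_def distrib_left)
    qed
    also have "(\<lambda>x. of_real (q1 x - q2 x) * (w1 x * w2 x)) = (\<lambda>x. of_real (q1 x - q2 x) * (cis (\<xi> \<bullet> x) * ((1 + r1 x) * (1 + r2 x))))"
    proof
      fix x
      have "w1 x * w2 x = exp (cdot \<zeta>1 x + cdot \<zeta>2 x) * ((1 + r1 x) * (1 + r2 x))"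
        using e1 e2 by (simp add: exp_add mult_ac)
      then show "of_real (q1 x - q2 x) * (w1 x * w2 x) = of_real (q1 x - q2 x) * (cis (\<xi> \<bullet> x) * ((1 + r1 x) * (1 + r2 x)))"
        using sum\<zeta> by (simp add: cis_conv_exp)
    qed
    finally show ?thesis using r1 r2 n1 n2 unfolding V_def by blast
  qed
  let ?I = "LINT x:\<Omega>|lborel. of_real (q1 x - q2 x) * cis (\<xi> \<bullet> x)"
  define \<kappa>0 where "\<kappa>0 = max 1 (max (4 * P) (\<mu> * norm \<xi>))"
  \<comment> \<open>The 32 arises from \<kappa> + 1 \<le> 2 \<kappa>, true as \<kappa> \<ge> 1,
    times the 16 P^2 / \<kappa>^2 of the corrections.\<close>
  define K where "K = P * V * (1 + 32 * P\<^sup>2)"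
  have K0: "K \<ge> 0" using P0 V0 by (simp add: K_def)
  have main: "cmod ?I \<le> K / \<kappa>" if \<kappa>: "\<kappa> \<ge> \<kappa>0" for \<kappa>
  proof (rule field_le_epsilon)
    fix \<eta> :: real assume \<eta>: "\<eta> > 0"
    have \<kappa>1: "\<kappa> \<ge> 1" "\<kappa> \<ge> 4 * P" "\<kappa> \<ge> \<mu> * norm \<xi>" using \<kappa> by (auto simp: \<kappa>0_def)
    obtain r1 r2 where r1: "continuous_on UNIV r1" and r2: "continuous_on UNIV r2"
      and n1: "cube_norm2 R r1 \<le> 16 * P\<^sup>2 / \<kappa>\<^sup>2 * V" and n2: "cube_norm2 R r2 \<le> 16 * P\<^sup>2 / \<kappa>\<^sup>2 * V"
      and I: "cmod (LINT x:\<Omega>|lborel. of_real (q1 x - q2 x) * (cis (\<xi> \<bullet> x) * ((1 + r1 x) * (1 + r2 x)))) \<le> \<eta>"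
      using rem[OF \<kappa>1(2,3) \<eta>] by (elim exE conjE) (rule that)
    have cr: "continuous_on S r1" "continuous_on S r2" for S using r1 r2 by (auto intro: continuous_on_subset)
    note cont = cr q1c q2c cU
    define G where "G x = of_real (q1 x - q2 x) * (cis (\<xi> \<bullet> x) * ((1 + r1 x) * (1 + r2 x)))" for x
    \<comment> \<open>Collects r1 + r2 + r1 r2 from expanding the product, so that the integrand of
      the Fourier coefficient is \<open>G x - H x\<close>.\<close>
    define H where "H x = of_real (q1 x - q2 x) * (cis (\<xi> \<bullet> x) * (r1 x + r2 x + r1 x * r2 x))" for x
    have iG: "set_integrable lborel \<Omega> G" unfolding G_def by (intro integrable_closure continuous_intros cont)
    have cH: "continuous_on (closure \<Omega>) H" unfolding H_def by (intro continuous_intros cont)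
    have iH: "set_integrable lborel \<Omega> H" by (rule integrable_closure[OF cH])
    have "?I = (LINT x:\<Omega>|lborel. G x - H x)" by (simp add: G_def H_def algebra_simps)
    also have "\<dots> = (LINT x:\<Omega>|lborel. G x) - (LINT x:\<Omega>|lborel. H x)" by (rule set_integral_diff(2)[OF iG iH])
    finally have "cmod ?I \<le> cmod (LINT x:\<Omega>|lborel. G x) + cmod (LINT x:\<Omega>|lborel. H x)"
      by (simp add: norm_triangle_ineq4)
    also have "cmod (LINT x:\<Omega>|lborel. G x) \<le> \<eta>" using I by (simp add: G_def)
    also have "cmod (LINT x:\<Omega>|lborel. H x) \<le> K / \<kappa>"
    proof -
      \<comment> \<open>Young's inequality with weight 1 / \<kappa>: the constant part contributes V
        / \<kappa>, and \<kappa> times the squared norms of r1, r2 is again O(1 / \<kappa>). Writing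
        \<open>(cmod 1)\<^sup>2\<close> lets the first integral be recognised as
        \<open>V\<close>.\<close>
      define N where "N x = P * (1 / \<kappa> * (cmod 1)\<^sup>2 + (\<kappa> + 1) / 2 * ((cmod (r1 x))\<^sup>2 + (cmod (r2 x))\<^sup>2))" for x :: "real^'n"
      have "cmod (LINT x:\<Omega>|lborel. H x) \<le> (LINT x:\<Omega>|lborel. cmod (H x))" by (rule set_integral_norm_bound[OF iH])
      also have "\<dots> \<le> (LINT x:cube R|lborel. N x)"
      proof (rule integral_le_cube)
        show "continuous_on (closure \<Omega>) (\<lambda>x. cmod (H x))" by (intro continuous_intros cH)
        show "continuous_on (cube R) N" unfolding N_def by (intro continuous_intros cr)
        show "0 \<le> N x" for x unfolding N_def using P0 \<kappa>1 by (intro mult_nonneg_nonneg add_nonneg_nonneg) auto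
        fix x assume x: "x \<in> \<Omega>"
        have \<kappa>p: "1 / \<kappa> > 0" using \<kappa>1 by simp
        have "cmod (r1 x + r2 x + r1 x * r2 x) \<le> \<bar>1 * cmod (r1 x)\<bar> + \<bar>1 * cmod (r2 x)\<bar> + \<bar>cmod (r1 x) * cmod (r2 x)\<bar>"
          by (simp add: norm_mult[symmetric]) (meson norm_triangle_le norm_triangle_ineq add_mono order_refl order_trans)
        also have "\<dots> \<le> (1 / \<kappa> * 1\<^sup>2 + (cmod (r1 x))\<^sup>2 / (1 / \<kappa>)) / 2 + (1 / \<kappa> * 1\<^sup>2 + (cmod (r2 x))\<^sup>2 / (1 / \<kappa>)) / 2
             + (1 * (cmod (r1 x))\<^sup>2 + (cmod (r2 x))\<^sup>2 / 1) / 2"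
          by (intro add_mono abs_mult_le_weighted \<kappa>p) auto
        also have "\<dots> = 1 / \<kappa> * (cmod 1)\<^sup>2 + (\<kappa> + 1) / 2 * ((cmod (r1 x))\<^sup>2 + (cmod (r2 x))\<^sup>2)"
          by (simp add: algebra_simps add_divide_distrib)
        finally have "cmod (r1 x + r2 x + r1 x * r2 x) \<le> 1 / \<kappa> * (cmod 1)\<^sup>2 + (\<kappa> + 1) / 2 * ((cmod (r1 x))\<^sup>2 + (cmod (r2 x))\<^sup>2)" .
        moreover have "cmod (H x) = \<bar>q1 x - q2 x\<bar> * cmod (r1 x + r2 x + r1 x * r2 x)"
          unfolding H_def norm_mult norm_of_real by simp
        ultimately show "cmod (H x) \<le> N x" unfolding N_def using Pb[OF x] P0 by (simp only:) (intro mult_mono, auto)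
      qed
      also have "(LINT x:cube R|lborel. N x) = P * (1 / \<kappa> * V + (\<kappa> + 1) / 2 * (cube_norm2 R r1 + cube_norm2 R r2))"
      proof -
        have i: "set_integrable lborel (cube R) (\<lambda>x::real^'n. 1 / \<kappa> * (cmod 1)\<^sup>2)"
          "set_integrable lborel (cube R) (\<lambda>x. (\<kappa> + 1) / 2 * ((cmod (r1 x))\<^sup>2 + (cmod (r2 x))\<^sup>2))"
          "set_integrable lborel (cube R) (\<lambda>x. (cmod (r1 x))\<^sup>2)" "set_integrable lborel (cube R) (\<lambda>x. (cmod (r2 x))\<^sup>2)"
          by (intro set_integrable_cube continuous_intros cr)+
        have "(LINT x:cube R|lborel. N x) = P * ((LINT x:(cube R :: (real^'n) set)|lborel. 1 / \<kappa> * (cmod 1)\<^sup>2) + (LINT x:cube R|lborel. (\<kappa> + 1) / 2 * ((cmod (r1 x))\<^sup>2 + (cmod (r2 x))\<^sup>2)))"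
          unfolding N_def set_integral_mult_right set_integral_add(2)[OF i(1,2)] ..
        also have "(LINT x:(cube R :: (real^'n) set)|lborel. 1 / \<kappa> * (cmod 1)\<^sup>2) = 1 / \<kappa> * V"
          unfolding V_def cube_norm2_def by (rule set_integral_mult_right)
        also have "(LINT x:cube R|lborel. (\<kappa> + 1) / 2 * ((cmod (r1 x))\<^sup>2 + (cmod (r2 x))\<^sup>2)) = (\<kappa> + 1) / 2 * (cube_norm2 R r1 + cube_norm2 R r2)"
          unfolding set_integral_mult_right set_integral_add(2)[OF i(3,4)] cube_norm2_def ..
        finally show ?thesis .
      qed
      also have "\<dots> \<le> P * (1 / \<kappa> * V + (\<kappa> + 1) / 2 * (16 * P\<^sup>2 / \<kappa>\<^sup>2 * V + 16 * P\<^sup>2 / \<kappa>\<^sup>2 * V))"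
        using P0 \<kappa>1 n1 n2 by (intro mult_left_mono add_left_mono add_mono) auto
      also have "\<dots> = P * V * (1 / \<kappa> + (\<kappa> + 1) * (16 * P\<^sup>2 / \<kappa>\<^sup>2))"
      proof -
        have "P * (c * V + (\<kappa> + 1) / 2 * (b * V + b * V)) = P * V * (c + (\<kappa> + 1) * b)" for b c
        proof -
          have "(\<kappa> + 1) / 2 * (b * V + b * V) = (\<kappa> + 1) * b * V" by (simp add: field_simps)
          then show ?thesis by (simp only:) (simp add: algebra_simps)
        qed
        then show ?thesis .
      qed
      also have "\<dots> \<le> P * V * (1 / \<kappa> + (2 * \<kappa>) * (16 * P\<^sup>2 / \<kappa>\<^sup>2))"
        using P0 V0 \<kappa>1 by (intro mult_left_mono add_left_mono mult_right_mono) auto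
      also have "\<dots> = K / \<kappa>" using \<kappa>1 by (simp add: K_def power2_eq_square field_simps)
      finally show ?thesis .
    qed
    finally show "cmod ?I \<le> K / \<kappa> + \<eta>" by simp
  qed
  have "cmod ?I \<le> K * \<epsilon>" if \<epsilon>: "\<epsilon> > 0" for \<epsilon>
  proof -
    have "cmod ?I \<le> K / max \<kappa>0 (1 / \<epsilon>)" by (rule main) simp
    also have "\<dots> \<le> K / (1 / \<epsilon>)" using K0 \<epsilon> by (intro divide_left_mono mult_pos_pos) (auto simp: less_max_iff_disj)
    finally show ?thesis by simp
  qed
  from le_mult_epsilon_imp_le_zero[OF this] show ?thesis by (simp add: \<xi>_def)
qed

text \<open>All lattice Fourier coefficients of p = q1 - q2 on \<open>\<Omega>\<close> vanish, so p
  is orthogonal to every unshifted trigonometric polynomial T. Approximating the extension of p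
  uniformly on the cube, the integral of p^2 equals that of p (p - T), which is at most \<eta> times
  the integral of |p|.\<close>

lemma potentials_equal:
  assumes n: "CARD('n) \<ge> 3" and x: "x \<in> \<Omega>"
  shows "q1 x = q2 x"
proof -
  define p where "p x = q1 x - q2 x" for x
  have pc: "continuous_on (closure \<Omega>) p" unfolding p_def by (intro continuous_intros q1c q2c)
  have "x \<in> closure \<Omega>" using x closure_subset by blast
  from R[OF this] have R0: "R > 0" using norm_ge_zero[of x] by linarith
  have comp: "\<forall>x\<in>closure \<Omega>. \<forall>i. \<bar>x $ i\<bar> < R"
  proof (intro ballI allI)
    fix x i assume "x \<in> closure \<Omega>"
    from R[OF this] show "\<bar>x $ i\<bar> < R" using component_le_norm_cart[of x i] by linarith
  qed
  obtain Q M where M: "M > 0" and Q: "continuous_on UNIV Q" "\<forall>x\<in>closure \<Omega>. Q x = p x"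
    "\<forall>x\<in>cube R. \<forall>i. \<bar>x $ i\<bar> = R \<longrightarrow> Q x = 0" "\<forall>x. \<bar>Q x\<bar> \<le> M"
    using extend_to_cube[OF compact_closure_domain comp pc] by (elim exE conjE) (rule that)
  have ip2: "set_integrable lborel \<Omega> (\<lambda>x. (p x)\<^sup>2)" by (intro integrable_closure continuous_intros pc)
  have "(LINT x:\<Omega>|lborel. (p x)\<^sup>2) \<le> (LINT x:\<Omega>|lborel. \<bar>p x\<bar>) * \<eta>" if \<eta>: "\<eta> > 0" for \<eta>
  proof -
    have "\<exists>c. finite {k. c k \<noteq> 0} \<and> (\<forall>x\<in>cube R. cmod (of_real (Q x) - trigpoly (pi / R) 0 c x) \<le> \<eta>)"
    proof (rule trig_approximation[OF R0 _ _ \<eta>])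
      show "continuous_on (cube R) (\<lambda>x. complex_of_real (Q x))"
        by (intro continuous_intros continuous_on_subset[OF Q(1)]) auto
    qed (use Q(3) in auto)
    then obtain c where c: "finite {k. c k \<noteq> 0}" "\<forall>x\<in>cube R. cmod (of_real (Q x) - trigpoly (pi / R) 0 c x) \<le> \<eta>" by blast
    let ?T = "trigpoly (pi / R) 0 c"
    have cT: "continuous_on (closure \<Omega>) ?T" by (rule continuous_on_trigpoly)
    have T0: "(LINT x:\<Omega>|lborel. of_real (p x) * ?T x) = 0"
    proof -
      have ik: "set_integrable lborel \<Omega> (\<lambda>x. c k * (of_real (p x) * cis ((pi / R) *\<^sub>R int_vec k \<bullet> x)))" for k
        by (intro integrable_closure continuous_intros pc)
      have "(LINT x:\<Omega>|lborel. of_real (p x) * ?T x) = (LINT x:\<Omega>|lborel. (\<Sum>k | c k \<noteq> 0. c k * (of_real (p x) * cis ((pi / R) *\<^sub>R int_vec k \<bullet> x))))"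
        by (simp add: trigpoly_def freq_def sum_distrib_left mult_ac)
      also have "\<dots> = (\<Sum>k | c k \<noteq> 0. (LINT x:\<Omega>|lborel. c k * (of_real (p x) * cis ((pi / R) *\<^sub>R int_vec k \<bullet> x))))"
        unfolding set_lebesgue_integral_def scaleR_sum_right
        by (rule Bochner_Integration.integral_sum) (use ik in \<open>simp only: set_integrable_def\<close>)
      also have "\<dots> = 0"
        unfolding set_integral_mult_right using fourier_coefficient_zero[OF n] by (simp add: p_def)
      finally show ?thesis .
    qed
    have sub: "x \<in> cube R" if "x \<in> \<Omega>" for x
      using comp that closure_subset[of \<Omega>] unfolding cube_def by (auto intro!: less_imp_le)
    have "complex_of_real (LINT x:\<Omega>|lborel. (p x)\<^sup>2) = (LINT x:\<Omega>|lborel. of_real ((p x)\<^sup>2))"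
      by (rule set_integral_complex_of_real[symmetric])
    also have "\<dots> = (LINT x:\<Omega>|lborel. of_real (p x) * (of_real (p x) - ?T x) + of_real (p x) * ?T x)"
      by (simp add: power2_eq_square algebra_simps)
    also have "\<dots> = (LINT x:\<Omega>|lborel. of_real (p x) * (of_real (p x) - ?T x)) + (LINT x:\<Omega>|lborel. of_real (p x) * ?T x)"
      by (intro set_integral_add integrable_closure continuous_intros pc cT)
    finally have "complex_of_real (LINT x:\<Omega>|lborel. (p x)\<^sup>2) = (LINT x:\<Omega>|lborel. of_real (p x) * (of_real (p x) - ?T x))"
      by (simp add: T0)
    then have "\<bar>LINT x:\<Omega>|lborel. (p x)\<^sup>2\<bar> = cmod (LINT x:\<Omega>|lborel. of_real (p x) * (of_real (p x) - ?T x))"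
      by (metis norm_of_real)
    also have "\<dots> \<le> (LINT x:\<Omega>|lborel. cmod (of_real (p x) * (of_real (p x) - ?T x)))"
      by (intro set_integral_norm_bound integrable_closure continuous_intros pc cT)
    also have "\<dots> \<le> (LINT x:\<Omega>|lborel. \<bar>p x\<bar> * \<eta>)"
    proof (rule set_integral_mono)
      show "cmod (of_real (p x) * (of_real (p x) - ?T x)) \<le> \<bar>p x\<bar> * \<eta>" if "x \<in> \<Omega>" for x
      proof -
        have "Q x = p x" using Q(2) that closure_subset by blast
        then have "cmod (of_real (p x) - ?T x) \<le> \<eta>" using c(2) sub[OF that] by metis
        then show ?thesis unfolding norm_mult norm_of_real by (intro mult_left_mono) auto
      qed
    qed (intro integrable_closure continuous_intros pc cT)+
    finally show ?thesis by simp
  qed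
  from le_mult_epsilon_imp_le_zero[OF this] have le0: "(LINT x:\<Omega>|lborel. (p x)\<^sup>2) \<le> 0" .
  have "(LINT x|lborel. indicator \<Omega> x *\<^sub>R (p x)\<^sup>2) = 0"
  proof (rule antisym)
    show "(LINT x|lborel. indicator \<Omega> x *\<^sub>R (p x)\<^sup>2) \<le> 0" using le0 by (simp add: set_lebesgue_integral_def)
    show "0 \<le> (LINT x|lborel. indicator \<Omega> x *\<^sub>R (p x)\<^sup>2)" by (intro integral_nonneg_AE AE_I2) simp
  qed
  then have ae: "AE x in lborel. indicator \<Omega> x *\<^sub>R (p x)\<^sup>2 = 0"
    using integral_nonneg_eq_0_iff_AE[of lborel "\<lambda>x. indicator \<Omega> x *\<^sub>R (p x)\<^sup>2"] ip2 by (simp add: set_integrable_def)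
  \<comment> \<open>From almost everywhere to everywhere: by continuity the set where
    \<open>p\<close> is nonzero is open, and a nonempty open set is not negligible.\<close>
  define S where "S = {y \<in> \<Omega>. p y \<noteq> 0}"
  have "open S"
  proof -
    have "open (\<Omega> \<inter> p -` (- {0}))"
      by (rule continuous_open_preimage[OF continuous_on_subset[OF pc closure_subset] op]) auto
    then show ?thesis by (simp add: S_def vimage_def Collect_conj_eq[symmetric] Int_def)
  qed
  moreover have "negligible S"
  proof -
    have "AE x in lborel. x \<notin> S" using ae by eventually_elim (auto simp: S_def)
    then have "AE x in lebesgue. x \<notin> S" by (rule AE_completion)
    then show ?thesis by (simp add: negligible_iff_null_sets AE_iff_null_sets[symmetric] \<open>open S\<close>)
  qed
  ultimately have "S = {}" using open_not_negligible by blast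
  then show ?thesis using x by (auto simp: S_def p_def)
qed

end

section \<open>The inverse problem\<close>

theorem theorem7p5:
  fixes \<Omega> :: "(real^'n) set"
    and \<alpha> \<delta>1 \<delta>2 :: real
    and a1 a2 :: "(real^'n) \<times> real \<times> (real^'n) \<Rightarrow> real"
    and V1 V2 :: "(real^'n \<Rightarrow> real) set"
    and \<Phi> :: "real^'n \<Rightarrow> real"
  assumes "CARD('n) \<ge> 3"
    and "0 < \<alpha>" and "\<alpha> < 1"
    and "open \<Omega>" and "connected \<Omega>" and "\<Omega> \<noteq> {}" and "bounded \<Omega>"
    and "holder_boundary 2 \<alpha> \<Omega>"
    and "holder_on 1 \<alpha> (\<Omega> \<times> UNIV \<times> UNIV) a1"
    and "holder_on 1 \<alpha> (\<Omega> \<times> UNIV \<times> UNIV) a2"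
    and "\<forall>x\<in>closure \<Omega>. \<forall>z p. a1 (x, z, p) > 0"
    and "\<forall>x\<in>closure \<Omega>. \<forall>z p. a2 (x, z, p) > 0"
    and "\<forall>x\<in>closure \<Omega>. \<forall>z p p'. a1 (x, z, p) = a1 (x, z, p')"
    and "\<forall>x\<in>closure \<Omega>. \<forall>z p p'. a2 (x, z, p) = a2 (x, z, p')"
    and "\<Phi> = (\<lambda>x. (norm x)\<^sup>2 / 2)"
    and "\<forall>x\<in>\<Omega>. \<forall>p. a1 (x, \<Phi> x, p) = 1"
    and "\<forall>x\<in>\<Omega>. \<forall>p. a2 (x, \<Phi> x, p) = 1"
    and "\<forall>x\<in>\<Omega>. \<forall>p. partial_z a1 x (\<Phi> x) p \<ge> 0"
    and "\<forall>x\<in>\<Omega>. \<forall>p. partial_z a2 x (\<Phi> x) p \<ge> 0"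
    and "well_posed \<Omega> \<alpha> a1 \<Phi> \<delta>1 V1"
    and "well_posed \<Omega> \<alpha> a2 \<Phi> \<delta>2 V2"
    and "cauchy_data \<Omega> \<alpha> a1 \<Phi> \<delta>1 V1 = cauchy_data \<Omega> \<alpha> a2 \<Phi> \<delta>2 V2"
  shows "\<forall>x\<in>\<Omega>. \<forall>p. partial_z a1 x (\<Phi> x) p = partial_z a2 x (\<Phi> x) p"
proof -
  note n = assms(1) and \<alpha> = assms(2,3) and op = assms(4) and ne = assms(6) and bd = assms(7) and hb = assms(8)
    and a1 = assms(9) and a2 = assms(10)
  have \<Phi>: "\<Phi> = quadratic" using assms(15) by (simp add: quadratic_def fun_eq_iff)
  have c\<Phi>: "continuous_on UNIV \<Phi>" unfolding assms(15) by (intro continuous_intros) auto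
  have cl: "x \<in> closure \<Omega>" if "x \<in> \<Omega>" for x using that closure_subset by blast
  have indep1: "\<forall>x\<in>\<Omega>. \<forall>z p. a1 (x, z, p) = a1 (x, z, 0)"
    using assms(13) cl by (intro ballI allI) (rule assms(13)[rule_format, OF cl])
  have indep2: "\<forall>x\<in>\<Omega>. \<forall>z p. a2 (x, z, p) = a2 (x, z, 0)"
    using assms(14) cl by (intro ballI allI) (rule assms(14)[rule_format, OF cl])
  \<comment> \<open>Reduces every p to the slice p = 0, in which the linear theory is
    stated.\<close>
  have pz: "partial_z a1 x z p = partial_z a1 x z 0" "partial_z a2 x z p = partial_z a2 x z 0" if "x \<in> \<Omega>" for x z p
    unfolding partial_z_def indep1[rule_format, OF that, of _ p] indep2[rule_format, OF that, of _ p] by (rule refl)+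
  \<comment> \<open>From here the potentials are continuous functions on the closure that agree with
    the z-derivatives inside.\<close>
  obtain q1 where q1: "continuous_on (closure \<Omega>) q1" "\<forall>x\<in>\<Omega>. q1 x = partial_z a1 x (\<Phi> x) 0"
    using partial_z_continuous_extension[OF a1 c\<Phi>] by (elim exE conjE) (rule that)
  obtain q2 where q2: "continuous_on (closure \<Omega>) q2" "\<forall>x\<in>\<Omega>. q2 x = partial_z a2 x (\<Phi> x) 0"
    using partial_z_continuous_extension[OF a2 c\<Phi>] by (elim exE conjE) (rule that)
  have q1p: "q1 x \<ge> 0" and q2p: "q2 x \<ge> 0" if "x \<in> \<Omega>" for x
    using q1(2) q2(2) assms(18,19) that by auto
  have "bounded (closure \<Omega>)" using bd by (rule bounded_closure)
  then obtain B where B: "\<And>x. x \<in> closure \<Omega> \<Longrightarrow> norm x \<le> B" by (auto simp: bounded_iff)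
  \<comment> \<open>The bound must be strict, so that the closure lies in the open cube and misses
    the faces on which the extended potentials vanish.\<close>
  have R: "norm x < B + 1" if "x \<in> closure \<Omega>" for x using B[OF that] by linarith
  have neg: "negligible (frontier \<Omega>)" by (rule negligible_frontier[OF op bd hb])
  have orth: "\<exists>v1 v2. holder_on 2 \<alpha> \<Omega> v1 \<and> holder_on 2 \<alpha> \<Omega> v2 \<and>
       (\<forall>x\<in>frontier \<Omega>. v1 x = w1 x \<and> v2 x = w2 x) \<and>
       (\<forall>x\<in>\<Omega>. laplacian v1 x = q1 x * v1 x \<and> laplacian v2 x = q2 x * v2 x) \<and>
       (LINT x:\<Omega>|lborel. (q1 x - q2 x) * (v1 x * v2 x)) = 0"
    if w: "holder_on 2 \<alpha> \<Omega> w1" "holder_on 2 \<alpha> \<Omega> w2" for w1 w2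
  proof -
    obtain v1 v2 where v: "holder_on 2 \<alpha> \<Omega> v1" "holder_on 2 \<alpha> \<Omega> v2"
       "\<forall>x\<in>frontier \<Omega>. v1 x = w1 x \<and> v2 x = w2 x"
       "\<forall>x\<in>\<Omega>. laplacian v1 x = partial_z a1 x (quadratic x) 0 * v1 x \<and> laplacian v2 x = partial_z a2 x (quadratic x) 0 * v2 x"
       "(LINT x:\<Omega>|lborel. (partial_z a1 x (quadratic x) 0 - partial_z a2 x (quadratic x) 0) * (v1 x * v2 x)) = 0"
      using linearised_orthogonality[OF op ne \<alpha> bd hb a1 a2 indep1 indep2 assms(20-22)[unfolded \<Phi>] w]
      by (elim exE conjE) (rule that)
    have "(LINT x:\<Omega>|lborel. (q1 x - q2 x) * (v1 x * v2 x))
        = (LINT x:\<Omega>|lborel. (partial_z a1 x (quadratic x) 0 - partial_z a2 x (quadratic x) 0) * (v1 x * v2 x))"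
      using op q1(2) q2(2) by (intro set_lebesgue_integral_cong) (auto simp: \<Phi>)
    then show ?thesis
      using v q1(2) q2(2) by (intro exI[of _ v1] exI[of _ v2]) (simp add: \<Phi>)
  qed
  show ?thesis
  proof (intro ballI allI)
    fix x p assume x: "x \<in> \<Omega>"
    have "q1 x = q2 x"
      by (rule potentials_equal[OF op ne \<alpha> bd neg R q1(1) q2(1) q1p q2p orth n x])
    then show "partial_z a1 x (\<Phi> x) p = partial_z a2 x (\<Phi> x) p"
      using q1(2) q2(2) x pz[OF x, of "\<Phi> x" p] by simp
  qed
qed

end
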